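(* Let $\mathbb G$ be an affine group scheme of finite type over $k$ and let $X \subset \mathcal O(\mathbb G)$ be a $k$-subspace. Denote by $i_{X*}: Mod(\mathbb G,X) \hookrightarrow Mod(\mathbb G)$ the full subcategory of $Mod(\mathbb G)$ whose objects are $X$-comodules. (1) $Mod(\mathbb G,X)$ is an abelian subcategory of $Mod(\mathbb G)$ which is closed under filtering colimits. (2) Sending a $\mathbb G$-module $M$ to its $\mathbb G$-submodule $M_X \subset M$ determines a functor $(-)_X: Mod(\mathbb G) \to Mod(\mathbb G,X)$. (3) The functor $(-)_X$ is left exact and is right adjoint to the embedding functor $i_{X*}: Mod(\mathbb G,X) \to Mod(\mathbb G)$.
   Context: $k$ is a field of characteristic $p>0$. $\mathcal O(\mathbb G)$ is the coordinate algebra of $\mathbb G$. $Mod(\mathbb G)$ is the abelian category of $\mathbb G$-modules, i.e. (possibly infinite dimensional) right $\mathcal O(\mathbb G)$-comodules $M$ over $k$ with coaction $\Delta_M: M \to M\otimes \mathcal O(\mathbb G)$. For a $k$-subspace $X \subset \mathcal O(\mathbb G)$, an $X$-comodule is a $\mathbb G$-module $M$ whose coaction $\Delta_M$ factors through $M\otimes X \subset M \otimes \mathcal O(\mathbb G)$. For a $\mathbb G$-module $M$, $M_X \subset M$ denotes the union (equivalently, the filtered colimit) of all $\mathbb G$-submodules of $M$ which are $X$-comodules. *)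

theory Defs
  imports "HOL-Algebra.Module" "HOL-Algebra.AbelCoset" "HOL-Algebra.Generated_Rings" "HOL-Library.Infinite_Typeclass"
begin

section \<open>Categories\<close>

text \<open>Hom-sets of different pairs of objects need not be disjoint, so composition and the additive
  structure take the objects as arguments: \<open>Cmp C x y z g f\<close> is the composite of
  \<open>f \<in> Hom C x y\<close> and \<open>g \<in> Hom C y z\<close>.\<close>

record ('o, 'f) category =
  Obj :: "'o set"
  Hom :: "'o \<Rightarrow> 'o \<Rightarrow> 'f set"
  Idn :: "'o \<Rightarrow> 'f"
  Cmp :: "'o \<Rightarrow> 'o \<Rightarrow> 'o \<Rightarrow> 'f \<Rightarrow> 'f \<Rightarrow> 'f"

record ('o, 'f) preadditive = "('o, 'f) category" +
  hom_add :: "'o \<Rightarrow> 'o \<Rightarrow> 'f \<Rightarrow> 'f \<Rightarrow> 'f"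
  hom_zero :: "'o \<Rightarrow> 'o \<Rightarrow> 'f"

record ('o, 'f, 'p, 'g) cat_functor =
  fobj :: "'o \<Rightarrow> 'p"
  fmap :: "'o \<Rightarrow> 'o \<Rightarrow> 'f \<Rightarrow> 'g"

definition is_category :: "('o, 'f, 'z) category_scheme \<Rightarrow> bool" where
  "is_category C \<longleftrightarrow>
     (\<forall>x\<in>Obj C. Idn C x \<in> Hom C x x) \<and>
     (\<forall>x\<in>Obj C. \<forall>y\<in>Obj C. \<forall>z\<in>Obj C. \<forall>f\<in>Hom C x y. \<forall>g\<in>Hom C y z.
        Cmp C x y z g f \<in> Hom C x z) \<and>
     (\<forall>x\<in>Obj C. \<forall>y\<in>Obj C. \<forall>f\<in>Hom C x y.
        Cmp C x x y f (Idn C x) = f \<and> Cmp C x y y (Idn C y) f = f) \<and>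
     (\<forall>w\<in>Obj C. \<forall>x\<in>Obj C. \<forall>y\<in>Obj C. \<forall>z\<in>Obj C.
        \<forall>f\<in>Hom C w x. \<forall>g\<in>Hom C x y. \<forall>h\<in>Hom C y z.
        Cmp C w y z h (Cmp C w x y g f) = Cmp C w x z (Cmp C x y z h g) f)"

definition is_functor ::
  "('o, 'f, 'z) category_scheme \<Rightarrow> ('p, 'g, 'w) category_scheme \<Rightarrow> ('o, 'f, 'p, 'g) cat_functor \<Rightarrow> bool"
  where
  "is_functor C D F \<longleftrightarrow>
     is_category C \<and> is_category D \<and>
     (\<forall>x\<in>Obj C. fobj F x \<in> Obj D) \<and>
     (\<forall>x\<in>Obj C. \<forall>y\<in>Obj C. \<forall>f\<in>Hom C x y. fmap F x y f \<in> Hom D (fobj F x) (fobj F y)) \<and>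
     (\<forall>x\<in>Obj C. fmap F x x (Idn C x) = Idn D (fobj F x)) \<and>
     (\<forall>x\<in>Obj C. \<forall>y\<in>Obj C. \<forall>z\<in>Obj C. \<forall>f\<in>Hom C x y. \<forall>g\<in>Hom C y z.
        fmap F x z (Cmp C x y z g f) =
          Cmp D (fobj F x) (fobj F y) (fobj F z) (fmap F y z g) (fmap F x y f))"

definition full_subcategory ::
  "('o, 'f, 'z) category_scheme \<Rightarrow> ('o, 'f, 'z) category_scheme \<Rightarrow> bool" where
  "full_subcategory S C \<longleftrightarrow> Obj S \<subseteq> Obj C \<and> S = C\<lparr>Obj := Obj S\<rparr>"

definition inclusion_functor :: "('o, 'f, 'o, 'f) cat_functor" where
  "inclusion_functor = \<lparr>fobj = \<lambda>x. x, fmap = \<lambda>x y f. f\<rparr>"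

definition right_adjoint ::
  "('o, 'f, 'z) category_scheme \<Rightarrow> ('p, 'g, 'w) category_scheme \<Rightarrow>
   ('o, 'f, 'p, 'g) cat_functor \<Rightarrow> ('p, 'g, 'o, 'f) cat_functor \<Rightarrow> bool" where
  \<comment> \<open>\<open>G : D \<rightarrow> C\<close> is right adjoint to \<open>F : C \<rightarrow> D\<close>: there is a bijection
      \<open>Hom D (F x) y \<cong> Hom C x (G y)\<close>, natural in \<open>x\<close> and \<open>y\<close>.\<close>
  "right_adjoint C D F G \<longleftrightarrow>
     is_functor C D F \<and> is_functor D C G \<and>
     (\<exists>\<phi>.
       (\<forall>x\<in>Obj C. \<forall>y\<in>Obj D.
          bij_betw (\<phi> x y) (Hom D (fobj F x) y) (Hom C x (fobj G y))) \<and>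
       (\<forall>x\<in>Obj C. \<forall>x'\<in>Obj C. \<forall>y\<in>Obj D. \<forall>y'\<in>Obj D.
          \<forall>u\<in>Hom C x' x. \<forall>v\<in>Hom D y y'. \<forall>h\<in>Hom D (fobj F x) y.
          \<phi> x' y' (Cmp D (fobj F x') y y' v (Cmp D (fobj F x') (fobj F x) y h (fmap F x' x u))) =
          Cmp C x' (fobj G y) (fobj G y') (fmap G y y' v)
            (Cmp C x' x (fobj G y) (\<phi> x y h) u)))"

subsection \<open>Filtered colimits\<close>

definition filtered_category :: "('i, 'j, 'z) category_scheme \<Rightarrow> bool" where
  "filtered_category J \<longleftrightarrow>
     is_category J \<and> Obj J \<noteq> {} \<and>
     (\<forall>i\<in>Obj J. \<forall>j\<in>Obj J. \<exists>k\<in>Obj J. Hom J i k \<noteq> {} \<and> Hom J j k \<noteq> {}) \<and>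
     (\<forall>i\<in>Obj J. \<forall>j\<in>Obj J. \<forall>u\<in>Hom J i j. \<forall>v\<in>Hom J i j.
        \<exists>k\<in>Obj J. \<exists>w\<in>Hom J j k. Cmp J i j k w u = Cmp J i j k w v)"

definition is_cocone ::
  "('i, 'j, 'z) category_scheme \<Rightarrow> ('o, 'f, 'w) category_scheme \<Rightarrow> ('i, 'j, 'o, 'f) cat_functor \<Rightarrow>
   'o \<Rightarrow> ('i \<Rightarrow> 'f) \<Rightarrow> bool" where
  "is_cocone J C F L \<gamma> \<longleftrightarrow>
     L \<in> Obj C \<and> (\<forall>i\<in>Obj J. \<gamma> i \<in> Hom C (fobj F i) L) \<and>
     (\<forall>i\<in>Obj J. \<forall>j\<in>Obj J. \<forall>u\<in>Hom J i j.
        Cmp C (fobj F i) (fobj F j) L (\<gamma> j) (fmap F i j u) = \<gamma> i)"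

definition is_colimit ::
  "('i, 'j, 'z) category_scheme \<Rightarrow> ('o, 'f, 'w) category_scheme \<Rightarrow> ('i, 'j, 'o, 'f) cat_functor \<Rightarrow>
   'o \<Rightarrow> ('i \<Rightarrow> 'f) \<Rightarrow> bool" where
  "is_colimit J C F L \<gamma> \<longleftrightarrow>
     is_cocone J C F L \<gamma> \<and>
     (\<forall>N \<delta>. is_cocone J C F N \<delta> \<longrightarrow>
        (\<exists>!u. u \<in> Hom C L N \<and> (\<forall>i\<in>Obj J. Cmp C (fobj F i) L N u (\<gamma> i) = \<delta> i)))"

definition closed_under_colimits_of ::
  "('i, 'j, 'z) category_scheme \<Rightarrow> ('o, 'f, 'w) category_scheme \<Rightarrow> ('o, 'f, 'w) category_scheme \<Rightarrow> bool"
  where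
  \<comment> \<open>Diagrams of shape \<open>J\<close> in \<open>S\<close> have colimits in the ambient category \<open>C\<close>, and these lie in \<open>S\<close>.\<close>
  "closed_under_colimits_of J S C \<longleftrightarrow>
     (\<forall>F. is_functor J S F \<longrightarrow>
        (\<exists>L \<gamma>. is_colimit J C F L \<gamma>) \<and> (\<forall>L \<gamma>. is_colimit J C F L \<gamma> \<longrightarrow> L \<in> Obj S))"

subsection \<open>Abelian categories\<close>

definition preadditive_category :: "('o, 'f, 'z) preadditive_scheme \<Rightarrow> bool" where
  "preadditive_category C \<longleftrightarrow>
     is_category C \<and>
     (\<forall>x\<in>Obj C. \<forall>y\<in>Obj C.
        comm_group \<lparr>carrier = Hom C x y, mult = hom_add C x y, one = hom_zero C x y\<rparr>) \<and>
     (\<forall>x\<in>Obj C. \<forall>y\<in>Obj C. \<forall>z\<in>Obj C.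
        \<forall>f\<in>Hom C x y. \<forall>f'\<in>Hom C x y. \<forall>g\<in>Hom C y z. \<forall>g'\<in>Hom C y z.
        Cmp C x y z g (hom_add C x y f f') =
          hom_add C x z (Cmp C x y z g f) (Cmp C x y z g f') \<and>
        Cmp C x y z (hom_add C y z g g') f =
          hom_add C x z (Cmp C x y z g f) (Cmp C x y z g' f))"

definition is_zero_object :: "('o, 'f, 'z) category_scheme \<Rightarrow> 'o \<Rightarrow> bool" where
  "is_zero_object C z \<longleftrightarrow>
     z \<in> Obj C \<and> (\<forall>x\<in>Obj C. (\<exists>!f. f \<in> Hom C x z) \<and> (\<exists>!f. f \<in> Hom C z x))"

definition is_biproduct ::
  "('o, 'f, 'z) preadditive_scheme \<Rightarrow> 'o \<Rightarrow> 'o \<Rightarrow> 'o \<Rightarrow> 'f \<Rightarrow> 'f \<Rightarrow> 'f \<Rightarrow> 'f \<Rightarrow> bool" where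
  "is_biproduct C x y s i\<^sub>1 i\<^sub>2 p\<^sub>1 p\<^sub>2 \<longleftrightarrow>
     s \<in> Obj C \<and> i\<^sub>1 \<in> Hom C x s \<and> i\<^sub>2 \<in> Hom C y s \<and> p\<^sub>1 \<in> Hom C s x \<and> p\<^sub>2 \<in> Hom C s y \<and>
     Cmp C x s x p\<^sub>1 i\<^sub>1 = Idn C x \<and> Cmp C y s y p\<^sub>2 i\<^sub>2 = Idn C y \<and>
     Cmp C y s x p\<^sub>1 i\<^sub>2 = hom_zero C y x \<and> Cmp C x s y p\<^sub>2 i\<^sub>1 = hom_zero C x y \<and>
     hom_add C s s (Cmp C s x s i\<^sub>1 p\<^sub>1) (Cmp C s y s i\<^sub>2 p\<^sub>2) = Idn C s"

definition additive_category :: "('o, 'f, 'z) preadditive_scheme \<Rightarrow> bool" where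
  "additive_category C \<longleftrightarrow>
     preadditive_category C \<and> (\<exists>z. is_zero_object C z) \<and>
     (\<forall>x\<in>Obj C. \<forall>y\<in>Obj C. \<exists>s i\<^sub>1 i\<^sub>2 p\<^sub>1 p\<^sub>2. is_biproduct C x y s i\<^sub>1 i\<^sub>2 p\<^sub>1 p\<^sub>2)"

definition is_kernel :: "('o, 'f, 'z) preadditive_scheme \<Rightarrow> 'o \<Rightarrow> 'o \<Rightarrow> 'f \<Rightarrow> 'o \<Rightarrow> 'f \<Rightarrow> bool" where
  \<comment> \<open>\<open>i : k \<rightarrow> x\<close> is a kernel of \<open>f : x \<rightarrow> y\<close>\<close>
  "is_kernel C x y f k i \<longleftrightarrow>
     k \<in> Obj C \<and> i \<in> Hom C k x \<and> Cmp C k x y f i = hom_zero C k y \<and>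
     (\<forall>w\<in>Obj C. \<forall>g\<in>Hom C w x. Cmp C w x y f g = hom_zero C w y \<longrightarrow>
        (\<exists>!u. u \<in> Hom C w k \<and> Cmp C w k x i u = g))"

definition is_cokernel :: "('o, 'f, 'z) preadditive_scheme \<Rightarrow> 'o \<Rightarrow> 'o \<Rightarrow> 'f \<Rightarrow> 'o \<Rightarrow> 'f \<Rightarrow> bool" where
  \<comment> \<open>\<open>q : y \<rightarrow> c\<close> is a cokernel of \<open>f : x \<rightarrow> y\<close>\<close>
  "is_cokernel C x y f c q \<longleftrightarrow>
     c \<in> Obj C \<and> q \<in> Hom C y c \<and> Cmp C x y c q f = hom_zero C x c \<and>
     (\<forall>w\<in>Obj C. \<forall>g\<in>Hom C y w. Cmp C x y w g f = hom_zero C x w \<longrightarrow>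
        (\<exists>!u. u \<in> Hom C c w \<and> Cmp C y c w u q = g))"

definition is_monic :: "('o, 'f, 'z) category_scheme \<Rightarrow> 'o \<Rightarrow> 'o \<Rightarrow> 'f \<Rightarrow> bool" where
  "is_monic C x y f \<longleftrightarrow>
     (\<forall>w\<in>Obj C. \<forall>g\<in>Hom C w x. \<forall>h\<in>Hom C w x. Cmp C w x y f g = Cmp C w x y f h \<longrightarrow> g = h)"

definition is_epic :: "('o, 'f, 'z) category_scheme \<Rightarrow> 'o \<Rightarrow> 'o \<Rightarrow> 'f \<Rightarrow> bool" where
  "is_epic C x y f \<longleftrightarrow>
     (\<forall>w\<in>Obj C. \<forall>g\<in>Hom C y w. \<forall>h\<in>Hom C y w. Cmp C x y w g f = Cmp C x y w h f \<longrightarrow> g = h)"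

definition abelian_category :: "('o, 'f, 'z) preadditive_scheme \<Rightarrow> bool" where
  "abelian_category C \<longleftrightarrow>
     additive_category C \<and>
     (\<forall>x\<in>Obj C. \<forall>y\<in>Obj C. \<forall>f\<in>Hom C x y.
        (\<exists>k i. is_kernel C x y f k i) \<and> (\<exists>c q. is_cokernel C x y f c q) \<and>
        (is_monic C x y f \<longrightarrow> (\<exists>z\<in>Obj C. \<exists>g\<in>Hom C y z. is_kernel C y z g x f)) \<and>
        (is_epic C x y f \<longrightarrow> (\<exists>w\<in>Obj C. \<exists>g\<in>Hom C w x. is_cokernel C w x g y f)))"

definition additive_functor ::
  "('o, 'f, 'z) preadditive_scheme \<Rightarrow> ('p, 'g, 'w) preadditive_scheme \<Rightarrow> ('o, 'f, 'p, 'g) cat_functor \<Rightarrow> bool"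
  where
  "additive_functor C D F \<longleftrightarrow>
     is_functor C D F \<and>
     (\<forall>x\<in>Obj C. \<forall>y\<in>Obj C. \<forall>f\<in>Hom C x y. \<forall>g\<in>Hom C x y.
        fmap F x y (hom_add C x y f g) =
          hom_add D (fobj F x) (fobj F y) (fmap F x y f) (fmap F x y g))"

text \<open>Exactness of \<open>0 \<rightarrow> k \<rightarrow> x \<rightarrow> y\<close> (of \<open>x \<rightarrow> y \<rightarrow> c \<rightarrow> 0\<close>) says that \<open>k \<rightarrow> x\<close> is a kernel of
  \<open>x \<rightarrow> y\<close> (that \<open>y \<rightarrow> c\<close> is a cokernel of \<open>x \<rightarrow> y\<close>).\<close>

definition left_exact ::
  "('o, 'f, 'z) preadditive_scheme \<Rightarrow> ('p, 'g, 'w) preadditive_scheme \<Rightarrow> ('o, 'f, 'p, 'g) cat_functor \<Rightarrow> bool"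
  where
  "left_exact C D F \<longleftrightarrow>
     additive_functor C D F \<and>
     (\<forall>x\<in>Obj C. \<forall>y\<in>Obj C. \<forall>f\<in>Hom C x y. \<forall>k i. is_kernel C x y f k i \<longrightarrow>
        is_kernel D (fobj F x) (fobj F y) (fmap F x y f) (fobj F k) (fmap F k x i))"

definition right_exact ::
  "('o, 'f, 'z) preadditive_scheme \<Rightarrow> ('p, 'g, 'w) preadditive_scheme \<Rightarrow> ('o, 'f, 'p, 'g) cat_functor \<Rightarrow> bool"
  where
  "right_exact C D F \<longleftrightarrow>
     additive_functor C D F \<and>
     (\<forall>x\<in>Obj C. \<forall>y\<in>Obj C. \<forall>f\<in>Hom C x y. \<forall>c q. is_cokernel C x y f c q \<longrightarrow>
        is_cokernel D (fobj F x) (fobj F y) (fmap F x y f) (fobj F c) (fmap F y c q))"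

definition abelian_subcategory ::
  "('o, 'f, 'z) preadditive_scheme \<Rightarrow> ('o, 'f, 'z) preadditive_scheme \<Rightarrow> bool" where
  "abelian_subcategory S C \<longleftrightarrow>
     full_subcategory S C \<and> abelian_category C \<and> abelian_category S \<and>
     left_exact S C inclusion_functor \<and> right_exact S C inclusion_functor"

section \<open>Tensor products of modules\<close>

definition module_hom ::
  "('r, 'q) ring_scheme \<Rightarrow> ('r, 'm, 'c) module_scheme \<Rightarrow> ('r, 'n, 'd) module_scheme \<Rightarrow> ('m \<Rightarrow> 'n) set"
  where
  "module_hom R M N =
     {h. h \<in> carrier M \<rightarrow> carrier N \<and>
         (\<forall>x\<in>carrier M. \<forall>y\<in>carrier M. h (x \<oplus>\<^bsub>M\<^esub> y) = h x \<oplus>\<^bsub>N\<^esub> h y) \<and>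
         (\<forall>r\<in>carrier R. \<forall>x\<in>carrier M. h (r \<odot>\<^bsub>M\<^esub> x) = r \<odot>\<^bsub>N\<^esub> h x)}"

text \<open>The fields \<open>mult\<close> and \<open>one\<close>, which modules inherit from the library's record type, carry no
  meaning for a module that is not an algebra.\<close>

definition free_module :: "('r, 'q) ring_scheme \<Rightarrow> 'b set \<Rightarrow> ('r, 'b \<Rightarrow> 'r) module" where
  "free_module R B =
     \<lparr>carrier = {f. (\<forall>b. f b \<in> carrier R) \<and> finite {b. f b \<noteq> \<zero>\<^bsub>R\<^esub>} \<and> {b. f b \<noteq> \<zero>\<^bsub>R\<^esub>} \<subseteq> B},
      mult = undefined, one = undefined,
      zero = \<lambda>b. \<zero>\<^bsub>R\<^esub>, add = \<lambda>f g b. f b \<oplus>\<^bsub>R\<^esub> g b, smult = \<lambda>r f b. r \<otimes>\<^bsub>R\<^esub> f b\<rparr>"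

definition free_gen :: "('r, 'q) ring_scheme \<Rightarrow> 'b \<Rightarrow> 'b \<Rightarrow> 'r" where
  "free_gen R b = (\<lambda>c. if c = b then \<one>\<^bsub>R\<^esub> else \<zero>\<^bsub>R\<^esub>)"

definition submodule_span ::
  "('r, 'q) ring_scheme \<Rightarrow> ('r, 'm) module \<Rightarrow> 'm set \<Rightarrow> 'm set" where
  "submodule_span R M S = \<Inter>{H. submodule H R M \<and> S \<subseteq> H}"

definition quotient_module ::
  "('r, 'q) ring_scheme \<Rightarrow> ('r, 'm) module \<Rightarrow> 'm set \<Rightarrow> ('r, 'm set) module" where
  "quotient_module R M H =
     \<lparr>carrier = a_rcosets\<^bsub>M\<^esub> H, mult = undefined, one = undefined,
      zero = H, add = set_add M, smult = \<lambda>r C. \<Union>c\<in>C. H +>\<^bsub>M\<^esub> (r \<odot>\<^bsub>M\<^esub> c)\<rparr>"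

definition tensor_relations ::
  "('r, 'q) ring_scheme \<Rightarrow> ('r, 'm, 'c) module_scheme \<Rightarrow> ('r, 'n, 'd) module_scheme \<Rightarrow> ('m \<times> 'n \<Rightarrow> 'r) set"
  where
  "tensor_relations R M N =
     (let F = free_module R (carrier M \<times> carrier N); \<delta> = (\<lambda>m n. free_gen R (m, n)) in
       {\<delta> (m \<oplus>\<^bsub>M\<^esub> m') n \<ominus>\<^bsub>F\<^esub> (\<delta> m n \<oplus>\<^bsub>F\<^esub> \<delta> m' n) | m m' n.
          m \<in> carrier M \<and> m' \<in> carrier M \<and> n \<in> carrier N} \<union>
       {\<delta> m (n \<oplus>\<^bsub>N\<^esub> n') \<ominus>\<^bsub>F\<^esub> (\<delta> m n \<oplus>\<^bsub>F\<^esub> \<delta> m n') | m n n'.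
          m \<in> carrier M \<and> n \<in> carrier N \<and> n' \<in> carrier N} \<union>
       {\<delta> (r \<odot>\<^bsub>M\<^esub> m) n \<ominus>\<^bsub>F\<^esub> (r \<odot>\<^bsub>F\<^esub> \<delta> m n) | r m n.
          r \<in> carrier R \<and> m \<in> carrier M \<and> n \<in> carrier N} \<union>
       {\<delta> m (r \<odot>\<^bsub>N\<^esub> n) \<ominus>\<^bsub>F\<^esub> (r \<odot>\<^bsub>F\<^esub> \<delta> m n) | r m n.
          r \<in> carrier R \<and> m \<in> carrier M \<and> n \<in> carrier N})"

definition tensor_submodule ::
  "('r, 'q) ring_scheme \<Rightarrow> ('r, 'm, 'c) module_scheme \<Rightarrow> ('r, 'n, 'd) module_scheme \<Rightarrow> ('m \<times> 'n \<Rightarrow> 'r) set"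
  where
  "tensor_submodule R M N =
     submodule_span R (free_module R (carrier M \<times> carrier N)) (tensor_relations R M N)"

definition tensor ::
  "('r, 'q) ring_scheme \<Rightarrow> ('r, 'm, 'c) module_scheme \<Rightarrow> ('r, 'n, 'd) module_scheme \<Rightarrow>
   ('r, ('m \<times> 'n \<Rightarrow> 'r) set) module" where
  "tensor R M N =
     quotient_module R (free_module R (carrier M \<times> carrier N)) (tensor_submodule R M N)"

definition pure_tensor ::
  "('r, 'q) ring_scheme \<Rightarrow> ('r, 'm, 'c) module_scheme \<Rightarrow> ('r, 'n, 'd) module_scheme \<Rightarrow>
   'm \<Rightarrow> 'n \<Rightarrow> ('m \<times> 'n \<Rightarrow> 'r) set" where
  "pure_tensor R M N m n =
     tensor_submodule R M N +>\<^bsub>free_module R (carrier M \<times> carrier N)\<^esub> free_gen R (m, n)"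

definition tensor_lift ::
  "('r, 'q) ring_scheme \<Rightarrow> ('r, 'm, 'c) module_scheme \<Rightarrow> ('r, 'n, 'd) module_scheme \<Rightarrow>
   ('r, 'p, 'e) module_scheme \<Rightarrow> ('m \<Rightarrow> 'n \<Rightarrow> 'p) \<Rightarrow> ('m \<times> 'n \<Rightarrow> 'r) set \<Rightarrow> 'p" where
  \<comment> \<open>The linear map \<open>M \<otimes> N \<rightarrow> P\<close> induced by a bilinear map \<open>b\<close> (unspecified if \<open>b\<close> is not bilinear).\<close>
  "tensor_lift R M N P b =
     (THE h. h \<in> module_hom R (tensor R M N) P \<inter> extensional (carrier (tensor R M N)) \<and>
        (\<forall>m\<in>carrier M. \<forall>n\<in>carrier N. h (pure_tensor R M N m n) = b m n))"

definition tensor_map ::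
  "('r, 'q) ring_scheme \<Rightarrow> ('r, 'm, 'c) module_scheme \<Rightarrow> ('r, 'n, 'd) module_scheme \<Rightarrow>
   ('r, 'm1, 'e) module_scheme \<Rightarrow> ('r, 'n1, 'g) module_scheme \<Rightarrow>
   ('m \<Rightarrow> 'm1) \<Rightarrow> ('n \<Rightarrow> 'n1) \<Rightarrow> ('m \<times> 'n \<Rightarrow> 'r) set \<Rightarrow> ('m1 \<times> 'n1 \<Rightarrow> 'r) set" where
  \<comment> \<open>\<open>f \<otimes> g : M \<otimes> N \<rightarrow> M' \<otimes> N'\<close>\<close>
  "tensor_map R M N M' N' f g =
     tensor_lift R M N (tensor R M' N') (\<lambda>m n. pure_tensor R M' N' (f m) (g n))"

definition tensor_assoc ::
  "('r, 'q) ring_scheme \<Rightarrow> ('r, 'm, 'c) module_scheme \<Rightarrow> ('r, 'n, 'd) module_scheme \<Rightarrow>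
   ('r, 'p, 'e) module_scheme \<Rightarrow>
   (('m \<times> 'n \<Rightarrow> 'r) set \<times> 'p \<Rightarrow> 'r) set \<Rightarrow> ('m \<times> ('n \<times> 'p \<Rightarrow> 'r) set \<Rightarrow> 'r) set" where
  \<comment> \<open>\<open>(M \<otimes> N) \<otimes> P \<rightarrow> M \<otimes> (N \<otimes> P)\<close>\<close>
  "tensor_assoc R M N P =
     (let T = tensor R M (tensor R N P) in
      tensor_lift R (tensor R M N) P T
        (\<lambda>t p. tensor_lift R M N T
           (\<lambda>m n. pure_tensor R M (tensor R N P) m (pure_tensor R N P n p)) t))"

definition tensor_algebra_product ::
  "('r, 'q) ring_scheme \<Rightarrow> ('r, 'm, 'c) module_scheme \<Rightarrow> ('r, 'n, 'd) module_scheme \<Rightarrow>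
   ('r, ('m \<times> 'n \<Rightarrow> 'r) set) module" where
  \<comment> \<open>The tensor product of two algebras, with \<open>(a \<otimes> b) (c \<otimes> d) = ac \<otimes> bd\<close>.\<close>
  "tensor_algebra_product R A B =
     (tensor R A B)
       \<lparr>mult := \<lambda>s t. tensor_lift R A B (tensor R A B)
          (\<lambda>a b. tensor_lift R A B (tensor R A B)
             (\<lambda>c d. pure_tensor R A B (a \<otimes>\<^bsub>A\<^esub> c) (b \<otimes>\<^bsub>B\<^esub> d)) t) s,
        one := pure_tensor R A B \<one>\<^bsub>A\<^esub> \<one>\<^bsub>B\<^esub>\<rparr>"

section \<open>Affine group schemes and their representations\<close>

record ('k, 'a) hopf_algebra = "('k, 'a) module" +
  comult :: "'a \<Rightarrow> ('a \<times> 'a \<Rightarrow> 'k) set"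
  counit :: "'a \<Rightarrow> 'k"
  antipode :: "'a \<Rightarrow> 'a"

text \<open>An affine group scheme over a field is given by its coordinate algebra, a commutative Hopf
  algebra.\<close>

locale affine_group_scheme = K?: field K + A?: algebra K A
  for K :: "'k ring" and A :: "('k, 'a) hopf_algebra" +
  assumes comult_linear: "comult A \<in> module_hom K A (tensor K A A)"
    and comult_ring_hom: "comult A \<in> ring_hom A (tensor_algebra_product K A A)"
    and counit_linear: "\<And>r a. r \<in> carrier K \<Longrightarrow> a \<in> carrier A \<Longrightarrow>
          counit A (r \<odot>\<^bsub>A\<^esub> a) = r \<otimes>\<^bsub>K\<^esub> counit A a"
    and counit_ring_hom: "counit A \<in> ring_hom A K"
    and antipode_linear: "antipode A \<in> module_hom K A A"
    and coassoc: "\<And>a. a \<in> carrier A \<Longrightarrow>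
          tensor_assoc K A A A (tensor_map K A A (tensor K A A) A (comult A) id (comult A a)) =
          tensor_map K A A A (tensor K A A) id (comult A) (comult A a)"
    and counit_left: "\<And>a. a \<in> carrier A \<Longrightarrow>
          tensor_lift K A A A (\<lambda>b c. counit A b \<odot>\<^bsub>A\<^esub> c) (comult A a) = a"
    and counit_right: "\<And>a. a \<in> carrier A \<Longrightarrow>
          tensor_lift K A A A (\<lambda>b c. counit A c \<odot>\<^bsub>A\<^esub> b) (comult A a) = a"
    and antipode_left: "\<And>a. a \<in> carrier A \<Longrightarrow>
          tensor_lift K A A A (\<lambda>b c. antipode A b \<otimes>\<^bsub>A\<^esub> c) (comult A a) =
          counit A a \<odot>\<^bsub>A\<^esub> \<one>\<^bsub>A\<^esub>"
    and antipode_right: "\<And>a. a \<in> carrier A \<Longrightarrow>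
          tensor_lift K A A A (\<lambda>b c. b \<otimes>\<^bsub>A\<^esub> antipode A c) (comult A a) =
          counit A a \<odot>\<^bsub>A\<^esub> \<one>\<^bsub>A\<^esub>"

definition has_characteristic :: "('r, 'q) ring_scheme \<Rightarrow> nat \<Rightarrow> bool" where
  "has_characteristic R p \<longleftrightarrow> (\<forall>n::nat. [n] \<cdot>\<^bsub>R\<^esub> \<one>\<^bsub>R\<^esub> = \<zero>\<^bsub>R\<^esub> \<longleftrightarrow> p dvd n)"

definition finite_type :: "('k, 'q) ring_scheme \<Rightarrow> ('k, 'a, 'c) module_scheme \<Rightarrow> bool" where
  \<comment> \<open>\<open>A\<close> is generated as a \<open>K\<close>-algebra, i.e. as a ring over the image of \<open>K\<close>, by finitely many
      elements.\<close>
  "finite_type K A \<longleftrightarrow>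
     (\<exists>S \<subseteq> carrier A. finite S \<and>
        generate_ring A (S \<union> (\<lambda>r. r \<odot>\<^bsub>A\<^esub> \<one>\<^bsub>A\<^esub>) ` carrier K) = carrier A)"

record ('k, 'a, 'm) comodule = "('k, 'm) module" +
  coact :: "'m \<Rightarrow> ('m \<times> 'a \<Rightarrow> 'k) set"

definition is_comodule :: "'k ring \<Rightarrow> ('k, 'a) hopf_algebra \<Rightarrow> ('k, 'a, 'm) comodule \<Rightarrow> bool" where
  "is_comodule K A M \<longleftrightarrow>
     module K M \<and> coact M \<in> module_hom K M (tensor K M A) \<and>
     (\<forall>m\<in>carrier M.
        tensor_assoc K M A A (tensor_map K M A (tensor K M A) A (coact M) id (coact M m)) =
        tensor_map K M A M (tensor K A A) id (comult A) (coact M m)) \<and>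
     (\<forall>m\<in>carrier M. tensor_lift K M A M (\<lambda>n a. counit A a \<odot>\<^bsub>M\<^esub> n) (coact M m) = m)"

definition tensor_image ::
  "'k ring \<Rightarrow> ('k, 'm, 'c) module_scheme \<Rightarrow> ('k, 'a, 'd) module_scheme \<Rightarrow> 'm set \<Rightarrow> 'a set \<Rightarrow>
   ('m \<times> 'a \<Rightarrow> 'k) set set" where
  \<comment> \<open>\<open>W \<otimes> Y\<close> as a subspace of \<open>M \<otimes> A\<close>\<close>
  "tensor_image K M A W Y =
     tensor_map K (M\<lparr>carrier := W\<rparr>) (A\<lparr>carrier := Y\<rparr>) M A id id `
       carrier (tensor K (M\<lparr>carrier := W\<rparr>) (A\<lparr>carrier := Y\<rparr>))"

definition subcomodule :: "'k ring \<Rightarrow> ('k, 'a) hopf_algebra \<Rightarrow> ('k, 'a, 'm) comodule \<Rightarrow> 'm set \<Rightarrow> bool"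
  where
  "subcomodule K A M W \<longleftrightarrow>
     submodule W K M \<and> coact M ` W \<subseteq> tensor_image K M A W (carrier A)"

definition restrict_comodule ::
  "'k ring \<Rightarrow> ('k, 'a) hopf_algebra \<Rightarrow> ('k, 'a, 'm) comodule \<Rightarrow> 'm set \<Rightarrow> ('k, 'a, 'm) comodule" where
  \<comment> \<open>As \<open>W \<otimes> A\<close> is not literally a subset of \<open>M \<otimes> A\<close>, the coaction of \<open>W\<close> is obtained by pulling
      that of \<open>M\<close> back along the injection \<open>W \<otimes> A \<rightarrow> M \<otimes> A\<close>.\<close>
  "restrict_comodule K A M W =
     M\<lparr>carrier := W,
       coact := \<lambda>w. THE t. t \<in> carrier (tensor K (M\<lparr>carrier := W\<rparr>) A) \<and>
         tensor_map K (M\<lparr>carrier := W\<rparr>) A M A id id t = coact M w\<rparr>"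

definition X_comodule ::
  "'k ring \<Rightarrow> ('k, 'a) hopf_algebra \<Rightarrow> 'a set \<Rightarrow> ('k, 'a, 'm) comodule \<Rightarrow> bool" where
  "X_comodule K A X M \<longleftrightarrow>
     is_comodule K A M \<and> coact M ` carrier M \<subseteq> tensor_image K M A (carrier M) X"

definition comodule_hom ::
  "'k ring \<Rightarrow> ('k, 'a) hopf_algebra \<Rightarrow> ('k, 'a, 'm) comodule \<Rightarrow> ('k, 'a, 'm) comodule \<Rightarrow> ('m \<Rightarrow> 'm) set"
  where
  "comodule_hom K A M N =
     {f \<in> module_hom K M N \<inter> extensional (carrier M).
        \<forall>m\<in>carrier M. coact N (f m) = tensor_map K M A N A f id (coact M m)}"

text \<open>The type \<open>'m\<close> plays the role of the universe: the objects of \<open>ModG K A\<close> are the comodules whose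
  underlying set is a subset of \<open>'m\<close>. It has to be infinite for direct sums to exist. A diagram is small if
  the objects and arrows of its index category can be taken from \<open>'m\<close>.
  Arrows are functions set to \<open>undefined\<close> outside the carrier of the source, so that equal
  homomorphisms are equal as arrows.\<close>

definition ModG ::
  "'k ring \<Rightarrow> ('k, 'a) hopf_algebra \<Rightarrow> (('k, 'a, 'm::infinite) comodule, 'm \<Rightarrow> 'm) preadditive" where
  "ModG K A =
     \<lparr>Obj = {M. is_comodule K A M},
      Hom = comodule_hom K A,
      Idn = \<lambda>M. restrict id (carrier M),
      Cmp = \<lambda>M N P g f. compose (carrier M) g f,
      hom_add = \<lambda>M N f g. \<lambda>m\<in>carrier M. f m \<oplus>\<^bsub>N\<^esub> g m,
      hom_zero = \<lambda>M N. \<lambda>m\<in>carrier M. \<zero>\<^bsub>N\<^esub>\<rparr>"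

definition ModGX ::
  "'k ring \<Rightarrow> ('k, 'a) hopf_algebra \<Rightarrow> 'a set \<Rightarrow>
   (('k, 'a, 'm::infinite) comodule, 'm \<Rightarrow> 'm) preadditive" where
  "ModGX K A X = (ModG K A)\<lparr>Obj := {M. X_comodule K A X M}\<rparr>"

definition X_part_carrier ::
  "'k ring \<Rightarrow> ('k, 'a) hopf_algebra \<Rightarrow> 'a set \<Rightarrow> ('k, 'a, 'm) comodule \<Rightarrow> 'm set" where
  "X_part_carrier K A X M =
     \<Union>{W. subcomodule K A M W \<and> X_comodule K A X (restrict_comodule K A M W)}"

definition X_part ::
  "'k ring \<Rightarrow> ('k, 'a) hopf_algebra \<Rightarrow> 'a set \<Rightarrow> ('k, 'a, 'm) comodule \<Rightarrow> ('k, 'a, 'm) comodule" where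
  "X_part K A X M = restrict_comodule K A M (X_part_carrier K A X M)"

definition X_part_functor ::
  "'k ring \<Rightarrow> ('k, 'a) hopf_algebra \<Rightarrow> 'a set \<Rightarrow>
   (('k, 'a, 'm) comodule, 'm \<Rightarrow> 'm, ('k, 'a, 'm) comodule, 'm \<Rightarrow> 'm) cat_functor" where
  "X_part_functor K A X =
     \<lparr>fobj = X_part K A X, fmap = \<lambda>M N f. restrict f (X_part_carrier K A X M)\<rparr>"

end

theory Submission
  imports Defs
begin

text \<open>Three facts about vector spaces and comodules carry the proof.

First, over a field every subspace has a complement (Zorn's lemma, \<open>subspace_complement\<close>), so every
linear map \<open>f\<close> has a linear \<open>s\<close> with \<open>f s f = f\<close> (\<open>linear_generalized_inverse\<close>).  Tensoring this
equation with \<open>A\<close> replaces all flatness arguments: \<open>f \<otimes> 1\<close> is injective if \<open>f\<close> is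
(\<open>tensor_map_injective\<close>), and an element of \<open>M \<otimes> X\<close> killed by \<open>f \<otimes> 1\<close> lies in \<open>ker f \<otimes> X\<close>
(\<open>tensor_map_kernel\<close>).

Second, coassociativity and the counit law travel along colinear maps in both directions: to the target
if the images of such maps span it (\<open>comodule_generated\<close>), to the source if the map is injective
(\<open>comodule_embedded\<close>).  Hence kernels and images carry a comodule structure, and so does any vector-space
colimit of comodules: the coactions of its pieces assemble to a coaction by the universal property, and the
pieces span it (\<open>small_colimit\<close>).  Cokernels, biproducts, the zero object and filtered colimits are all
such colimits.

Third, for a subspace \<open>X \<subseteq> A\<close> the condition \<open>\<Delta> W \<subseteq> W \<otimes> X\<close> on a subspace \<open>W\<close> of \<open>M\<close> is stable under
images of colinear maps, under kernels and under sums (\<open>X_subcomodule_image\<close>, \<open>X_subcomodule_kernel\<close>,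
\<open>X_subcomodule_sum\<close>), and it says that \<open>W\<close> is a subcomodule which is an \<open>X\<close>-comodule
(\<open>X_subcomodule_iff\<close>).  Stability under sums makes the union \<open>M\<^sub>X\<close> of all these \<open>W\<close> again such a
subspace; stability under images makes \<open>M \<mapsto> M\<^sub>X\<close> a functor and gives
\<open>Hom(M, N\<^sub>X) = Hom(M, N)\<close> for every \<open>X\<close>-comodule \<open>M\<close>, which is the adjunction.

The category of all comodules is the case \<open>X = A\<close>, so both categories are treated at once.  For every
\<open>X\<close> the categorical kernels are exactly the injective colinear maps onto the set-theoretic kernel, and
the cokernels are exactly the surjective ones whose kernel is the image (\<open>kernel_iff\<close>,
\<open>cokernel_iff\<close>).  These descriptions depend on \<open>X\<close> only in that the new object has to be an
\<open>X\<close>-comodule, so the inclusion is exact; and left exactness of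
\<open>M \<mapsto> M\<^sub>X\<close> is read off from the first one.\<close>

section \<open>Linear maps\<close>

lemma module_homI:
  assumes "\<And>x. x \<in> carrier M \<Longrightarrow> h x \<in> carrier N"
    and "\<And>x y. x \<in> carrier M \<Longrightarrow> y \<in> carrier M \<Longrightarrow> h (x \<oplus>\<^bsub>M\<^esub> y) = h x \<oplus>\<^bsub>N\<^esub> h y"
    and "\<And>r x. r \<in> carrier R \<Longrightarrow> x \<in> carrier M \<Longrightarrow> h (r \<odot>\<^bsub>M\<^esub> x) = r \<odot>\<^bsub>N\<^esub> h x"
  shows "h \<in> module_hom R M N"
  using assms by (auto simp: module_hom_def)

lemma module_hom_closed: "h \<in> module_hom R M N \<Longrightarrow> x \<in> carrier M \<Longrightarrow> h x \<in> carrier N"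
  by (auto simp: module_hom_def)

lemma module_hom_add:
  "h \<in> module_hom R M N \<Longrightarrow> x \<in> carrier M \<Longrightarrow> y \<in> carrier M \<Longrightarrow> h (x \<oplus>\<^bsub>M\<^esub> y) = h x \<oplus>\<^bsub>N\<^esub> h y"
  by (auto simp: module_hom_def)

lemma module_hom_smult:
  "h \<in> module_hom R M N \<Longrightarrow> r \<in> carrier R \<Longrightarrow> x \<in> carrier M \<Longrightarrow> h (r \<odot>\<^bsub>M\<^esub> x) = r \<odot>\<^bsub>N\<^esub> h x"
  by (auto simp: module_hom_def)

lemma module_hom_zero:
  assumes "module R M" "module R N" "h \<in> module_hom R M N"
  shows "h \<zero>\<^bsub>M\<^esub> = \<zero>\<^bsub>N\<^esub>"
proof -
  interpret M: module R M by fact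
  interpret N: module R N by fact
  have "h \<zero>\<^bsub>M\<^esub> = h (\<zero>\<^bsub>R\<^esub> \<odot>\<^bsub>M\<^esub> \<zero>\<^bsub>M\<^esub>)" by simp
  also have "\<dots> = \<zero>\<^bsub>R\<^esub> \<odot>\<^bsub>N\<^esub> h \<zero>\<^bsub>M\<^esub>"
    using assms(3) by (intro module_hom_smult) auto
  also have "\<dots> = \<zero>\<^bsub>N\<^esub>"
    using module_hom_closed[OF assms(3)] by simp
  finally show ?thesis .
qed

lemma module_hom_minus:
  assumes "module R M" "module R N" "h \<in> module_hom R M N" "x \<in> carrier M" "y \<in> carrier M"
  shows "h (x \<ominus>\<^bsub>M\<^esub> y) = h x \<ominus>\<^bsub>N\<^esub> h y"
proof -
  interpret M: module R M by fact
  interpret N: module R N by fact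
  have y: "h y \<in> carrier N" using assms module_hom_closed by metis
  have "\<ominus>\<^bsub>M\<^esub> y = (\<ominus>\<^bsub>R\<^esub> \<one>\<^bsub>R\<^esub>) \<odot>\<^bsub>M\<^esub> y"
    using assms by (simp add: M.smult_l_minus)
  then have "h (\<ominus>\<^bsub>M\<^esub> y) = (\<ominus>\<^bsub>R\<^esub> \<one>\<^bsub>R\<^esub>) \<odot>\<^bsub>N\<^esub> h y"
    using assms by (simp add: module_hom_smult)
  also have "\<dots> = \<ominus>\<^bsub>N\<^esub> h y" using y by (simp add: N.smult_l_minus)
  finally show ?thesis
    using assms by (simp add: a_minus_def module_hom_add[OF assms(3)])
qed

lemma module_hom_id: "id \<in> module_hom R M M"
  by (auto simp: module_hom_def)

lemma module_hom_comp:
  "f \<in> module_hom R M N \<Longrightarrow> g \<in> module_hom R N P \<Longrightarrow> (\<lambda>x. g (f x)) \<in> module_hom R M P"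
  by (auto simp: module_hom_def Pi_iff)

lemma module_hom_cong:
  assumes "module R M" "\<And>x. x \<in> carrier M \<Longrightarrow> f x = g x" "f \<in> module_hom R M N"
  shows "g \<in> module_hom R M N"
proof -
  interpret M: module R M by fact
  show ?thesis
    using assms(2,3) by (auto simp: module_hom_def Pi_iff)
qed

lemma module_hom_restrict:
  assumes "module R M" "f \<in> module_hom R M N"
  shows "restrict f (carrier M) \<in> module_hom R M N \<inter> extensional (carrier M)"
  using module_hom_cong[OF assms(1) _ assms(2), of "restrict f (carrier M)"] by simp

lemma module_hom_const_zero:
  assumes "module R N"
  shows "(\<lambda>_. \<zero>\<^bsub>N\<^esub>) \<in> module_hom R M N"
proof -
  interpret N: module R N by fact
  show ?thesis by (auto simp: module_hom_def)
qed

lemma module_hom_sum: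
  assumes "module R M" "module R N" "f \<in> module_hom R M N" "g \<in> module_hom R M N"
  shows "(\<lambda>x. f x \<oplus>\<^bsub>N\<^esub> g x) \<in> module_hom R M N"
proof -
  interpret M: module R M by fact
  interpret N: module R N by fact
  show ?thesis
  proof (rule module_homI, goal_cases)
    case (1 x) then show ?case using assms(3,4) by (auto intro: module_hom_closed)
  next
    case (2 x y)
    then show ?case
      using module_hom_closed[OF assms(3)] module_hom_closed[OF assms(4)]
      by (simp add: module_hom_add[OF assms(3)] module_hom_add[OF assms(4)] N.a_ac)
  next
    case (3 r x)
    then show ?case
      using module_hom_closed[OF assms(3)] module_hom_closed[OF assms(4)]
      by (simp add: module_hom_smult[OF assms(3)] module_hom_smult[OF assms(4)] N.smult_r_distr)
  qed
qed

lemma module_hom_smult_const: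
  assumes "module R M" "module R N" "f \<in> module_hom R M N" "r \<in> carrier R"
  shows "(\<lambda>x. r \<odot>\<^bsub>N\<^esub> f x) \<in> module_hom R M N"
proof -
  interpret M: module R M by fact
  interpret N: module R N by fact
  show ?thesis
  proof (rule module_homI, goal_cases)
    case (1 x) then show ?case using assms(3,4) by (auto intro: module_hom_closed)
  next
    case (2 x y)
    then show ?case
      using module_hom_closed[OF assms(3)] assms(4)
      by (simp add: module_hom_add[OF assms(3)] N.smult_r_distr)
  next
    case (3 s x)
    then have "f x \<in> carrier N" using module_hom_closed[OF assms(3)] by auto
    then show ?case
      using 3 assms(4)
      by (simp add: module_hom_smult[OF assms(3)] N.smult_assoc1[symmetric] M.R.m_comm)
  qed
qed

lemma module_hom_diff:
  assumes "module R M" "module R N" "f \<in> module_hom R M N" "g \<in> module_hom R M N"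
  shows "(\<lambda>x. f x \<ominus>\<^bsub>N\<^esub> g x) \<in> module_hom R M N"
proof -
  interpret M: module R M by fact
  interpret N: module R N by fact
  have "(\<lambda>x. f x \<oplus>\<^bsub>N\<^esub> (\<ominus>\<^bsub>R\<^esub> \<one>\<^bsub>R\<^esub>) \<odot>\<^bsub>N\<^esub> g x) \<in> module_hom R M N"
    using assms by (intro module_hom_sum module_hom_smult_const) auto
  then show ?thesis
    by (rule module_hom_cong[OF assms(1), rotated])
       (use module_hom_closed[OF assms(4)] in \<open>simp add: a_minus_def N.smult_l_minus\<close>)
qed

lemma submodule_iff:
  assumes "module R M"
  shows "submodule H R M \<longleftrightarrow> H \<subseteq> carrier M \<and> \<zero>\<^bsub>M\<^esub> \<in> H \<and> (\<forall>x\<in>H. \<forall>y\<in>H. x \<oplus>\<^bsub>M\<^esub> y \<in> H) \<and>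
    (\<forall>r\<in>carrier R. \<forall>x\<in>H. r \<odot>\<^bsub>M\<^esub> x \<in> H)"
proof -
  interpret M: module R M by fact
  show ?thesis
  proof (intro iffI conjI ballI)
    assume H: "submodule H R M"
    show "H \<subseteq> carrier M" "\<And>x y. x \<in> H \<Longrightarrow> y \<in> H \<Longrightarrow> x \<oplus>\<^bsub>M\<^esub> y \<in> H"
      "\<And>r x. r \<in> carrier R \<Longrightarrow> x \<in> H \<Longrightarrow> r \<odot>\<^bsub>M\<^esub> x \<in> H"
      using M.submoduleE[OF H] by auto
    show "\<zero>\<^bsub>M\<^esub> \<in> H"
      using subgroup.one_closed[OF submodule.axioms(1)[OF H]] by simp
  next
    assume H: "H \<subseteq> carrier M \<and> \<zero>\<^bsub>M\<^esub> \<in> H \<and> (\<forall>x\<in>H. \<forall>y\<in>H. x \<oplus>\<^bsub>M\<^esub> y \<in> H) \<and>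
      (\<forall>r\<in>carrier R. \<forall>x\<in>H. r \<odot>\<^bsub>M\<^esub> x \<in> H)"
    show "submodule H R M"
    proof (rule M.submoduleI)
      fix x assume "x \<in> H"
      then have "\<ominus>\<^bsub>M\<^esub> x = (\<ominus>\<^bsub>R\<^esub> \<one>\<^bsub>R\<^esub>) \<odot>\<^bsub>M\<^esub> x"
        using H by (auto simp: M.smult_l_minus subset_iff)
      then show "\<ominus>\<^bsub>M\<^esub> x \<in> H" using H \<open>x \<in> H\<close> by simp
    qed (use H in auto)
  qed
qed

lemma submodule_minus:
  assumes "module R M" "submodule H R M" "x \<in> H" "y \<in> H"
  shows "x \<ominus>\<^bsub>M\<^esub> y \<in> H"
proof -
  interpret M: module R M by fact
  show ?thesis using M.submoduleE[OF assms(2)] assms(3,4) by (auto simp: a_minus_def)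
qed

lemma submodule_sum:
  assumes M: "module R M" and V: "submodule V R M" and W: "submodule W R M"
  shows "submodule {v \<oplus>\<^bsub>M\<^esub> w | v w. v \<in> V \<and> w \<in> W} R M" (is "submodule ?U R M")
    and "V \<subseteq> {v \<oplus>\<^bsub>M\<^esub> w | v w. v \<in> V \<and> w \<in> W}" "W \<subseteq> {v \<oplus>\<^bsub>M\<^esub> w | v w. v \<in> V \<and> w \<in> W}"
proof -
  interpret M: module R M by fact
  note sub = submodule_iff[OF M]
  have c: "V \<subseteq> carrier M" "\<zero>\<^bsub>M\<^esub> \<in> V" "W \<subseteq> carrier M" "\<zero>\<^bsub>M\<^esub> \<in> W" using V W by (simp_all add: sub)
  have UI: "v \<oplus>\<^bsub>M\<^esub> w \<in> ?U" if "v \<in> V" "w \<in> W" for v w using that by blast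
  show VU: "V \<subseteq> ?U"
  proof
    fix v assume v: "v \<in> V"
    have "v \<oplus>\<^bsub>M\<^esub> \<zero>\<^bsub>M\<^esub> = v" using v c by auto
    then show "v \<in> ?U" using UI[OF v c(4)] by (simp only:)
  qed
  show "W \<subseteq> ?U"
  proof
    fix w assume w: "w \<in> W"
    have "\<zero>\<^bsub>M\<^esub> \<oplus>\<^bsub>M\<^esub> w = w" using w c by auto
    then show "w \<in> ?U" using UI[OF c(2) w] by (simp only:)
  qed
  show "submodule ?U R M"
    unfolding sub
  proof (intro conjI ballI)
    show "?U \<subseteq> carrier M" using c by auto
    show "\<zero>\<^bsub>M\<^esub> \<in> ?U" using VU c by blast
  next
    fix x y assume "x \<in> ?U" "y \<in> ?U"
    then obtain v w v' w' where *: "v \<in> V" "w \<in> W" "v' \<in> V" "w' \<in> W" "x = v \<oplus>\<^bsub>M\<^esub> w" "y = v' \<oplus>\<^bsub>M\<^esub> w'"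
      by blast
    then have "x \<oplus>\<^bsub>M\<^esub> y = (v \<oplus>\<^bsub>M\<^esub> v') \<oplus>\<^bsub>M\<^esub> (w \<oplus>\<^bsub>M\<^esub> w')" using c by (simp add: M.a_ac subset_iff)
    moreover have "v \<oplus>\<^bsub>M\<^esub> v' \<in> V" "w \<oplus>\<^bsub>M\<^esub> w' \<in> W" using V W * by (simp_all add: sub)
    ultimately show "x \<oplus>\<^bsub>M\<^esub> y \<in> ?U" using UI by simp
  next
    fix r x assume "r \<in> carrier R" "x \<in> ?U"
    then obtain v w where *: "r \<in> carrier R" "v \<in> V" "w \<in> W" "x = v \<oplus>\<^bsub>M\<^esub> w" by blast
    then have "r \<odot>\<^bsub>M\<^esub> x = r \<odot>\<^bsub>M\<^esub> v \<oplus>\<^bsub>M\<^esub> r \<odot>\<^bsub>M\<^esub> w" using c by (simp add: M.smult_r_distr subset_iff)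
    moreover have "r \<odot>\<^bsub>M\<^esub> v \<in> V" "r \<odot>\<^bsub>M\<^esub> w \<in> W" using V W * by (simp_all add: sub)
    ultimately show "r \<odot>\<^bsub>M\<^esub> x \<in> ?U" using UI by simp
  qed
qed

lemma submodule_multiples:
  assumes M: "module R M" and m: "m \<in> carrier M"
  shows "submodule {r \<odot>\<^bsub>M\<^esub> m | r. r \<in> carrier R} R M"
proof -
  interpret M: module R M by fact
  show ?thesis
    unfolding submodule_iff[OF M]
  proof (intro conjI ballI)
    show "\<zero>\<^bsub>M\<^esub> \<in> {r \<odot>\<^bsub>M\<^esub> m | r. r \<in> carrier R}" using m M.smult_l_null by force
  qed (use m in \<open>auto simp: M.smult_l_distr[symmetric] M.smult_assoc1[symmetric]\<close>)
qed

lemma submodule_module: "module R M \<Longrightarrow> submodule H R M \<Longrightarrow> module R (M\<lparr>carrier := H\<rparr>)"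
  by (rule submodule.submodule_is_module)

lemma module_hom_image:
  assumes "module R M" "module R N" "h \<in> module_hom R M N" "submodule W R M"
  shows "submodule (h ` W) R N"
proof -
  have W: "W \<subseteq> carrier M" "\<zero>\<^bsub>M\<^esub> \<in> W" "\<And>x y. x \<in> W \<Longrightarrow> y \<in> W \<Longrightarrow> x \<oplus>\<^bsub>M\<^esub> y \<in> W"
    "\<And>r x. r \<in> carrier R \<Longrightarrow> x \<in> W \<Longrightarrow> r \<odot>\<^bsub>M\<^esub> x \<in> W"
    using assms(4) by (auto simp: submodule_iff[OF assms(1)])
  have "h ` W \<subseteq> carrier N" using W module_hom_closed[OF assms(3)] by auto
  moreover have "\<zero>\<^bsub>N\<^esub> \<in> h ` W"
    by (rule rev_image_eqI[OF W(2)]) (simp add: module_hom_zero[OF assms(1-3)])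
  moreover have "h x \<oplus>\<^bsub>N\<^esub> h y \<in> h ` W" if "x \<in> W" "y \<in> W" for x y
    using W(1) that by (intro rev_image_eqI[OF W(3)[OF that]]) (simp add: module_hom_add[OF assms(3)] subsetD[OF W(1)])
  moreover have "r \<odot>\<^bsub>N\<^esub> h x \<in> h ` W" if "r \<in> carrier R" "x \<in> W" for r x
    using W(1) that by (intro rev_image_eqI[OF W(4)[OF that]]) (simp add: module_hom_smult[OF assms(3)] subsetD[OF W(1)])
  ultimately show ?thesis by (auto simp: submodule_iff[OF assms(2)])
qed

lemma module_hom_kernel:
  assumes "module R M" "module R N" "h \<in> module_hom R M N"
  shows "submodule {x \<in> carrier M. h x = \<zero>\<^bsub>N\<^esub>} R M"
proof -
  interpret M: module R M by fact
  interpret N: module R N by fact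
  show ?thesis
    using module_hom_zero[OF assms]
    by (auto simp: submodule_iff[OF assms(1)] module_hom_add[OF assms(3)] module_hom_smult[OF assms(3)])
qed

lemma module_hom_equalizer:
  assumes "module R M" "module R N" "f \<in> module_hom R M N" "g \<in> module_hom R M N"
  shows "submodule {x \<in> carrier M. f x = g x} R M"
proof -
  interpret M: module R M by fact
  show ?thesis
    using module_hom_zero[OF assms(1,2,3)] module_hom_zero[OF assms(1,2,4)]
    by (auto simp: submodule_iff[OF assms(1)] module_hom_add[OF assms(3)] module_hom_smult[OF assms(3)]
       module_hom_add[OF assms(4)] module_hom_smult[OF assms(4)])
qed

lemma minus_eq_zero_iff:
  assumes "module R M" "x \<in> carrier M" "y \<in> carrier M"
  shows "x \<ominus>\<^bsub>M\<^esub> y = \<zero>\<^bsub>M\<^esub> \<longleftrightarrow> x = y"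
proof -
  interpret M: module R M by fact
  show ?thesis
    using assms M.minus_equality[of x "\<ominus>\<^bsub>M\<^esub> y"] by (auto simp: a_minus_def M.r_neg)
qed

text \<open>A linear map descends along a surjection whose kernel it kills.  This one lemma provides the universal
property of quotients, hence of presented modules and tensor products, and the maps out of cokernels.\<close>

lemma factor_through_surjection:
  assumes M: "module R M" and Q: "module R Q" and P: "module R P"
    and q: "q \<in> module_hom R M Q" and surj: "q ` carrier M = carrier Q"
    and g: "g \<in> module_hom R M P"
    and ker: "\<And>m. m \<in> carrier M \<Longrightarrow> q m = \<zero>\<^bsub>Q\<^esub> \<Longrightarrow> g m = \<zero>\<^bsub>P\<^esub>"
  obtains u where "u \<in> module_hom R Q P" "\<And>m. m \<in> carrier M \<Longrightarrow> u (q m) = g m"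
proof -
  interpret M: module R M by fact
  interpret Q: module R Q by fact
  interpret P: module R P by fact
  define u where "u = (\<lambda>y. g (inv_into (carrier M) q y))"
  have u: "u (q m) = g m" if m: "m \<in> carrier M" for m
  proof -
    define m' where "m' = inv_into (carrier M) q (q m)"
    have m': "m' \<in> carrier M" "q m' = q m"
      using m by (auto simp: m'_def inv_into_into f_inv_into_f)
    have "q (m' \<ominus>\<^bsub>M\<^esub> m) = \<zero>\<^bsub>Q\<^esub>"
      using m m' module_hom_closed[OF q] by (simp add: module_hom_minus[OF M Q q] minus_eq_zero_iff[OF Q])
    then have "g (m' \<ominus>\<^bsub>M\<^esub> m) = \<zero>\<^bsub>P\<^esub>" using m m' by (simp add: ker)
    then have "g m' = g m"
      using m m' module_hom_closed[OF g] by (simp add: module_hom_minus[OF M P g] minus_eq_zero_iff[OF P])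
    then show ?thesis by (simp add: u_def m'_def)
  qed
  have "u \<in> module_hom R Q P"
  proof (rule module_homI)
    fix x assume "x \<in> carrier Q"
    then obtain m where "m \<in> carrier M" "x = q m" using surj by blast
    then show "u x \<in> carrier P" by (simp add: u module_hom_closed[OF g])
  next
    fix x y assume "x \<in> carrier Q" "y \<in> carrier Q"
    then obtain m n where m: "m \<in> carrier M" "x = q m" "n \<in> carrier M" "y = q n" using surj by blast
    then have "x \<oplus>\<^bsub>Q\<^esub> y = q (m \<oplus>\<^bsub>M\<^esub> n)" by (simp add: module_hom_add[OF q])
    then show "u (x \<oplus>\<^bsub>Q\<^esub> y) = u x \<oplus>\<^bsub>P\<^esub> u y" using m by (simp add: u module_hom_add[OF g])
  next
    fix r x assume "r \<in> carrier R" "x \<in> carrier Q"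
    then obtain m where m: "r \<in> carrier R" "m \<in> carrier M" "x = q m" using surj by blast
    then have "r \<odot>\<^bsub>Q\<^esub> x = q (r \<odot>\<^bsub>M\<^esub> m)" by (simp add: module_hom_smult[OF q])
    then show "u (r \<odot>\<^bsub>Q\<^esub> x) = r \<odot>\<^bsub>P\<^esub> u x" using m by (simp add: u module_hom_smult[OF g])
  qed
  with u that show thesis by blast
qed

section \<open>Complements of subspaces\<close>

text \<open>A subspace \<open>C\<close> maximal among those meeting \<open>W\<close> only in \<open>0\<close> is a complement: a vector \<open>m\<close> outside
\<open>W + C\<close> could be added to \<open>C\<close>, since \<open>w = c + r m\<close> with \<open>r \<noteq> 0\<close> would give \<open>m \<in> W + C\<close> after
division by \<open>r\<close>.\<close>

lemma subspace_complement:
  assumes K: "field K" and M: "module K M" and W: "submodule W K M"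
  obtains C where "submodule C K M" "W \<inter> C = {\<zero>\<^bsub>M\<^esub>}"
    "\<And>m. m \<in> carrier M \<Longrightarrow> \<exists>w\<in>W. \<exists>c\<in>C. m = w \<oplus>\<^bsub>M\<^esub> c"
proof -
  interpret K: field K by fact
  interpret M: module K M by fact
  note sub = submodule_iff[OF M]
  have Wc: "W \<subseteq> carrier M" "\<zero>\<^bsub>M\<^esub> \<in> W" using W by (auto simp: sub)
  define \<A> where "\<A> = {C. submodule C K M \<and> W \<inter> C = {\<zero>\<^bsub>M\<^esub>}}"
  have "\<exists>C\<in>\<A>. \<forall>D\<in>\<A>. C \<subseteq> D \<longrightarrow> D = C"
  proof (rule subset_Zorn_nonempty)
    have "{\<zero>\<^bsub>M\<^esub>} \<in> \<A>" using Wc by (auto simp: \<A>_def sub)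
    then show "\<A> \<noteq> {}" by blast
  next
    fix \<C> assume ne: "\<C> \<noteq> {}" and ch: "subset.chain \<A> \<C>"
    have mem: "C \<in> \<C> \<Longrightarrow> submodule C K M \<and> W \<inter> C = {\<zero>\<^bsub>M\<^esub>}" for C
      using ch by (auto simp: subset_chain_def \<A>_def)
    have "submodule (\<Union>\<C>) K M" unfolding sub
    proof (intro conjI ballI)
      show "\<Union>\<C> \<subseteq> carrier M" using mem unfolding sub by blast
      show "\<zero>\<^bsub>M\<^esub> \<in> \<Union>\<C>" using mem ne by blast
      show "\<And>r x. r \<in> carrier K \<Longrightarrow> x \<in> \<Union>\<C> \<Longrightarrow> r \<odot>\<^bsub>M\<^esub> x \<in> \<Union>\<C>" using mem unfolding sub by blast
      fix x y assume "x \<in> \<Union>\<C>" "y \<in> \<Union>\<C>"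
      then obtain C D where CD: "C \<in> \<C>" "D \<in> \<C>" "x \<in> C" "y \<in> D" by blast
      then have "C \<subseteq> D \<or> D \<subseteq> C" using ch by (auto simp: subset_chain_def)
      then show "x \<oplus>\<^bsub>M\<^esub> y \<in> \<Union>\<C>"
      proof
        assume "C \<subseteq> D"
        then have "x \<oplus>\<^bsub>M\<^esub> y \<in> D" using CD mem[OF CD(2)] by (auto simp: sub)
        then show ?thesis using CD by blast
      next
        assume "D \<subseteq> C"
        then have "x \<oplus>\<^bsub>M\<^esub> y \<in> C" using CD mem[OF CD(1)] by (auto simp: sub)
        then show ?thesis using CD by blast
      qed
    qed
    moreover have "W \<inter> \<Union>\<C> = {\<zero>\<^bsub>M\<^esub>}" using mem ne by blast
    ultimately show "\<Union>\<C> \<in> \<A>" by (simp add: \<A>_def)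
  qed
  then obtain C where C: "submodule C K M" "W \<inter> C = {\<zero>\<^bsub>M\<^esub>}"
    and max: "\<And>D. submodule D K M \<Longrightarrow> W \<inter> D = {\<zero>\<^bsub>M\<^esub>} \<Longrightarrow> C \<subseteq> D \<Longrightarrow> D = C"
    by (auto simp: \<A>_def)
  have Cc: "C \<subseteq> carrier M" "\<zero>\<^bsub>M\<^esub> \<in> C" using C by (auto simp: sub)
  have "\<exists>w\<in>W. \<exists>c\<in>C. m = w \<oplus>\<^bsub>M\<^esub> c" if m: "m \<in> carrier M" for m
  proof (rule ccontr)
    assume contra: "\<not> ?thesis"
    let ?Km = "{r \<odot>\<^bsub>M\<^esub> m | r. r \<in> carrier K}"
    define D where "D = {c \<oplus>\<^bsub>M\<^esub> x | c x. c \<in> C \<and> x \<in> ?Km}"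
    note Km = submodule_multiples[OF M m]
    have "submodule D K M" unfolding D_def by (rule submodule_sum(1)[OF M C(1) Km])
    moreover have "W \<inter> D = {\<zero>\<^bsub>M\<^esub>}"
    proof -
      have "x = \<zero>\<^bsub>M\<^esub>" if x: "x \<in> W" "x \<in> D" for x
      proof -
        obtain c r where *: "c \<in> C" "r \<in> carrier K" "x = c \<oplus>\<^bsub>M\<^esub> r \<odot>\<^bsub>M\<^esub> m"
          using x(2) by (auto simp: D_def)
        have cx: "c \<in> carrier M" "x \<in> carrier M" using * x Wc Cc by auto
        have "r = \<zero>\<^bsub>K\<^esub>"
        proof (rule ccontr)
          assume r: "r \<noteq> \<zero>\<^bsub>K\<^esub>"
          then have ri: "inv\<^bsub>K\<^esub> r \<in> carrier K" "inv\<^bsub>K\<^esub> r \<otimes>\<^bsub>K\<^esub> r = \<one>\<^bsub>K\<^esub>"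
            using * K.field_Units by auto
          have "r \<odot>\<^bsub>M\<^esub> m = x \<oplus>\<^bsub>M\<^esub> (\<ominus>\<^bsub>M\<^esub> c)"
            using * cx m by (simp add: M.a_ac M.r_neg M.a_assoc[symmetric] M.r_neg1)
          moreover have "m = inv\<^bsub>K\<^esub> r \<odot>\<^bsub>M\<^esub> (r \<odot>\<^bsub>M\<^esub> m)"
            using ri * m by (simp add: M.smult_assoc1[symmetric])
          ultimately have "m = inv\<^bsub>K\<^esub> r \<odot>\<^bsub>M\<^esub> x \<oplus>\<^bsub>M\<^esub> inv\<^bsub>K\<^esub> r \<odot>\<^bsub>M\<^esub> (\<ominus>\<^bsub>M\<^esub> c)"
            using ri cx by (simp add: M.smult_r_distr)
          moreover have "inv\<^bsub>K\<^esub> r \<odot>\<^bsub>M\<^esub> x \<in> W" "inv\<^bsub>K\<^esub> r \<odot>\<^bsub>M\<^esub> (\<ominus>\<^bsub>M\<^esub> c) \<in> C"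
            using W C ri x * M.submoduleE[OF W] M.submoduleE[OF C(1)] by auto
          ultimately show False using contra by blast
        qed
        then have "x = c" using * cx m by simp
        then show ?thesis using C(2) * x by blast
      qed
      moreover have "\<zero>\<^bsub>M\<^esub> \<in> D" using \<open>submodule D K M\<close> by (simp add: sub)
      ultimately show ?thesis using Wc by blast
    qed
    moreover have "C \<subseteq> D" unfolding D_def by (rule submodule_sum(2)[OF M C(1) Km])
    ultimately have "D = C" using max by blast
    moreover have "m \<in> D"
      using submodule_sum(3)[OF M C(1) Km] M.smult_one[OF m, symmetric] K.one_closed unfolding D_def by blast
    ultimately have "m \<in> C" by simp
    moreover have "m = \<zero>\<^bsub>M\<^esub> \<oplus>\<^bsub>M\<^esub> m" using m by simp
    ultimately show False using contra Wc by blast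
  qed
  with C that show thesis by blast
qed

lemma linear_retraction:
  assumes K: "field K" and M: "module K M" and W: "submodule W K M"
  obtains \<rho> where "\<rho> \<in> module_hom K M (M\<lparr>carrier := W\<rparr>)" "\<And>w. w \<in> W \<Longrightarrow> \<rho> w = w"
proof -
  interpret K: field K by fact
  interpret M: module K M by fact
  obtain C where C: "submodule C K M" "W \<inter> C = {\<zero>\<^bsub>M\<^esub>}"
    and WC: "\<And>m. m \<in> carrier M \<Longrightarrow> \<exists>w\<in>W. \<exists>c\<in>C. m = w \<oplus>\<^bsub>M\<^esub> c"
    using subspace_complement[OF assms] by blast
  note sub = submodule_iff[OF M]
  have Wc: "W \<subseteq> carrier M" "\<zero>\<^bsub>M\<^esub> \<in> W" "C \<subseteq> carrier M" "\<zero>\<^bsub>M\<^esub> \<in> C" using W C by (auto simp: sub)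
  define \<rho> where "\<rho> = (\<lambda>m. SOME w. w \<in> W \<and> (\<exists>c\<in>C. m = w \<oplus>\<^bsub>M\<^esub> c))"
  have \<rho>: "\<rho> (w \<oplus>\<^bsub>M\<^esub> c) = w" if wc: "w \<in> W" "c \<in> C" for w c
    unfolding \<rho>_def
  proof (rule some_equality)
    show "w \<in> W \<and> (\<exists>d\<in>C. w \<oplus>\<^bsub>M\<^esub> c = w \<oplus>\<^bsub>M\<^esub> d)" using wc by blast
    fix v assume "v \<in> W \<and> (\<exists>d\<in>C. w \<oplus>\<^bsub>M\<^esub> c = v \<oplus>\<^bsub>M\<^esub> d)"
    then obtain d where d: "v \<in> W" "d \<in> C" "w \<oplus>\<^bsub>M\<^esub> c = v \<oplus>\<^bsub>M\<^esub> d" by blast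
    have car: "v \<in> carrier M" "w \<in> carrier M" "c \<in> carrier M" "d \<in> carrier M" using d wc Wc by auto
    have "v = (v \<oplus>\<^bsub>M\<^esub> d) \<ominus>\<^bsub>M\<^esub> d"
      using car by (simp add: a_minus_def M.a_assoc M.r_neg)
    also have "\<dots> = (c \<ominus>\<^bsub>M\<^esub> d) \<oplus>\<^bsub>M\<^esub> w"
      using car d(3)[symmetric] by (simp add: a_minus_def M.a_ac)
    finally have "v \<ominus>\<^bsub>M\<^esub> w = ((c \<ominus>\<^bsub>M\<^esub> d) \<oplus>\<^bsub>M\<^esub> w) \<ominus>\<^bsub>M\<^esub> w"
      by simp
    also have "\<dots> = c \<ominus>\<^bsub>M\<^esub> d"
      using car by (simp add: a_minus_def M.a_assoc M.r_neg)
    finally have eq: "v \<ominus>\<^bsub>M\<^esub> w = c \<ominus>\<^bsub>M\<^esub> d" .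
    have "v \<ominus>\<^bsub>M\<^esub> w \<in> W" "c \<ominus>\<^bsub>M\<^esub> d \<in> C"
      using submodule_minus[OF M W] submodule_minus[OF M C(1)] d wc by auto
    with eq C(2) have "v \<ominus>\<^bsub>M\<^esub> w = \<zero>\<^bsub>M\<^esub>" by auto
    then show "v = w" using minus_eq_zero_iff[OF M] car by blast
  qed
  have "\<rho> \<in> module_hom K M (M\<lparr>carrier := W\<rparr>)"
  proof (rule module_homI, simp_all)
    fix m assume "m \<in> carrier M"
    then obtain w c where "w \<in> W" "c \<in> C" "m = w \<oplus>\<^bsub>M\<^esub> c" using WC by blast
    then show "\<rho> m \<in> W" by (simp add: \<rho>)
  next
    fix m n assume "m \<in> carrier M" "n \<in> carrier M"
    then obtain w c v d where *: "w \<in> W" "c \<in> C" "m = w \<oplus>\<^bsub>M\<^esub> c" "v \<in> W" "d \<in> C" "n = v \<oplus>\<^bsub>M\<^esub> d"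
      using WC by metis
    then have "m \<oplus>\<^bsub>M\<^esub> n = (w \<oplus>\<^bsub>M\<^esub> v) \<oplus>\<^bsub>M\<^esub> (c \<oplus>\<^bsub>M\<^esub> d)" using Wc by (simp add: M.a_ac subset_iff)
    then show "\<rho> (m \<oplus>\<^bsub>M\<^esub> n) = \<rho> m \<oplus>\<^bsub>M\<^esub> \<rho> n" using * W C by (simp add: \<rho> sub)
  next
    fix r m assume "r \<in> carrier K" "m \<in> carrier M"
    then obtain w c where *: "r \<in> carrier K" "w \<in> W" "c \<in> C" "m = w \<oplus>\<^bsub>M\<^esub> c" using WC by blast
    then have "r \<odot>\<^bsub>M\<^esub> m = r \<odot>\<^bsub>M\<^esub> w \<oplus>\<^bsub>M\<^esub> r \<odot>\<^bsub>M\<^esub> c" using Wc by (simp add: M.smult_r_distr subset_iff)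
    then show "\<rho> (r \<odot>\<^bsub>M\<^esub> m) = r \<odot>\<^bsub>M\<^esub> \<rho> m" using * W C by (simp add: \<rho> sub)
  qed
  moreover have "\<rho> w = w" if "w \<in> W" for w
    using \<rho>[OF that Wc(4)] that Wc by auto
  ultimately show thesis using that by blast
qed

text \<open>With \<open>\<rho>\<close> a retraction onto \<open>ker f\<close>, the map \<open>1 - \<rho>\<close> factors through the image of \<open>f\<close> as \<open>t f\<close>; a
retraction onto that image extends \<open>t\<close> to all of \<open>N\<close>.\<close>

lemma linear_generalized_inverse:
  assumes K: "field K" and M: "module K M" and N: "module K N" and f: "f \<in> module_hom K M N"
  obtains s where "s \<in> module_hom K N M" "\<And>m. m \<in> carrier M \<Longrightarrow> f (s (f m)) = f m"
proof -
  interpret M: module K M by fact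
  interpret N: module K N by fact
  let ?Z = "{m \<in> carrier M. f m = \<zero>\<^bsub>N\<^esub>}" and ?I = "N\<lparr>carrier := f ` carrier M\<rparr>"
  have Z: "submodule ?Z K M" by (rule module_hom_kernel[OF M N f])
  have Isub: "submodule (f ` carrier M) K N"
    by (rule module_hom_image[OF M N f M.carrier_is_submodule])
  have I: "module K ?I" by (rule submodule_module[OF N Isub])
  obtain \<rho> where \<rho>: "\<rho> \<in> module_hom K M (M\<lparr>carrier := ?Z\<rparr>)" "\<And>w. w \<in> ?Z \<Longrightarrow> \<rho> w = w"
    using linear_retraction[OF K M Z] by blast
  obtain \<sigma> where \<sigma>: "\<sigma> \<in> module_hom K N ?I" "\<And>w. w \<in> f ` carrier M \<Longrightarrow> \<sigma> w = w"
    using linear_retraction[OF K N Isub] by blast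
  have \<rho>M: "\<rho> \<in> module_hom K M M" and \<rho>Z: "\<And>m. m \<in> carrier M \<Longrightarrow> f (\<rho> m) = \<zero>\<^bsub>N\<^esub>"
    using \<rho>(1) by (auto simp: module_hom_def Pi_iff)
  have e: "(\<lambda>m. id m \<ominus>\<^bsub>M\<^esub> \<rho> m) \<in> module_hom K M M"
    by (intro module_hom_diff M \<rho>M module_hom_id)
  have fI: "f \<in> module_hom K M ?I" using f by (auto simp: module_hom_def)
  obtain t where t: "t \<in> module_hom K ?I M" "\<And>m. m \<in> carrier M \<Longrightarrow> t (f m) = id m \<ominus>\<^bsub>M\<^esub> \<rho> m"
  proof (rule factor_through_surjection[OF M I M fI _ e])
    show "id m \<ominus>\<^bsub>M\<^esub> \<rho> m = \<zero>\<^bsub>M\<^esub>" if "m \<in> carrier M" "f m = \<zero>\<^bsub>?I\<^esub>" for m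
      using \<rho>(2)[of m] that by (simp add: M.r_neg a_minus_def)
  qed auto
  show thesis
  proof (rule that)
    show "(\<lambda>n. t (\<sigma> n)) \<in> module_hom K N M" by (rule module_hom_comp[OF \<sigma>(1) t(1)])
    fix m assume m: "m \<in> carrier M"
    have "f (m \<ominus>\<^bsub>M\<^esub> \<rho> m) = f m \<ominus>\<^bsub>N\<^esub> f (\<rho> m)"
      using m module_hom_closed[OF \<rho>M] by (simp add: module_hom_minus[OF M N f])
    then show "f (t (\<sigma> (f m))) = f m"
      using m \<rho>Z module_hom_closed[OF f] by (simp add: t(2) \<sigma>(2) a_minus_def)
  qed
qed

section \<open>Modules given by generators and relations\<close>

text \<open>The module axioms pass to any structure onto which a module maps compatibly with the operations.  This
applies to quotients, to structures transported along a bijection, and to records that differ only in fields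
that are irrelevant for the module structure.\<close>

lemma module_of_surjection:
  assumes M: "module R M" and surj: "q ` carrier M = carrier Q"
    and add: "\<And>x y. x \<in> carrier M \<Longrightarrow> y \<in> carrier M \<Longrightarrow> q (x \<oplus>\<^bsub>M\<^esub> y) = q x \<oplus>\<^bsub>Q\<^esub> q y"
    and smult: "\<And>r x. r \<in> carrier R \<Longrightarrow> x \<in> carrier M \<Longrightarrow> q (r \<odot>\<^bsub>M\<^esub> x) = r \<odot>\<^bsub>Q\<^esub> q x"
    and zero: "q \<zero>\<^bsub>M\<^esub> = \<zero>\<^bsub>Q\<^esub>"
  shows "module R Q" "q \<in> module_hom R M Q"
proof -
  interpret M: module R M by fact
  have E: "\<exists>m\<in>carrier M. x = q m" if "x \<in> carrier Q" for x using that surj by blast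
  have C: "q m \<in> carrier Q" if "m \<in> carrier M" for m using that surj by blast
  have "abelian_group Q"
  proof (rule abelian_groupI)
    fix x y assume "x \<in> carrier Q" "y \<in> carrier Q"
    then obtain m n where "m \<in> carrier M" "n \<in> carrier M" "x = q m" "y = q n" using E by metis
    then show "x \<oplus>\<^bsub>Q\<^esub> y \<in> carrier Q" "x \<oplus>\<^bsub>Q\<^esub> y = y \<oplus>\<^bsub>Q\<^esub> x"
      using C by (simp_all add: add[symmetric] M.a_comm)
  next
    show "\<zero>\<^bsub>Q\<^esub> \<in> carrier Q" using C zero by (metis M.zero_closed)
  next
    fix x y z assume "x \<in> carrier Q" "y \<in> carrier Q" "z \<in> carrier Q"
    then obtain m n k where "m \<in> carrier M" "n \<in> carrier M" "k \<in> carrier M" "x = q m" "y = q n" "z = q k"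
      using E by metis
    then show "x \<oplus>\<^bsub>Q\<^esub> y \<oplus>\<^bsub>Q\<^esub> z = x \<oplus>\<^bsub>Q\<^esub> (y \<oplus>\<^bsub>Q\<^esub> z)" by (simp add: add[symmetric] M.a_assoc)
  next
    fix x assume "x \<in> carrier Q"
    then obtain m where m: "m \<in> carrier M" "x = q m" using E by metis
    then show "\<zero>\<^bsub>Q\<^esub> \<oplus>\<^bsub>Q\<^esub> x = x" by (simp add: zero[symmetric] add[symmetric])
    show "\<exists>y\<in>carrier Q. y \<oplus>\<^bsub>Q\<^esub> x = \<zero>\<^bsub>Q\<^esub>"
      using m C by (intro bexI[of _ "q (\<ominus>\<^bsub>M\<^esub> m)"]) (simp_all add: zero[symmetric] add[symmetric] M.l_neg)
  qed
  moreover have "cring R" ..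
  ultimately show "module R Q"
    by (intro moduleI)
       (auto dest!: E simp: C smult[symmetric] add[symmetric] M.smult_l_distr M.smult_r_distr M.smult_assoc1)
  show "q \<in> module_hom R M Q"
    using C by (intro module_homI) (simp_all add: add smult)
qed

lemma free_module_module:
  assumes "cring R"
  shows "module R (free_module R B)"
proof -
  interpret R: cring R by fact
  have fin: "finite {b. f b \<oplus>\<^bsub>R\<^esub> g b \<noteq> \<zero>\<^bsub>R\<^esub>} \<and> {b. f b \<oplus>\<^bsub>R\<^esub> g b \<noteq> \<zero>\<^bsub>R\<^esub>} \<subseteq> B"
    if "finite {b. f b \<noteq> \<zero>\<^bsub>R\<^esub>}" "{b. f b \<noteq> \<zero>\<^bsub>R\<^esub>} \<subseteq> B" "finite {b. g b \<noteq> \<zero>\<^bsub>R\<^esub>}" "{b. g b \<noteq> \<zero>\<^bsub>R\<^esub>} \<subseteq> B"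
    for f g :: "_ \<Rightarrow> _"
  proof -
    have "{b. f b \<oplus>\<^bsub>R\<^esub> g b \<noteq> \<zero>\<^bsub>R\<^esub>} \<subseteq> {b. f b \<noteq> \<zero>\<^bsub>R\<^esub>} \<union> {b. g b \<noteq> \<zero>\<^bsub>R\<^esub>}" by auto
    then show ?thesis using that by (meson finite_UnI finite_subset le_sup_iff order_trans sup.bounded_iff)
  qed
  have fin2: "finite {b. r \<otimes>\<^bsub>R\<^esub> f b \<noteq> \<zero>\<^bsub>R\<^esub>} \<and> {b. r \<otimes>\<^bsub>R\<^esub> f b \<noteq> \<zero>\<^bsub>R\<^esub>} \<subseteq> B"
    if "finite {b. f b \<noteq> \<zero>\<^bsub>R\<^esub>}" "{b. f b \<noteq> \<zero>\<^bsub>R\<^esub>} \<subseteq> B" "r \<in> carrier R" for f :: "_ \<Rightarrow> _" and r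
  proof -
    have "{b. r \<otimes>\<^bsub>R\<^esub> f b \<noteq> \<zero>\<^bsub>R\<^esub>} \<subseteq> {b. f b \<noteq> \<zero>\<^bsub>R\<^esub>}" using that by auto
    then show ?thesis using that by (meson finite_subset order_trans)
  qed
  have "abelian_group (free_module R B)"
  proof (rule abelian_groupI)
    fix f assume f: "f \<in> carrier (free_module R B)"
    have "(\<lambda>b. \<ominus>\<^bsub>R\<^esub> \<one>\<^bsub>R\<^esub> \<otimes>\<^bsub>R\<^esub> f b) \<in> carrier (free_module R B)"
      using f fin2[of f "\<ominus>\<^bsub>R\<^esub> \<one>\<^bsub>R\<^esub>"] by (auto simp: free_module_def)
    moreover have "(\<lambda>b. \<ominus>\<^bsub>R\<^esub> \<one>\<^bsub>R\<^esub> \<otimes>\<^bsub>R\<^esub> f b) \<oplus>\<^bsub>free_module R B\<^esub> f = \<zero>\<^bsub>free_module R B\<^esub>"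
      using f by (auto simp: free_module_def fun_eq_iff R.l_minus R.l_neg)
    ultimately show "\<exists>g\<in>carrier (free_module R B). g \<oplus>\<^bsub>free_module R B\<^esub> f = \<zero>\<^bsub>free_module R B\<^esub>" by blast
  qed (use fin in \<open>auto simp: free_module_def fun_eq_iff R.a_ac\<close>)
  then show ?thesis
    using assms
    by (intro moduleI)
       (use fin2 in \<open>auto simp: free_module_def fun_eq_iff R.l_distr R.r_distr R.m_assoc\<close>)
qed

lemma free_gen_closed:
  assumes "cring R" "b \<in> B"
  shows "free_gen R b \<in> carrier (free_module R B)"
proof -
  interpret R: cring R by fact
  have "{c. free_gen R b c \<noteq> \<zero>\<^bsub>R\<^esub>} \<subseteq> {b}" by (auto simp: free_gen_def)
  then show ?thesis
    using assms(2) finite_subset[of "{c. free_gen R b c \<noteq> \<zero>\<^bsub>R\<^esub>}" "{b}"]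
    by (auto simp: free_module_def) (auto simp: free_gen_def)
qed

text \<open>By induction on the support, every element of a free module is a combination of generators.\<close>

lemma free_module_span:
  assumes R: "cring R" and H: "submodule H R (free_module R B)" and gen: "\<And>b. b \<in> B \<Longrightarrow> free_gen R b \<in> H"
  shows "carrier (free_module R B) \<subseteq> H"
proof -
  interpret R: cring R by fact
  note sub = submodule_iff[OF free_module_module[OF R]]
  have "f \<in> H" if "finite S" "f \<in> carrier (free_module R B)" "{b. f b \<noteq> \<zero>\<^bsub>R\<^esub>} \<subseteq> S" for S f
    using that
  proof (induction S arbitrary: f)
    case empty
    then have "f = \<zero>\<^bsub>free_module R B\<^esub>" by (auto simp: free_module_def)
    then show ?case using H by (simp add: sub)
  next
    case (insert b S)
    show ?case
    proof (cases "f b = \<zero>\<^bsub>R\<^esub>")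
      case True
      then show ?thesis using insert by auto
    next
      case False
      then have b: "b \<in> B" and fb: "f b \<in> carrier R" using insert.prems by (auto simp: free_module_def)
      have sup: "{c. (f(b := \<zero>\<^bsub>R\<^esub>)) c \<noteq> \<zero>\<^bsub>R\<^esub>} \<subseteq> {c. f c \<noteq> \<zero>\<^bsub>R\<^esub>}" by auto
      have "f(b := \<zero>\<^bsub>R\<^esub>) \<in> carrier (free_module R B)"
        using insert.prems(1) finite_subset[OF sup] order_trans[OF sup] by (auto simp: free_module_def)
      moreover have "{c. (f(b := \<zero>\<^bsub>R\<^esub>)) c \<noteq> \<zero>\<^bsub>R\<^esub>} \<subseteq> S" using insert.prems(2) by auto
      ultimately have "f(b := \<zero>\<^bsub>R\<^esub>) \<in> H" by (rule insert.IH)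
      moreover have "f b \<odot>\<^bsub>free_module R B\<^esub> free_gen R b \<in> H" using H gen[OF b] fb by (simp add: sub)
      ultimately have "f(b := \<zero>\<^bsub>R\<^esub>) \<oplus>\<^bsub>free_module R B\<^esub> (f b \<odot>\<^bsub>free_module R B\<^esub> free_gen R b) \<in> H"
        using H by (simp add: sub)
      moreover have "f(b := \<zero>\<^bsub>R\<^esub>) \<oplus>\<^bsub>free_module R B\<^esub> (f b \<odot>\<^bsub>free_module R B\<^esub> free_gen R b) = f"
        using insert.prems(1) by (auto simp: free_module_def free_gen_def fun_eq_iff)
      ultimately show ?thesis by simp
    qed
  qed
  then show ?thesis by (auto simp: free_module_def)
qed

lemma free_module_lift:
  fixes R :: "('r, 'q) ring_scheme" and B :: "'b set"
  assumes R: "cring R" and P: "module R P" and \<phi>: "\<And>b. b \<in> B \<Longrightarrow> \<phi> b \<in> carrier P"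
  obtains h where "h \<in> module_hom R (free_module R B) P" "\<And>b. b \<in> B \<Longrightarrow> h (free_gen R b) = \<phi> b"
proof -
  interpret R: cring R by fact
  interpret P: module R P by fact
  interpret F: module R "free_module R B" by (rule free_module_module[OF R])
  define supp where "supp f = {b. f b \<noteq> \<zero>\<^bsub>R\<^esub>}" for f :: "'b \<Rightarrow> 'r"
  define h where "h f = (\<Oplus>\<^bsub>P\<^esub>b\<in>supp f. f b \<odot>\<^bsub>P\<^esub> \<phi> b)" for f
  have h: "h f = (\<Oplus>\<^bsub>P\<^esub>b\<in>S. f b \<odot>\<^bsub>P\<^esub> \<phi> b)"
    if "finite S" "supp f \<subseteq> S" "S \<subseteq> B" "\<And>b. f b \<in> carrier R" for f S
    unfolding h_def using that \<phi>
    by (intro P.add.finprod_mono_neutral_cong_left) (auto simp: supp_def)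
  have carF: "f b \<in> carrier R" "finite (supp f)" "supp f \<subseteq> B" if "f \<in> carrier (free_module R B)" for f b
    using that by (auto simp: free_module_def supp_def)
  have "h \<in> module_hom R (free_module R B) P"
  proof (rule module_homI)
    fix f assume f: "f \<in> carrier (free_module R B)"
    note carF[OF f]
    then show "h f \<in> carrier P" unfolding h_def using \<phi> by (intro P.finsum_closed) auto
  next
    fix f g assume f: "f \<in> carrier (free_module R B)" and g: "g \<in> carrier (free_module R B)"
    let ?S = "supp f \<union> supp g"
    have S: "finite ?S" "?S \<subseteq> B" using carF(2,3)[OF f] carF(2,3)[OF g] by auto
    have "supp (f \<oplus>\<^bsub>free_module R B\<^esub> g) \<subseteq> ?S" by (auto simp: supp_def free_module_def)
    then have "h (f \<oplus>\<^bsub>free_module R B\<^esub> g) = (\<Oplus>\<^bsub>P\<^esub>b\<in>?S. (f b \<oplus>\<^bsub>R\<^esub> g b) \<odot>\<^bsub>P\<^esub> \<phi> b)"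
      using S carF(1)[OF f] carF(1)[OF g] by (subst h[of ?S]) (simp_all add: free_module_def)
    also have "\<dots> = (\<Oplus>\<^bsub>P\<^esub>b\<in>?S. f b \<odot>\<^bsub>P\<^esub> \<phi> b \<oplus>\<^bsub>P\<^esub> g b \<odot>\<^bsub>P\<^esub> \<phi> b)"
      using S carF(1)[OF f] carF(1)[OF g] \<phi> by (intro P.finsum_cong') (auto simp: P.smult_l_distr subset_iff)
    also have "\<dots> = (\<Oplus>\<^bsub>P\<^esub>b\<in>?S. f b \<odot>\<^bsub>P\<^esub> \<phi> b) \<oplus>\<^bsub>P\<^esub> (\<Oplus>\<^bsub>P\<^esub>b\<in>?S. g b \<odot>\<^bsub>P\<^esub> \<phi> b)"
      using S carF(1)[OF f] carF(1)[OF g] \<phi> by (intro P.finsum_addf) (auto simp: subset_iff)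
    also have "\<dots> = h f \<oplus>\<^bsub>P\<^esub> h g"
      using S carF(1)[OF f] carF(1)[OF g] by (simp add: h[of ?S])
    finally show "h (f \<oplus>\<^bsub>free_module R B\<^esub> g) = h f \<oplus>\<^bsub>P\<^esub> h g" .
  next
    fix r f assume r: "r \<in> carrier R" and f: "f \<in> carrier (free_module R B)"
    have "supp (r \<odot>\<^bsub>free_module R B\<^esub> f) \<subseteq> supp f" using r by (auto simp: supp_def free_module_def)
    then have "h (r \<odot>\<^bsub>free_module R B\<^esub> f) = (\<Oplus>\<^bsub>P\<^esub>b\<in>supp f. (r \<otimes>\<^bsub>R\<^esub> f b) \<odot>\<^bsub>P\<^esub> \<phi> b)"
      using r carF[OF f] by (subst h[of "supp f"]) (simp_all add: free_module_def)
    also have "\<dots> = (\<Oplus>\<^bsub>P\<^esub>b\<in>supp f. r \<odot>\<^bsub>P\<^esub> (f b \<odot>\<^bsub>P\<^esub> \<phi> b))"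
      using r carF[OF f] \<phi> by (intro P.finsum_cong') (auto simp: P.smult_assoc1 subset_iff)
    also have "\<dots> = r \<odot>\<^bsub>P\<^esub> h f"
      unfolding h_def using r carF[OF f] \<phi> by (intro P.finsum_smult_ldistr[symmetric]) (auto simp: subset_iff)
    finally show "h (r \<odot>\<^bsub>free_module R B\<^esub> f) = r \<odot>\<^bsub>P\<^esub> h f" .
  qed
  moreover have "h (free_gen R b) = \<phi> b" if b: "b \<in> B" for b
  proof -
    have "h (free_gen R b) = (\<Oplus>\<^bsub>P\<^esub>c\<in>{b}. free_gen R b c \<odot>\<^bsub>P\<^esub> \<phi> c)"
      using b by (intro h) (auto simp: supp_def free_gen_def)
    also have "\<dots> = free_gen R b b \<odot>\<^bsub>P\<^esub> \<phi> b"
      using b \<phi> by (subst P.finsum_insert) (auto simp: free_gen_def)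
    finally show ?thesis using b \<phi> by (simp add: free_gen_def)
  qed
  ultimately show thesis using that by blast
qed

lemma quotient_module_properties:
  fixes M :: "('r, 'm) module"
  assumes M: "module R M" and H: "submodule H R M"
  shows "module R (quotient_module R M H)"
    and "(\<lambda>x. H +>\<^bsub>M\<^esub> x) \<in> module_hom R M (quotient_module R M H)"
    and "(\<lambda>x. H +>\<^bsub>M\<^esub> x) ` carrier M = carrier (quotient_module R M H)"
    and "x \<in> carrier M \<Longrightarrow> H +>\<^bsub>M\<^esub> x = \<zero>\<^bsub>quotient_module R M H\<^esub> \<longleftrightarrow> x \<in> H"
proof -
  interpret M: module R M by fact
  have sg: "subgroup H (add_monoid M)" using H by (rule submodule.axioms)
  interpret S: abelian_subgroup H M
    by (rule abelian_subgroupI3) (auto intro: additive_subgroupI sg M.abelian_group_axioms)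
  show surj: "(\<lambda>x. H +>\<^bsub>M\<^esub> x) ` carrier M = carrier (quotient_module R M H)"
    by (auto simp: quotient_module_def A_RCOSETS_def')
  have smult: "(\<Union>c\<in>H +>\<^bsub>M\<^esub> x. H +>\<^bsub>M\<^esub> (r \<odot>\<^bsub>M\<^esub> c)) = H +>\<^bsub>M\<^esub> (r \<odot>\<^bsub>M\<^esub> x)"
    if x: "x \<in> carrier M" and r: "r \<in> carrier R" for x r
  proof -
    have "H +>\<^bsub>M\<^esub> (r \<odot>\<^bsub>M\<^esub> c) = H +>\<^bsub>M\<^esub> (r \<odot>\<^bsub>M\<^esub> x)" if c: "c \<in> H +>\<^bsub>M\<^esub> x" for c
    proof -
      obtain h where h: "h \<in> H" "c = h \<oplus>\<^bsub>M\<^esub> x" using c by (auto simp: a_r_coset_def')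
      then have "r \<odot>\<^bsub>M\<^esub> c = (r \<odot>\<^bsub>M\<^esub> h) \<oplus>\<^bsub>M\<^esub> (r \<odot>\<^bsub>M\<^esub> x)"
        using x r by (simp add: M.smult_r_distr)
      then have "r \<odot>\<^bsub>M\<^esub> c \<in> H +>\<^bsub>M\<^esub> (r \<odot>\<^bsub>M\<^esub> x)"
        using submodule.smult_closed[OF H r h(1)] by (auto simp: a_r_coset_def')
      then show ?thesis using x r S.a_repr_independence'[of "r \<odot>\<^bsub>M\<^esub> c" "r \<odot>\<^bsub>M\<^esub> x"] by simp
    qed
    moreover have "x \<in> H +>\<^bsub>M\<^esub> x" using x by (rule S.a_rcos_self)
    ultimately show ?thesis by (intro SUP_eq_const) blast+
  qed
  show "module R (quotient_module R M H)" "(\<lambda>x. H +>\<^bsub>M\<^esub> x) \<in> module_hom R M (quotient_module R M H)"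
    by (rule module_of_surjection[OF M surj];
        simp add: quotient_module_def S.a_rcos_sum smult S.a_subset)+
  show "H +>\<^bsub>M\<^esub> x = \<zero>\<^bsub>quotient_module R M H\<^esub> \<longleftrightarrow> x \<in> H" if "x \<in> carrier M"
    using that S.a_rcos_const M.a_coset_join1[OF _ that sg] by (auto simp: quotient_module_def)
qed

lemma submodule_span_submodule:
  fixes M :: "('r, 'm) module"
  assumes M: "module R M" and S: "S \<subseteq> carrier M"
  shows "submodule (submodule_span R M S) R M" "S \<subseteq> submodule_span R M S"
proof -
  interpret M: module R M by fact
  note sub = submodule_iff[OF M]
  have "submodule_span R M S \<subseteq> carrier M"
    using S M.carrier_is_submodule by (auto simp: submodule_span_def)
  then show "submodule (submodule_span R M S) R M"
    unfolding sub by (auto simp: submodule_span_def sub)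
  show "S \<subseteq> submodule_span R M S" by (auto simp: submodule_span_def)
qed

text \<open>Tensor products and colimits of modules are both given by generators and relations; their common
properties are proved for this construction.\<close>

definition presented_module :: "('r, 'q) ring_scheme \<Rightarrow> 'b set \<Rightarrow> ('b \<Rightarrow> 'r) set \<Rightarrow> ('r, ('b \<Rightarrow> 'r) set) module" where
  "presented_module R B Z =
     quotient_module R (free_module R B) (submodule_span R (free_module R B) Z)"

definition presented_class :: "('r, 'q) ring_scheme \<Rightarrow> 'b set \<Rightarrow> ('b \<Rightarrow> 'r) set \<Rightarrow> ('b \<Rightarrow> 'r) \<Rightarrow> ('b \<Rightarrow> 'r) set" where
  "presented_class R B Z f = submodule_span R (free_module R B) Z +>\<^bsub>free_module R B\<^esub> f"

lemma presented_module_properties: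
  assumes R: "cring R" and Z: "Z \<subseteq> carrier (free_module R B)"
  shows "module R (presented_module R B Z)"
    and "presented_class R B Z \<in> module_hom R (free_module R B) (presented_module R B Z)"
    and "presented_class R B Z ` carrier (free_module R B) = carrier (presented_module R B Z)"
    and "z \<in> Z \<Longrightarrow> presented_class R B Z z = \<zero>\<^bsub>presented_module R B Z\<^esub>"
proof -
  note F = free_module_module[OF R, of B]
  note S = submodule_span_submodule[OF F Z]
  note Q = quotient_module_properties[OF F S(1), folded presented_module_def presented_class_def]
  show "module R (presented_module R B Z)"
    "presented_class R B Z \<in> module_hom R (free_module R B) (presented_module R B Z)"
    "presented_class R B Z ` carrier (free_module R B) = carrier (presented_module R B Z)"
    by (rule Q)+
  show "presented_class R B Z z = \<zero>\<^bsub>presented_module R B Z\<^esub>" if "z \<in> Z"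
    using Q(4)[of z] S(2) Z that by blast
qed

lemma presented_module_span:
  assumes R: "cring R" and Z: "Z \<subseteq> carrier (free_module R B)"
    and W: "submodule W R (presented_module R B Z)"
    and gen: "\<And>b. b \<in> B \<Longrightarrow> presented_class R B Z (free_gen R b) \<in> W"
  shows "carrier (presented_module R B Z) \<subseteq> W"
proof -
  note F = free_module_module[OF R, of B] and Q = presented_module_properties[OF R Z]
  have "submodule {f \<in> carrier (free_module R B). presented_class R B Z f \<in> W} R (free_module R B)"
    using W module_hom_zero[OF F Q(1,2)] abelian_group.axioms(1)[OF module.axioms(2)[OF F]]
    unfolding submodule_iff[OF F] submodule_iff[OF Q(1)]
    by (auto simp: module_hom_add[OF Q(2)] module_hom_smult[OF Q(2)] abelian_monoid.a_closed
        abelian_monoid.zero_closed module.smult_closed[OF F])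
  then have "carrier (free_module R B) \<subseteq> {f \<in> carrier (free_module R B). presented_class R B Z f \<in> W}"
    by (rule free_module_span[OF R]) (auto simp: gen free_gen_closed[OF R])
  then show ?thesis unfolding Q(3)[symmetric] by blast
qed

text \<open>The condition on the relations is stated for every linear extension of \<open>\<phi>\<close> to the free module, so
that users can verify it from linearity alone, without a formula for the extension.\<close>

lemma presented_module_lift:
  assumes R: "cring R" and Z: "Z \<subseteq> carrier (free_module R B)" and P: "module R P"
    and \<phi>: "\<And>b. b \<in> B \<Longrightarrow> \<phi> b \<in> carrier P"
    and rel: "\<And>h z. h \<in> module_hom R (free_module R B) P \<Longrightarrow>
      (\<And>b. b \<in> B \<Longrightarrow> h (free_gen R b) = \<phi> b) \<Longrightarrow> z \<in> Z \<Longrightarrow> h z = \<zero>\<^bsub>P\<^esub>"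
  obtains u where "u \<in> module_hom R (presented_module R B Z) P"
    "\<And>b. b \<in> B \<Longrightarrow> u (presented_class R B Z (free_gen R b)) = \<phi> b"
proof -
  note F = free_module_module[OF R, of B] and Q = presented_module_properties[OF R Z]
  obtain h where h: "h \<in> module_hom R (free_module R B) P" "\<And>b. b \<in> B \<Longrightarrow> h (free_gen R b) = \<phi> b"
    by (rule free_module_lift[OF R P, of B \<phi>, OF \<phi>]) blast+
  let ?H = "submodule_span R (free_module R B) Z"
  have ker: "h f = \<zero>\<^bsub>P\<^esub>" if f: "f \<in> carrier (free_module R B)"
    "presented_class R B Z f = \<zero>\<^bsub>presented_module R B Z\<^esub>" for f
  proof -
    have "f \<in> ?H"
      using quotient_module_properties(4)[OF F submodule_span_submodule(1)[OF F Z] f(1)] f(2)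
      by (simp add: presented_class_def presented_module_def)
    moreover have "?H \<subseteq> {x \<in> carrier (free_module R B). h x = \<zero>\<^bsub>P\<^esub>}"
      unfolding submodule_span_def
      using module_hom_kernel[OF F P h(1)] Z rel[OF h] by (intro Inter_lower) auto
    ultimately show ?thesis by blast
  qed
  obtain u where "u \<in> module_hom R (presented_module R B Z) P"
    "\<And>f. f \<in> carrier (free_module R B) \<Longrightarrow> u (presented_class R B Z f) = h f"
    using factor_through_surjection[OF F Q(1) P Q(2,3) h(1) ker] by blast
  with that show thesis using h(2) free_gen_closed[OF R] by metis
qed

section \<open>Tensor products\<close>

lemma tensor_eq_presented:
  "tensor R M N = presented_module R (carrier M \<times> carrier N) (tensor_relations R M N)"
  "pure_tensor R M N m n =
     presented_class R (carrier M \<times> carrier N) (tensor_relations R M N) (free_gen R (m, n))"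
  by (simp_all add: tensor_def pure_tensor_def presented_module_def presented_class_def tensor_submodule_def)

lemma tensor_relations_closed:
  assumes M: "module R M" and N: "module R N"
  shows "tensor_relations R M N \<subseteq> carrier (free_module R (carrier M \<times> carrier N))"
proof -
  interpret M: module R M by fact
  interpret N: module R N by fact
  have R: "cring R" ..
  let ?F = "free_module R (carrier M \<times> carrier N)"
  interpret F: module R ?F by (rule free_module_module[OF R])
  have "free_gen R (m, n) \<in> carrier ?F" if "m \<in> carrier M" "n \<in> carrier N" for m n
    using that by (intro free_gen_closed[OF R]) simp
  then show ?thesis by (auto simp: tensor_relations_def Let_def)
qed

lemma
  assumes M: "module R M" and N: "module R N"
  shows tensor_module: "module R (tensor R M N)"
    and pure_tensor_closed: "m \<in> carrier M \<Longrightarrow> n \<in> carrier N \<Longrightarrow> pure_tensor R M N m n \<in> carrier (tensor R M N)"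
    and pure_tensor_add_left: "m \<in> carrier M \<Longrightarrow> m' \<in> carrier M \<Longrightarrow> n \<in> carrier N \<Longrightarrow>
      pure_tensor R M N (m \<oplus>\<^bsub>M\<^esub> m') n = pure_tensor R M N m n \<oplus>\<^bsub>tensor R M N\<^esub> pure_tensor R M N m' n"
    and pure_tensor_add_right: "m \<in> carrier M \<Longrightarrow> n \<in> carrier N \<Longrightarrow> n' \<in> carrier N \<Longrightarrow>
      pure_tensor R M N m (n \<oplus>\<^bsub>N\<^esub> n') = pure_tensor R M N m n \<oplus>\<^bsub>tensor R M N\<^esub> pure_tensor R M N m n'"
    and pure_tensor_smult_left: "r \<in> carrier R \<Longrightarrow> m \<in> carrier M \<Longrightarrow> n \<in> carrier N \<Longrightarrow>
      pure_tensor R M N (r \<odot>\<^bsub>M\<^esub> m) n = r \<odot>\<^bsub>tensor R M N\<^esub> pure_tensor R M N m n"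
    and pure_tensor_smult_right: "r \<in> carrier R \<Longrightarrow> m \<in> carrier M \<Longrightarrow> n \<in> carrier N \<Longrightarrow>
      pure_tensor R M N m (r \<odot>\<^bsub>N\<^esub> n) = r \<odot>\<^bsub>tensor R M N\<^esub> pure_tensor R M N m n"
proof -
  interpret M: module R M by fact
  interpret N: module R N by fact
  have R: "cring R" ..
  let ?B = "carrier M \<times> carrier N" and ?Z = "tensor_relations R M N"
  let ?F = "free_module R ?B" and ?T = "tensor R M N" and ?\<pi> = "presented_class R ?B ?Z"
  have F: "module R ?F" by (rule free_module_module[OF R])
  interpret F: module R ?F by (rule F)
  note Q = presented_module_properties[OF R tensor_relations_closed[OF M N], folded tensor_eq_presented]
  show T: "module R ?T" by (rule Q)
  interpret T: module R ?T by (rule T)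
  note \<pi> = Q(2)
  have gen: "free_gen R (m, n) \<in> carrier ?F" if "m \<in> carrier M" "n \<in> carrier N" for m n
    using that by (intro free_gen_closed[OF R]) simp
  show "pure_tensor R M N m n \<in> carrier ?T" if "m \<in> carrier M" "n \<in> carrier N"
    using module_hom_closed[OF \<pi> gen[OF that]] by (simp add: tensor_eq_presented)
  have rel: "?\<pi> f = ?\<pi> g" if "f \<ominus>\<^bsub>?F\<^esub> g \<in> ?Z" "f \<in> carrier ?F" "g \<in> carrier ?F" for f g
    using Q(4)[OF that(1)] that(2,3) module_hom_closed[OF \<pi>]
    by (simp add: module_hom_minus[OF F T \<pi>] minus_eq_zero_iff[OF T])
  show "pure_tensor R M N (m \<oplus>\<^bsub>M\<^esub> m') n = pure_tensor R M N m n \<oplus>\<^bsub>?T\<^esub> pure_tensor R M N m' n" if "m \<in> carrier M" "m' \<in> carrier M" "n \<in> carrier N"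
  proof -
    have "free_gen R (m \<oplus>\<^bsub>M\<^esub> m', n) \<ominus>\<^bsub>?F\<^esub> (free_gen R (m, n) \<oplus>\<^bsub>?F\<^esub> free_gen R (m', n)) \<in> ?Z"
      using that unfolding tensor_relations_def Let_def by blast
    from rel[OF this] show ?thesis
      using that by (simp add: tensor_eq_presented(2) module_hom_add[OF \<pi>] module_hom_smult[OF \<pi>] gen)
  qed
  show "pure_tensor R M N m (n \<oplus>\<^bsub>N\<^esub> n') = pure_tensor R M N m n \<oplus>\<^bsub>?T\<^esub> pure_tensor R M N m n'" if "m \<in> carrier M" "n \<in> carrier N" "n' \<in> carrier N"
  proof -
    have "free_gen R (m, n \<oplus>\<^bsub>N\<^esub> n') \<ominus>\<^bsub>?F\<^esub> (free_gen R (m, n) \<oplus>\<^bsub>?F\<^esub> free_gen R (m, n')) \<in> ?Z"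
      using that unfolding tensor_relations_def Let_def by blast
    from rel[OF this] show ?thesis
      using that by (simp add: tensor_eq_presented(2) module_hom_add[OF \<pi>] module_hom_smult[OF \<pi>] gen)
  qed
  show "pure_tensor R M N (r \<odot>\<^bsub>M\<^esub> m) n = r \<odot>\<^bsub>?T\<^esub> pure_tensor R M N m n" if "r \<in> carrier R" "m \<in> carrier M" "n \<in> carrier N"
  proof -
    have "free_gen R (r \<odot>\<^bsub>M\<^esub> m, n) \<ominus>\<^bsub>?F\<^esub> (r \<odot>\<^bsub>?F\<^esub> free_gen R (m, n)) \<in> ?Z"
      using that unfolding tensor_relations_def Let_def by blast
    from rel[OF this] show ?thesis
      using that by (simp add: tensor_eq_presented(2) module_hom_add[OF \<pi>] module_hom_smult[OF \<pi>] gen)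
  qed
  show "pure_tensor R M N m (r \<odot>\<^bsub>N\<^esub> n) = r \<odot>\<^bsub>?T\<^esub> pure_tensor R M N m n" if "r \<in> carrier R" "m \<in> carrier M" "n \<in> carrier N"
  proof -
    have "free_gen R (m, r \<odot>\<^bsub>N\<^esub> n) \<ominus>\<^bsub>?F\<^esub> (r \<odot>\<^bsub>?F\<^esub> free_gen R (m, n)) \<in> ?Z"
      using that unfolding tensor_relations_def Let_def by blast
    from rel[OF this] show ?thesis
      using that by (simp add: tensor_eq_presented(2) module_hom_add[OF \<pi>] module_hom_smult[OF \<pi>] gen)
  qed
qed

lemma pure_tensor_linear_left:
  assumes "module R M" "module R N" "n \<in> carrier N"
  shows "(\<lambda>m. pure_tensor R M N m n) \<in> module_hom R M (tensor R M N)"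
  using assms by (intro module_homI)
    (auto simp: pure_tensor_closed pure_tensor_add_left pure_tensor_smult_left)

lemma tensor_span:
  assumes M: "module R M" and N: "module R N" and W: "submodule W R (tensor R M N)"
    and gen: "\<And>m n. m \<in> carrier M \<Longrightarrow> n \<in> carrier N \<Longrightarrow> pure_tensor R M N m n \<in> W"
  shows "carrier (tensor R M N) \<subseteq> W"
  unfolding tensor_eq_presented(1)
proof (rule presented_module_span)
  interpret M: module R M by fact
  show "cring R" ..
  show "tensor_relations R M N \<subseteq> carrier (free_module R (carrier M \<times> carrier N))"
    by (rule tensor_relations_closed[OF M N])
qed (use W gen in \<open>auto simp: tensor_eq_presented\<close>)

text \<open>The zero tensor needs no case of its own, since \<open>0 = 0 \<otimes> 0\<close> is pure; neither do scalar multiples, since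
scalars can be moved into a pure tensor.\<close>

lemma tensor_induct [consumes 3, case_names pure add]:
  assumes M: "module R M" and N: "module R N" and t: "t \<in> carrier (tensor R M N)"
    and pure: "\<And>m n. m \<in> carrier M \<Longrightarrow> n \<in> carrier N \<Longrightarrow> P (pure_tensor R M N m n)"
    and add: "\<And>s t. s \<in> carrier (tensor R M N) \<Longrightarrow> t \<in> carrier (tensor R M N) \<Longrightarrow> P s \<Longrightarrow> P t \<Longrightarrow>
      P (s \<oplus>\<^bsub>tensor R M N\<^esub> t)"
  shows "P t"
proof -
  interpret M: module R M by fact
  interpret N: module R N by fact
  note T = tensor_module[OF M N]
  interpret T: module R "tensor R M N" by (rule T)
  \<comment> \<open>The elements satisfying \<open>P\<close> need not form a submodule; those all of whose multiples satisfy it do.\<close>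
  let ?W = "{t \<in> carrier (tensor R M N). \<forall>r\<in>carrier R. P (r \<odot>\<^bsub>tensor R M N\<^esub> t)}"
  have gen: "pure_tensor R M N m n \<in> ?W" if "m \<in> carrier M" "n \<in> carrier N" for m n
    using that pure[of "_ \<odot>\<^bsub>M\<^esub> m" n]
    by (auto simp: pure_tensor_closed[OF M N] pure_tensor_smult_left[OF M N, symmetric])
  have zero: "\<zero>\<^bsub>tensor R M N\<^esub> = \<zero>\<^bsub>R\<^esub> \<odot>\<^bsub>tensor R M N\<^esub> pure_tensor R M N \<zero>\<^bsub>M\<^esub> \<zero>\<^bsub>N\<^esub>"
    by (simp add: pure_tensor_closed[OF M N])
  have "P (\<zero>\<^bsub>R\<^esub> \<odot>\<^bsub>tensor R M N\<^esub> pure_tensor R M N \<zero>\<^bsub>M\<^esub> \<zero>\<^bsub>N\<^esub>)"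
    using gen[OF M.zero_closed N.zero_closed] M.R.zero_closed by blast
  then have "P \<zero>\<^bsub>tensor R M N\<^esub>" by (simp only: zero[symmetric])
  then have "submodule ?W R (tensor R M N)"
    unfolding submodule_iff[OF T]
    by (auto simp: T.smult_r_distr add T.smult_assoc1[symmetric])
  then have "t \<in> ?W" using tensor_span[OF M N _ gen] t by blast
  then have "P (\<one>\<^bsub>R\<^esub> \<odot>\<^bsub>tensor R M N\<^esub> t)" by blast
  then show ?thesis using t by simp
qed

lemma tensor_eqI:
  assumes M: "module R M" and N: "module R N" and P: "module R P"
    and h: "h \<in> module_hom R (tensor R M N) P" and k: "k \<in> module_hom R (tensor R M N) P"
    and eq: "\<And>m n. m \<in> carrier M \<Longrightarrow> n \<in> carrier N \<Longrightarrow> h (pure_tensor R M N m n) = k (pure_tensor R M N m n)"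
    and t: "t \<in> carrier (tensor R M N)"
  shows "h t = k t"
  using M N t
  by (induction rule: tensor_induct) (simp_all add: eq module_hom_add[OF h] module_hom_add[OF k])

definition bilinear_map ::
  "('r, 'q) ring_scheme \<Rightarrow> ('r, 'm, 'c) module_scheme \<Rightarrow> ('r, 'n, 'd) module_scheme \<Rightarrow>
   ('r, 'p, 'e) module_scheme \<Rightarrow> ('m \<Rightarrow> 'n \<Rightarrow> 'p) \<Rightarrow> bool" where
  "bilinear_map R M N P b \<longleftrightarrow>
     (\<forall>n\<in>carrier N. (\<lambda>m. b m n) \<in> module_hom R M P) \<and> (\<forall>m\<in>carrier M. b m \<in> module_hom R N P)"

lemma
  assumes M: "module R M" and N: "module R N" and P: "module R P" and b: "bilinear_map R M N P b"
  shows tensor_lift_linear: "tensor_lift R M N P b \<in> module_hom R (tensor R M N) P"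
    and tensor_lift_pure: "m \<in> carrier M \<Longrightarrow> n \<in> carrier N \<Longrightarrow> tensor_lift R M N P b (pure_tensor R M N m n) = b m n"
proof -
  interpret M: module R M by fact
  interpret N: module R N by fact
  interpret P: module R P by fact
  have R: "cring R" ..
  note T = tensor_module[OF M N]
  have bl: "(\<lambda>m. b m n) \<in> module_hom R M P" if "n \<in> carrier N" for n
    using b that by (auto simp: bilinear_map_def)
  have br: "b m \<in> module_hom R N P" if "m \<in> carrier M" for m
    using b that by (auto simp: bilinear_map_def)
  let ?B = "carrier M \<times> carrier N"
  have F: "module R (free_module R ?B)" by (rule free_module_module[OF R])
  interpret F: module R "free_module R ?B" by (rule F)
  have gen: "free_gen R (m, n) \<in> carrier (free_module R ?B)" if "m \<in> carrier M" "n \<in> carrier N" for m n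
    using that by (intro free_gen_closed[OF R]) simp
  have rel: "h z = \<zero>\<^bsub>P\<^esub>" if h: "h \<in> module_hom R (free_module R ?B) P"
    and hb: "\<And>x. x \<in> ?B \<Longrightarrow> h (free_gen R x) = (\<lambda>(m, n). b m n) x" and z: "z \<in> tensor_relations R M N" for h z
    using z hb[OF SigmaI]
    by (auto simp: tensor_relations_def Let_def gen module_hom_minus[OF F P h] module_hom_add[OF h]
        module_hom_smult[OF h] minus_eq_zero_iff[OF P] module_hom_closed[OF bl]
        module_hom_add[OF bl] module_hom_smult[OF bl] module_hom_add[OF br] module_hom_smult[OF br])
  obtain u where u: "u \<in> module_hom R (tensor R M N) P"
    "\<And>x. x \<in> ?B \<Longrightarrow> u (presented_class R ?B (tensor_relations R M N) (free_gen R x)) = (\<lambda>(m, n). b m n) x"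
    unfolding tensor_eq_presented(1)
    by (rule presented_module_lift[OF R tensor_relations_closed[OF M N] P, of "\<lambda>(m, n). b m n"])
       (use rel module_hom_closed[OF bl] in auto)
  have up: "u (pure_tensor R M N m n) = b m n" if "m \<in> carrier M" "n \<in> carrier N" for m n
    using u(2)[of "(m, n)"] that by (simp add: tensor_eq_presented)
  let ?P = "\<lambda>h. h \<in> module_hom R (tensor R M N) P \<inter> extensional (carrier (tensor R M N)) \<and>
        (\<forall>m\<in>carrier M. \<forall>n\<in>carrier N. h (pure_tensor R M N m n) = b m n)"
  have "\<exists>!h. ?P h"
  proof (rule ex1I)
    show "?P (restrict u (carrier (tensor R M N)))"
      using module_hom_restrict[OF T u(1)] up pure_tensor_closed[OF M N] by auto
    fix h assume h: "?P h"
    show "h = restrict u (carrier (tensor R M N))"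
    proof
      fix t
      show "h t = restrict u (carrier (tensor R M N)) t"
      proof (cases "t \<in> carrier (tensor R M N)")
        case True
        then show ?thesis using tensor_eqI[OF M N P _ u(1), of h] h up by simp
      next
        case False
        then show ?thesis using h by (auto simp: extensional_def)
      qed
    qed
  qed
  from theI'[OF this, folded tensor_lift_def]
  show "tensor_lift R M N P b \<in> module_hom R (tensor R M N) P"
    "m \<in> carrier M \<Longrightarrow> n \<in> carrier N \<Longrightarrow> tensor_lift R M N P b (pure_tensor R M N m n) = b m n"
    by blast+
qed

lemma bilinear_pure_tensor:
  assumes M: "module R M" and N: "module R N" and M': "module R M'" and N': "module R N'"
    and f: "f \<in> module_hom R M M'" and g: "g \<in> module_hom R N N'"
  shows "bilinear_map R M N (tensor R M' N') (\<lambda>m n. pure_tensor R M' N' (f m) (g n))"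
  unfolding bilinear_map_def module_hom_def
  using module_hom_closed[OF f] module_hom_closed[OF g]
  by (auto simp: pure_tensor_closed[OF M' N'] module_hom_add[OF f] module_hom_add[OF g] module_hom_smult[OF f]
      module_hom_smult[OF g] pure_tensor_add_left[OF M' N'] pure_tensor_add_right[OF M' N']
      pure_tensor_smult_left[OF M' N'] pure_tensor_smult_right[OF M' N'])

lemma
  assumes M: "module R M" and N: "module R N" and M': "module R M'" and N': "module R N'"
    and f: "f \<in> module_hom R M M'" and g: "g \<in> module_hom R N N'"
  shows tensor_map_linear: "tensor_map R M N M' N' f g \<in> module_hom R (tensor R M N) (tensor R M' N')"
    and tensor_map_pure: "m \<in> carrier M \<Longrightarrow> n \<in> carrier N \<Longrightarrow>
      tensor_map R M N M' N' f g (pure_tensor R M N m n) = pure_tensor R M' N' (f m) (g n)"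
  unfolding tensor_map_def
  using tensor_lift_linear[OF M N tensor_module[OF M' N'] bilinear_pure_tensor[OF assms]]
    tensor_lift_pure[OF M N tensor_module[OF M' N'] bilinear_pure_tensor[OF assms]] by auto

lemma tensor_map_closed:
  assumes "module R M" "module R N" "module R M'" "module R N'"
    and "f \<in> module_hom R M M'" "g \<in> module_hom R N N'" "t \<in> carrier (tensor R M N)"
  shows "tensor_map R M N M' N' f g t \<in> carrier (tensor R M' N')"
  using module_hom_closed[OF tensor_map_linear[OF assms(1-6)] assms(7)] .

lemma tensor_map_cong:
  assumes M: "module R M" and N: "module R N" and M': "module R M'" and N': "module R N'"
    and f: "f \<in> module_hom R M M'" and g: "g \<in> module_hom R N N'"
    and ff: "\<And>m. m \<in> carrier M \<Longrightarrow> f m = f' m" and gg: "\<And>n. n \<in> carrier N \<Longrightarrow> g n = g' n"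
    and t: "t \<in> carrier (tensor R M N)"
  shows "tensor_map R M N M' N' f g t = tensor_map R M N M' N' f' g' t"
proof -
  have f': "f' \<in> module_hom R M M'" by (rule module_hom_cong[OF M ff f])
  have g': "g' \<in> module_hom R N N'" by (rule module_hom_cong[OF N gg g])
  show ?thesis
    by (rule tensor_eqI[OF M N tensor_module[OF M' N'] _ _ _ t])
       (simp_all add: tensor_map_linear tensor_map_pure assms f' g')
qed

lemma tensor_map_id:
  assumes M: "module R M" and N: "module R N" and t: "t \<in> carrier (tensor R M N)"
  shows "tensor_map R M N M N id id t = t"
proof -
  have "tensor_map R M N M N id id t = id t"
    by (rule tensor_eqI[OF M N tensor_module[OF M N] tensor_map_linear[OF M N M N module_hom_id module_hom_id]
            module_hom_id _ t])
       (simp add: tensor_map_pure[OF M N M N module_hom_id module_hom_id])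
  then show ?thesis by simp
qed

lemma tensor_map_comp:
  assumes M: "module R M" and N: "module R N" and M': "module R M'" and N': "module R N'"
    and M'': "module R M''" and N'': "module R N''"
    and f: "f \<in> module_hom R M M'" and g: "g \<in> module_hom R N N'"
    and f': "f' \<in> module_hom R M' M''" and g': "g' \<in> module_hom R N' N''"
    and t: "t \<in> carrier (tensor R M N)"
  shows "tensor_map R M' N' M'' N'' f' g' (tensor_map R M N M' N' f g t) =
    tensor_map R M N M'' N'' (\<lambda>m. f' (f m)) (\<lambda>n. g' (g n)) t"
proof -
  note ff = module_hom_comp[OF f f'] and gg = module_hom_comp[OF g g']
  show ?thesis
    by (rule tensor_eqI[OF M N tensor_module[OF M'' N''] _ _ _ t])
       (simp_all add: tensor_map_linear tensor_map_pure assms ff gg module_hom_closed[OF f] module_hom_closed[OF g]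
         module_hom_comp[OF tensor_map_linear[OF M N M' N' f g] tensor_map_linear[OF M' N' M'' N'' f' g']])
qed

lemma tensor_map_sum_left:
  assumes M: "module R M" and N: "module R N" and M': "module R M'" and N': "module R N'"
    and f: "f \<in> module_hom R M M'" and f': "f' \<in> module_hom R M M'" and g: "g \<in> module_hom R N N'"
    and t: "t \<in> carrier (tensor R M N)"
  shows "tensor_map R M N M' N' (\<lambda>m. f m \<oplus>\<^bsub>M'\<^esub> f' m) g t =
    tensor_map R M N M' N' f g t \<oplus>\<^bsub>tensor R M' N'\<^esub> tensor_map R M N M' N' f' g t"
proof (rule tensor_eqI[OF M N tensor_module[OF M' N'] _ _ _ t])
  show "(\<lambda>t. tensor_map R M N M' N' f g t \<oplus>\<^bsub>tensor R M' N'\<^esub> tensor_map R M N M' N' f' g t)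
      \<in> module_hom R (tensor R M N) (tensor R M' N')"
    by (intro module_hom_sum tensor_map_linear tensor_module assms)
qed (simp_all add: tensor_map_linear tensor_map_pure module_hom_sum assms pure_tensor_add_left
       module_hom_closed[OF f] module_hom_closed[OF f'] module_hom_closed[OF g])

lemma tensor_map_zero_left:
  assumes M: "module R M" and N: "module R N" and M': "module R M'" and N': "module R N'"
    and g: "g \<in> module_hom R N N'" and t: "t \<in> carrier (tensor R M N)"
  shows "tensor_map R M N M' N' (\<lambda>_. \<zero>\<^bsub>M'\<^esub>) g t = \<zero>\<^bsub>tensor R M' N'\<^esub>"
proof (rule tensor_eqI[OF M N tensor_module[OF M' N'] _ _ _ t])
  note z = module_hom_const_zero[OF M', of M]
  show "tensor_map R M N M' N' (\<lambda>_. \<zero>\<^bsub>M'\<^esub>) g \<in> module_hom R (tensor R M N) (tensor R M' N')"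
    by (rule tensor_map_linear[OF M N M' N' z g])
  show "(\<lambda>_. \<zero>\<^bsub>tensor R M' N'\<^esub>) \<in> module_hom R (tensor R M N) (tensor R M' N')"
    by (rule module_hom_const_zero[OF tensor_module[OF M' N']])
  fix m n assume "m \<in> carrier M" "n \<in> carrier N"
  then show "tensor_map R M N M' N' (\<lambda>_. \<zero>\<^bsub>M'\<^esub>) g (pure_tensor R M N m n) = \<zero>\<^bsub>tensor R M' N'\<^esub>"
    using module_hom_zero[OF M' tensor_module[OF M' N'] pure_tensor_linear_left[OF M' N']] module_hom_closed[OF g]
    by (simp add: tensor_map_pure[OF M N M' N' z g])
qed

lemma tensor_eqI3:
  assumes M: "module R M" and N: "module R N" and P: "module R P" and Q: "module R Q"
    and h: "h \<in> module_hom R (tensor R (tensor R M N) P) Q" and k: "k \<in> module_hom R (tensor R (tensor R M N) P) Q"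
    and eq: "\<And>m n p. m \<in> carrier M \<Longrightarrow> n \<in> carrier N \<Longrightarrow> p \<in> carrier P \<Longrightarrow>
      h (pure_tensor R (tensor R M N) P (pure_tensor R M N m n) p) =
      k (pure_tensor R (tensor R M N) P (pure_tensor R M N m n) p)"
    and t: "t \<in> carrier (tensor R (tensor R M N) P)"
  shows "h t = k t"
proof (rule tensor_eqI[OF tensor_module[OF M N] P Q h k _ t])
  fix s p assume s: "s \<in> carrier (tensor R M N)" and p: "p \<in> carrier P"
  note lin = pure_tensor_linear_left[OF tensor_module[OF M N] P p]
  show "h (pure_tensor R (tensor R M N) P s p) = k (pure_tensor R (tensor R M N) P s p)"
    by (rule tensor_eqI[OF M N Q module_hom_comp[OF lin h] module_hom_comp[OF lin k] _ s]) (rule eq[OF _ _ p])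
qed

lemma
  assumes M: "module R M" and N: "module R N" and P: "module R P"
  shows tensor_assoc_linear:
      "tensor_assoc R M N P \<in> module_hom R (tensor R (tensor R M N) P) (tensor R M (tensor R N P))"
    and tensor_assoc_pure: "m \<in> carrier M \<Longrightarrow> n \<in> carrier N \<Longrightarrow> p \<in> carrier P \<Longrightarrow>
      tensor_assoc R M N P (pure_tensor R (tensor R M N) P (pure_tensor R M N m n) p) =
      pure_tensor R M (tensor R N P) m (pure_tensor R N P n p)"
proof -
  note NP = tensor_module[OF N P] and MN = tensor_module[OF M N]
  note T = tensor_module[OF M NP]
  interpret T: module R "tensor R M (tensor R N P)" by (rule T)
  interpret P: module R P by fact
  let ?b = "\<lambda>p m n. pure_tensor R M (tensor R N P) m (pure_tensor R N P n p)"
  let ?L = "\<lambda>t p. tensor_lift R M N (tensor R M (tensor R N P)) (?b p) t"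
  have b: "bilinear_map R M N (tensor R M (tensor R N P)) (?b p)" if "p \<in> carrier P" for p
    using bilinear_pure_tensor[OF M N M NP module_hom_id pure_tensor_linear_left[OF N P that]] by simp
  note lin = tensor_lift_linear[OF M N T b] and pure = tensor_lift_pure[OF M N T b]
  have bil: "bilinear_map R (tensor R M N) P (tensor R M (tensor R N P)) ?L"
    unfolding bilinear_map_def
  proof (intro conjI ballI)
    fix p assume "p \<in> carrier P"
    then show "(\<lambda>t. ?L t p) \<in> module_hom R (tensor R M N) (tensor R M (tensor R N P))" by (rule lin)
  next
    fix t assume t: "t \<in> carrier (tensor R M N)"
    show "?L t \<in> module_hom R P (tensor R M (tensor R N P))"
    proof (rule module_homI)
      fix p assume "p \<in> carrier P"
      then show "?L t p \<in> carrier (tensor R M (tensor R N P))" using module_hom_closed[OF lin] t by blast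
    next
      fix p p' assume p: "p \<in> carrier P" "p' \<in> carrier P"
      show "?L t (p \<oplus>\<^bsub>P\<^esub> p') = ?L t p \<oplus>\<^bsub>tensor R M (tensor R N P)\<^esub> ?L t p'"
        by (rule tensor_eqI[OF M N T lin module_hom_sum[OF MN T lin lin] _ t])
           (use p in \<open>simp_all add: pure pure_tensor_add_right pure_tensor_closed M N P NP\<close>)
    next
      fix r p assume p: "r \<in> carrier R" "p \<in> carrier P"
      show "?L t (r \<odot>\<^bsub>P\<^esub> p) = r \<odot>\<^bsub>tensor R M (tensor R N P)\<^esub> ?L t p"
        by (rule tensor_eqI[OF M N T lin module_hom_smult_const[OF MN T lin] _ t])
           (use p in \<open>simp_all add: pure pure_tensor_smult_right pure_tensor_closed M N P NP\<close>)
    qed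
  qed
  show "tensor_assoc R M N P \<in> module_hom R (tensor R (tensor R M N) P) (tensor R M (tensor R N P))"
    unfolding tensor_assoc_def Let_def by (rule tensor_lift_linear[OF MN P T bil])
  show "tensor_assoc R M N P (pure_tensor R (tensor R M N) P (pure_tensor R M N m n) p) =
      pure_tensor R M (tensor R N P) m (pure_tensor R N P n p)"
    if "m \<in> carrier M" "n \<in> carrier N" "p \<in> carrier P"
    unfolding tensor_assoc_def Let_def
    using that by (simp add: tensor_lift_pure[OF MN P T bil] pure pure_tensor_closed[OF M N])
qed

text \<open>Naturality is needed in the first variable only: there a colinear map acts on \<open>M \<otimes> A \<otimes> A\<close>.\<close>

lemma tensor_assoc_natural:
  assumes M: "module R M" and M': "module R M'" and N: "module R N" and P: "module R P"
    and f: "f \<in> module_hom R M M'" and t: "t \<in> carrier (tensor R (tensor R M N) P)"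
  shows "tensor_assoc R M' N P (tensor_map R (tensor R M N) P (tensor R M' N) P (tensor_map R M N M' N f id) id t) =
    tensor_map R M (tensor R N P) M' (tensor R N P) f id (tensor_assoc R M N P t)"
proof -
  note NP = tensor_module[OF N P] and MN = tensor_module[OF M N] and MN' = tensor_module[OF M' N]
  note a = tensor_assoc_linear[OF M N P] and a' = tensor_assoc_linear[OF M' N P]
  note f1 = tensor_map_linear[OF M N M' N f module_hom_id]
  note f11 = tensor_map_linear[OF MN P MN' P f1 module_hom_id] and f2 = tensor_map_linear[OF M NP M' NP f module_hom_id]
  show ?thesis
    by (rule tensor_eqI3[OF M N P tensor_module[OF M' NP] module_hom_comp[OF f11 a'] module_hom_comp[OF a f2] _ t])
       (simp add: tensor_map_pure[OF MN P MN' P f1 module_hom_id] tensor_map_pure[OF M N M' N f module_hom_id]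
         tensor_map_pure[OF M NP M' NP f module_hom_id] tensor_assoc_pure M N P M' pure_tensor_closed
         module_hom_closed[OF f])
qed

text \<open>Injective linear maps stay injective after tensoring, because a generalized inverse of \<open>f\<close> is a left
inverse.\<close>

lemma tensor_map_injective:
  assumes K: "field K" and M: "module K M" and M': "module K M'" and N: "module K N"
    and f: "f \<in> module_hom K M M'" and inj: "inj_on f (carrier M)"
    and s: "s \<in> carrier (tensor K M N)" and t: "t \<in> carrier (tensor K M N)"
    and eq: "tensor_map K M N M' N f id s = tensor_map K M N M' N f id t"
  shows "s = t"
proof -
  obtain g where g: "g \<in> module_hom K M' M" and fgf: "\<And>m. m \<in> carrier M \<Longrightarrow> f (g (f m)) = f m"
    using linear_generalized_inverse[OF K M M' f] by blast
  have gf: "g (f m) = id m" if "m \<in> carrier M" for m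
    using inj_onD[OF inj fgf[OF that]] that module_hom_closed[OF g] module_hom_closed[OF f] by simp
  have "tensor_map K M' N M N g id (tensor_map K M N M' N f id x) = x" if "x \<in> carrier (tensor K M N)" for x
  proof -
    have "tensor_map K M' N M N g id (tensor_map K M N M' N f id x) = tensor_map K M N M N id id x"
      using tensor_map_comp[OF M N M' N M N f module_hom_id g module_hom_id that]
        tensor_map_cong[OF M N M N module_hom_comp[OF f g] module_hom_id gf _ that, of id]
      by (simp add: id_def)
    then show ?thesis using tensor_map_id[OF M N that] by simp
  qed
  then show ?thesis using eq s t by metis
qed

section \<open>Subspaces of a tensor product\<close>

text \<open>Tensor products ignore the remaining fields of the records, such as the coaction.\<close>

lemma
  assumes eq: "carrier M = carrier M'" "add M = add M'" "smult M = smult M'"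
  shows tensor_cong_left: "tensor R M N = tensor R M' N"
    and pure_tensor_cong_left: "pure_tensor R M N = pure_tensor R M' N"
    and tensor_map_cong_source: "tensor_map R M N P Q = tensor_map R M' N P Q"
    and tensor_map_cong_target: "tensor_map R P Q M N = tensor_map R P Q M' N"
proof -
  have r: "tensor_relations R M N = tensor_relations R M' N"
    by (simp add: tensor_relations_def eq)
  show T: "tensor R M N = tensor R M' N" by (simp only: tensor_eq_presented eq r)
  show p: "pure_tensor R M N = pure_tensor R M' N"
    by (intro ext) (simp only: tensor_eq_presented eq r)
  show "tensor_map R M N P Q = tensor_map R M' N P Q" "tensor_map R P Q M N = tensor_map R P Q M' N"
    by (intro ext, simp only: tensor_map_def tensor_lift_def T p eq)+
qed

lemma tensor_map_comp_id:
  assumes "module R M" "module R N" "module R M'" "module R M''"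
    and "f \<in> module_hom R M M'" "g \<in> module_hom R M' M''" "t \<in> carrier (tensor R M N)"
  shows "tensor_map R M' N M'' N g id (tensor_map R M N M' N f id t) = tensor_map R M N M'' N (\<lambda>m. g (f m)) id t"
  using tensor_map_comp[OF assms(1,2,3,2,4,2,5) module_hom_id assms(6) module_hom_id assms(7)] by (simp add: id_def)

lemma inclusion_linear: "W \<subseteq> carrier M \<Longrightarrow> id \<in> module_hom R (M\<lparr>carrier := W\<rparr>) M"
  by (auto simp: module_hom_def)

lemma tensor_image_submodule:
  assumes M: "module K M" and N: "module K N" and W: "submodule W K M" and Y: "submodule Y K N"
  shows "submodule (tensor_image K M N W Y) K (tensor K M N)"
  unfolding tensor_image_def
proof (rule module_hom_image)
  have WM: "module K (M\<lparr>carrier := W\<rparr>)" and YN: "module K (N\<lparr>carrier := Y\<rparr>)"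
    using submodule_module M N W Y by blast+
  show T: "module K (tensor K (M\<lparr>carrier := W\<rparr>) (N\<lparr>carrier := Y\<rparr>))" by (rule tensor_module[OF WM YN])
  show "module K (tensor K M N)" by (rule tensor_module[OF M N])
  show "tensor_map K (M\<lparr>carrier := W\<rparr>) (N\<lparr>carrier := Y\<rparr>) M N id id
      \<in> module_hom K (tensor K (M\<lparr>carrier := W\<rparr>) (N\<lparr>carrier := Y\<rparr>)) (tensor K M N)"
    using W Y by (intro tensor_map_linear WM YN M N inclusion_linear) (auto simp: submodule_iff[OF M] submodule_iff[OF N])
  show "submodule (carrier (tensor K (M\<lparr>carrier := W\<rparr>) (N\<lparr>carrier := Y\<rparr>))) K
      (tensor K (M\<lparr>carrier := W\<rparr>) (N\<lparr>carrier := Y\<rparr>))"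
    by (rule module.carrier_is_submodule[OF T])
qed

lemma
  assumes M: "module K M" and N: "module K N" and W: "submodule W K M" and Y: "submodule Y K N"
  shows tensor_image_pure: "w \<in> W \<Longrightarrow> y \<in> Y \<Longrightarrow> pure_tensor K M N w y \<in> tensor_image K M N W Y"
    and tensor_image_induct: "t \<in> tensor_image K M N W Y \<Longrightarrow>
      (\<And>w y. w \<in> W \<Longrightarrow> y \<in> Y \<Longrightarrow> P (pure_tensor K M N w y)) \<Longrightarrow>
      (\<And>s t. s \<in> tensor_image K M N W Y \<Longrightarrow> t \<in> tensor_image K M N W Y \<Longrightarrow> P s \<Longrightarrow> P t \<Longrightarrow>
        P (s \<oplus>\<^bsub>tensor K M N\<^esub> t)) \<Longrightarrow> P t"
proof -
  let ?W = "M\<lparr>carrier := W\<rparr>" and ?Y = "N\<lparr>carrier := Y\<rparr>"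
  let ?T = "tensor K ?W ?Y" and ?j = "tensor_map K ?W ?Y M N id id"
  have WM: "module K ?W" and YN: "module K ?Y"
    using submodule_module M N W Y by blast+
  have iW: "id \<in> module_hom K ?W M" and iY: "id \<in> module_hom K ?Y N"
    using W Y by (auto intro!: inclusion_linear simp: submodule_iff[OF M] submodule_iff[OF N])
  note j = tensor_map_linear[OF WM YN M N iW iY] and jp = tensor_map_pure[OF WM YN M N iW iY]
  show pure: "pure_tensor K M N w y \<in> tensor_image K M N W Y" if "w \<in> W" "y \<in> Y" for w y
    unfolding tensor_image_def
    using that pure_tensor_closed[OF WM YN, of w y] jp[of w y]
    by (intro rev_image_eqI[of "pure_tensor K ?W ?Y w y"]) simp_all
  show "P t" if t: "t \<in> tensor_image K M N W Y"
    and P: "\<And>w y. w \<in> W \<Longrightarrow> y \<in> Y \<Longrightarrow> P (pure_tensor K M N w y)"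
    and add: "\<And>s t. s \<in> tensor_image K M N W Y \<Longrightarrow> t \<in> tensor_image K M N W Y \<Longrightarrow> P s \<Longrightarrow> P t \<Longrightarrow>
        P (s \<oplus>\<^bsub>tensor K M N\<^esub> t)"
  proof -
    obtain t' where t': "t' \<in> carrier ?T" "t = ?j t'" using t by (auto simp: tensor_image_def)
    have "P (?j t')"
    proof (rule tensor_induct[OF WM YN t'(1), of "\<lambda>x. P (?j x)"])
      fix w y assume "w \<in> carrier ?W" "y \<in> carrier ?Y"
      then show "P (?j (pure_tensor K ?W ?Y w y))" using P by (simp only: jp) simp
    next
      fix s t assume "s \<in> carrier ?T" "t \<in> carrier ?T" "P (?j s)" "P (?j t)"
      then show "P (?j (s \<oplus>\<^bsub>?T\<^esub> t))"
        unfolding module_hom_add[OF j \<open>s \<in> carrier ?T\<close> \<open>t \<in> carrier ?T\<close>]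
        by (intro add) (auto simp: tensor_image_def)
    qed
    then show ?thesis using t' by simp
  qed
qed

lemma tensor_map_tensor_image:
  assumes M: "module K M" and N: "module K N" and W: "submodule W K M" and Y: "submodule Y K N"
    and M': "module K M'" and N': "module K N'" and W': "submodule W' K M'" and Y': "submodule Y' K N'"
    and f: "f \<in> module_hom K M M'" and g: "g \<in> module_hom K N N'" and fW: "f ` W \<subseteq> W'" and gY: "g ` Y \<subseteq> Y'"
    and t: "t \<in> tensor_image K M N W Y"
  shows "tensor_map K M N M' N' f g t \<in> tensor_image K M' N' W' Y'"
proof -
  have WM: "W \<subseteq> carrier M" "Y \<subseteq> carrier N" using W Y by (auto simp: submodule_iff[OF M] submodule_iff[OF N])
  note I = tensor_image_submodule[OF M N W Y] and I' = tensor_image_submodule[OF M' N' W' Y']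
  have IC: "tensor_image K M N W Y \<subseteq> carrier (tensor K M N)"
    using I by (simp add: submodule_iff[OF tensor_module[OF M N]])
  show ?thesis
  proof (rule tensor_image_induct[OF M N W Y t])
    fix w y assume "w \<in> W" "y \<in> Y"
    then show "tensor_map K M N M' N' f g (pure_tensor K M N w y) \<in> tensor_image K M' N' W' Y'"
      using WM fW gY by (auto simp: tensor_map_pure[OF M N M' N' f g] subset_iff intro!: tensor_image_pure[OF M' N' W' Y'])
  next
    fix s t assume "s \<in> tensor_image K M N W Y" "t \<in> tensor_image K M N W Y"
      "tensor_map K M N M' N' f g s \<in> tensor_image K M' N' W' Y'"
      "tensor_map K M N M' N' f g t \<in> tensor_image K M' N' W' Y'"
    then show "tensor_map K M N M' N' f g (s \<oplus>\<^bsub>tensor K M N\<^esub> t) \<in> tensor_image K M' N' W' Y'"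
      using I' IC by (auto simp: module_hom_add[OF tensor_map_linear[OF M N M' N' f g]] subset_iff
          submodule_iff[OF tensor_module[OF M' N']])
  qed
qed

lemma tensor_image_mono:
  assumes M: "module K M" and N: "module K N" and W: "submodule W K M" and Y: "submodule Y K N"
    and W': "submodule W' K M" and Y': "submodule Y' K N" and le: "W \<subseteq> W'" "Y \<subseteq> Y'"
  shows "tensor_image K M N W Y \<subseteq> tensor_image K M N W' Y'"
proof
  fix t assume t: "t \<in> tensor_image K M N W Y"
  have tc: "t \<in> carrier (tensor K M N)"
    using t tensor_image_submodule[OF M N W Y] by (auto simp: submodule_iff[OF tensor_module[OF M N]])
  have "tensor_map K M N M N id id t \<in> tensor_image K M N W' Y'"
    by (rule tensor_map_tensor_image[OF M N W Y M N W' Y' module_hom_id module_hom_id _ _ t])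
       (use le in auto)
  then show "t \<in> tensor_image K M N W' Y'" using tensor_map_id[OF M N tc] by simp
qed

lemma tensor_image_carrier:
  assumes M: "module K M" and N: "module K N"
  shows "tensor_image K M N (carrier M) (carrier N) = carrier (tensor K M N)"
  unfolding tensor_image_def using tensor_map_id[OF M N] by force

text \<open>This is \<open>ker (f \<otimes> 1) \<inter> (M \<otimes> Y) \<subseteq> ker f \<otimes> Y\<close>.  Let \<open>g\<close> be a generalized inverse of \<open>f\<close> and
\<open>e = 1 - g f\<close>, which maps into \<open>ker f\<close>.  Then \<open>t = (e \<otimes> 1) t + (g f \<otimes> 1) t\<close>; the second summand vanishes
and the first lies in \<open>ker f \<otimes> Y\<close>.\<close>

lemma tensor_map_kernel:
  assumes K: "field K" and M: "module K M" and M': "module K M'" and N: "module K N" and Y: "submodule Y K N"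
    and f: "f \<in> module_hom K M M'" and t: "t \<in> tensor_image K M N (carrier M) Y"
    and zero: "tensor_map K M N M' N f id t = \<zero>\<^bsub>tensor K M' N\<^esub>"
  shows "t \<in> tensor_image K M N {m \<in> carrier M. f m = \<zero>\<^bsub>M'\<^esub>} Y"
proof -
  interpret M: module K M by fact
  note sM = M.carrier_is_submodule
  note T = tensor_module[OF M N] and T' = tensor_module[OF M' N]
  interpret T: module K "tensor K M N" by (rule T)
  have tc: "t \<in> carrier (tensor K M N)"
    using t tensor_image_submodule[OF M N sM Y] by (auto simp: submodule_iff[OF T])
  obtain g where g: "g \<in> module_hom K M' M" and fgf: "\<And>m. m \<in> carrier M \<Longrightarrow> f (g (f m)) = f m"
    using linear_generalized_inverse[OF K M M' f] by blast
  define e where "e m = m \<ominus>\<^bsub>M\<^esub> g (f m)" for m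
  note gf = module_hom_comp[OF f g]
  have e: "e \<in> module_hom K M M"
    using module_hom_diff[OF M M module_hom_id gf] by (simp add: e_def[abs_def])
  have gfc: "g (f m) \<in> carrier M" if "m \<in> carrier M" for m by (rule module_hom_closed[OF gf that])
  have eker: "f (e m) = \<zero>\<^bsub>M'\<^esub>" if "m \<in> carrier M" for m
    using that gfc[OF that] module_hom_closed[OF f]
    by (simp add: e_def module_hom_minus[OF M M' f] fgf minus_eq_zero_iff[OF M'])
  have "tensor_map K M N M N (\<lambda>m. e m \<oplus>\<^bsub>M\<^esub> g (f m)) id t = tensor_map K M N M N id id t"
    by (rule tensor_map_cong[OF M N M N module_hom_sum[OF M M e gf] module_hom_id _ _ tc])
       (simp_all add: e_def gfc a_minus_def M.a_assoc M.l_neg)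
  then have "tensor_map K M N M N e id t \<oplus>\<^bsub>tensor K M N\<^esub> tensor_map K M N M N (\<lambda>m. g (f m)) id t = t"
    using tensor_map_id[OF M N tc] by (simp add: tensor_map_sum_left[OF M N M N e gf module_hom_id tc])
  moreover have "tensor_map K M N M N (\<lambda>m. g (f m)) id t = \<zero>\<^bsub>tensor K M N\<^esub>"
    using tensor_map_comp_id[OF M N M' M f g tc] zero
      module_hom_zero[OF T' T tensor_map_linear[OF M' N M N g module_hom_id]] by simp
  moreover have "tensor_map K M N M N e id t \<in> carrier (tensor K M N)"
    by (rule tensor_map_closed[OF M N M N e module_hom_id tc])
  ultimately have "tensor_map K M N M N e id t = t" by simp
  moreover have "tensor_map K M N M N e id t \<in> tensor_image K M N {m \<in> carrier M. f m = \<zero>\<^bsub>M'\<^esub>} Y"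
    by (rule tensor_map_tensor_image[OF M N sM Y M N module_hom_kernel[OF M M' f] Y e module_hom_id _ _ t])
       (use eker module_hom_closed[OF e] in auto)
  ultimately show ?thesis by simp
qed

section \<open>Comodules and colinear maps\<close>

text \<open>Unlike the arrows of the comodule category, colinear maps may connect comodules on different types and need
not be normalised outside the carrier.\<close>

definition colinear ::
  "('k, 'q) ring_scheme \<Rightarrow> ('k, 'a, 'd) module_scheme \<Rightarrow> ('k, 'a, 'm) comodule \<Rightarrow> ('k, 'a, 'n) comodule \<Rightarrow> ('m \<Rightarrow> 'n) \<Rightarrow> bool"
  where
  "colinear K A M N f \<longleftrightarrow> f \<in> module_hom K M N \<and>
     (\<forall>m\<in>carrier M. coact N (f m) = tensor_map K M A N A f id (coact M m))"

text \<open>The images of the \<open>\<gamma> i\<close> span \<open>L\<close>, stated as an induction principle.\<close>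

definition jointly_spanning ::
  "('k, 'q) ring_scheme \<Rightarrow> ('k, 'n, 'd) module_scheme \<Rightarrow> 'i set \<Rightarrow> ('i \<Rightarrow> ('k, 'm, 'e) module_scheme) \<Rightarrow>
   ('i \<Rightarrow> 'm \<Rightarrow> 'n) \<Rightarrow> bool" where
  "jointly_spanning K L I F \<gamma> \<longleftrightarrow>
     (\<forall>W. submodule W K L \<longrightarrow> (\<forall>i\<in>I. \<gamma> i ` carrier (F i) \<subseteq> W) \<longrightarrow> carrier L \<subseteq> W)"

lemma jointly_spanningD:
  "jointly_spanning K L I F \<gamma> \<Longrightarrow> submodule W K L \<Longrightarrow> (\<And>i. i \<in> I \<Longrightarrow> \<gamma> i ` carrier (F i) \<subseteq> W) \<Longrightarrow> carrier L \<subseteq> W"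
  by (simp add: jointly_spanning_def)

text \<open>A vector space with a linear coaction, before coassociativity and the counit law are known.\<close>

definition precomodule :: "('k, 'q) ring_scheme \<Rightarrow> ('k, 'a, 'd) module_scheme \<Rightarrow> ('k, 'a, 'm) comodule \<Rightarrow> bool" where
  "precomodule K A M \<longleftrightarrow> module K M \<and> coact M \<in> module_hom K M (tensor K M A)"

lemma comodule_precomodule: "is_comodule K A M \<Longrightarrow> precomodule K A M"
  by (simp add: is_comodule_def precomodule_def)

lemma comodule_hom_iff: "f \<in> comodule_hom K A M N \<longleftrightarrow> colinear K A M N f \<and> f \<in> extensional (carrier M)"
  by (auto simp: comodule_hom_def colinear_def)

lemma colinear_linear: "colinear K A M N f \<Longrightarrow> f \<in> module_hom K M N"
  by (simp add: colinear_def)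

lemma colinear_coact:
  "colinear K A M N f \<Longrightarrow> m \<in> carrier M \<Longrightarrow> coact N (f m) = tensor_map K M A N A f id (coact M m)"
  by (simp add: colinear_def)

context affine_group_scheme
begin

lemma field_K: "field K" ..

lemma A_module: "module K A" ..

lemma precomodule_module: "precomodule K A M \<Longrightarrow> module K M"
  and precomodule_coact: "precomodule K A M \<Longrightarrow> coact M \<in> module_hom K M (tensor K M A)"
  by (simp_all add: precomodule_def)

lemma colinear_cong:
  assumes M: "precomodule K A M" and N: "module K N" and f: "colinear K A M N f"
    and eq: "\<And>m. m \<in> carrier M \<Longrightarrow> f m = g m"
  shows "colinear K A M N g"
  unfolding colinear_def
proof (intro conjI ballI)
  note MM = precomodule_module[OF M]
  show "g \<in> module_hom K M N" by (rule module_hom_cong[OF MM eq colinear_linear[OF f]])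
  fix m assume m: "m \<in> carrier M"
  have "tensor_map K M A N A f id (coact M m) = tensor_map K M A N A g id (coact M m)"
    by (rule tensor_map_cong[OF MM A_module N A_module colinear_linear[OF f] module_hom_id eq _
          module_hom_closed[OF precomodule_coact[OF M] m]]) simp_all
  then show "coact N (g m) = tensor_map K M A N A g id (coact M m)"
    using colinear_coact[OF f m] eq[OF m] by simp
qed

lemma colinear_id: "precomodule K A M \<Longrightarrow> colinear K A M M id"
  unfolding colinear_def
proof (intro conjI ballI)
  fix m assume "precomodule K A M" "m \<in> carrier M"
  then show "coact M (id m) = tensor_map K M A M A id id (coact M m)"
    using tensor_map_id[OF precomodule_module A_module module_hom_closed[OF precomodule_coact], of M m] by simp
qed (rule module_hom_id)

lemma colinear_comp:
  assumes M: "precomodule K A M" and N: "module K N" and P: "module K P"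
    and f: "colinear K A M N f" and g: "colinear K A N P g"
  shows "colinear K A M P (\<lambda>m. g (f m))"
  unfolding colinear_def
proof (intro conjI ballI)
  show "(\<lambda>m. g (f m)) \<in> module_hom K M P"
    by (rule module_hom_comp[OF colinear_linear[OF f] colinear_linear[OF g]])
  fix m assume m: "m \<in> carrier M"
  then show "coact P (g (f m)) = tensor_map K M A P A (\<lambda>m. g (f m)) id (coact M m)"
    using colinear_coact[OF g module_hom_closed[OF colinear_linear[OF f]]] colinear_coact[OF f]
      tensor_map_comp_id[OF precomodule_module[OF M] A_module N P colinear_linear[OF f] colinear_linear[OF g]
        module_hom_closed[OF precomodule_coact[OF M]]] by simp
qed

lemma colinear_sum:
  assumes M: "precomodule K A M" and N: "precomodule K A N"
    and f: "colinear K A M N f" and g: "colinear K A M N g"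
  shows "colinear K A M N (\<lambda>m. f m \<oplus>\<^bsub>N\<^esub> g m)"
  unfolding colinear_def
proof (intro conjI ballI)
  note MM = precomodule_module[OF M] and NM = precomodule_module[OF N]
  note fl = colinear_linear[OF f] and gl = colinear_linear[OF g]
  show "(\<lambda>m. f m \<oplus>\<^bsub>N\<^esub> g m) \<in> module_hom K M N" by (rule module_hom_sum[OF MM NM fl gl])
  fix m assume m: "m \<in> carrier M"
  then show "coact N (f m \<oplus>\<^bsub>N\<^esub> g m) = tensor_map K M A N A (\<lambda>m. f m \<oplus>\<^bsub>N\<^esub> g m) id (coact M m)"
    using tensor_map_sum_left[OF MM A_module NM A_module fl gl module_hom_id module_hom_closed[OF precomodule_coact[OF M] m]]
    by (simp add: module_hom_add[OF precomodule_coact[OF N]] module_hom_closed[OF fl] module_hom_closed[OF gl]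
        colinear_coact[OF f] colinear_coact[OF g])
qed

text \<open>With \<open>r = -1\<close> this provides the additive inverses of arrows.\<close>

lemma colinear_smult:
  assumes M: "precomodule K A M" and N: "precomodule K A N" and r: "r \<in> carrier K"
    and f: "colinear K A M N f"
  shows "colinear K A M N (\<lambda>m. f (r \<odot>\<^bsub>M\<^esub> m))"
  unfolding colinear_def
proof (intro conjI ballI)
  note MM = precomodule_module[OF M] and NM = precomodule_module[OF N]
  interpret M: module K M by (rule MM)
  note fl = colinear_linear[OF f] and T = tensor_module[OF MM A_module] and T' = tensor_module[OF NM A_module]
  have rM: "(\<lambda>m. r \<odot>\<^bsub>M\<^esub> m) \<in> module_hom K M M"
    using module_hom_smult_const[OF MM MM module_hom_id r] by simp
  show fr: "(\<lambda>m. f (r \<odot>\<^bsub>M\<^esub> m)) \<in> module_hom K M N" by (rule module_hom_comp[OF rM fl])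
  fix m assume m: "m \<in> carrier M"
  then have cm: "coact M m \<in> carrier (tensor K M A)" by (rule module_hom_closed[OF precomodule_coact[OF M]])
  have "coact N (f (r \<odot>\<^bsub>M\<^esub> m)) = r \<odot>\<^bsub>tensor K N A\<^esub> tensor_map K M A N A f id (coact M m)"
    using m r cm by (simp add: colinear_coact[OF f] module_hom_smult[OF precomodule_coact[OF M]]
        module_hom_smult[OF tensor_map_linear[OF MM A_module NM A_module fl module_hom_id]])
  also have "\<dots> = tensor_map K M A N A (\<lambda>m. f (r \<odot>\<^bsub>M\<^esub> m)) id (coact M m)"
    by (rule tensor_eqI[OF MM A_module T' module_hom_smult_const[OF T T'
          tensor_map_linear[OF MM A_module NM A_module fl module_hom_id] r]
          tensor_map_linear[OF MM A_module NM A_module fr module_hom_id] _ cm])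
       (use r in \<open>simp add: tensor_map_pure[OF MM A_module NM A_module _ module_hom_id] fl fr module_hom_smult[OF fl]
         pure_tensor_smult_left[OF NM A_module] module_hom_closed[OF fl]\<close>)
  finally show "coact N (f (r \<odot>\<^bsub>M\<^esub> m)) = tensor_map K M A N A (\<lambda>m. f (r \<odot>\<^bsub>M\<^esub> m)) id (coact M m)" .
qed

lemma colinear_zero:
  assumes M: "precomodule K A M" and N: "precomodule K A N"
  shows "colinear K A M N (\<lambda>_. \<zero>\<^bsub>N\<^esub>)"
  unfolding colinear_def
  using module_hom_zero[OF precomodule_module[OF N] tensor_module[OF precomodule_module[OF N] A_module] precomodule_coact[OF N]]
    tensor_map_zero_left[OF precomodule_module[OF M] A_module precomodule_module[OF N] A_module module_hom_id
      module_hom_closed[OF precomodule_coact[OF M]]]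
  by (auto simp: module_hom_const_zero[OF precomodule_module[OF N]])

text \<open>Both sides of the colinearity equation for \<open>u\<close> are linear, so it is enough to check it on a spanning
family.\<close>

lemma colinear_through_generators:
  assumes N: "precomodule K A N" and P: "precomodule K A P" and u: "u \<in> module_hom K N P"
    and F: "\<And>i. i \<in> I \<Longrightarrow> precomodule K A (F i)" and \<gamma>: "\<And>i. i \<in> I \<Longrightarrow> colinear K A (F i) N (\<gamma> i)"
    and span: "jointly_spanning K N I F \<gamma>"
    and u\<gamma>: "\<And>i. i \<in> I \<Longrightarrow> colinear K A (F i) P (\<lambda>m. u (\<gamma> i m))"
  shows "colinear K A N P u"
proof -
  note NM = precomodule_module[OF N] and PM = precomodule_module[OF P]
  let ?E = "{n \<in> carrier N. coact P (u n) = tensor_map K N A P A u id (coact N n)}"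
  have "submodule ?E K N"
    by (rule module_hom_equalizer[OF NM tensor_module[OF PM A_module]
          module_hom_comp[OF u precomodule_coact[OF P]]
          module_hom_comp[OF precomodule_coact[OF N] tensor_map_linear[OF NM A_module PM A_module u module_hom_id]]])
  moreover have "\<gamma> i ` carrier (F i) \<subseteq> ?E" if i: "i \<in> I" for i
  proof (rule image_subsetI, rule CollectI, rule conjI)
    fix m assume m: "m \<in> carrier (F i)"
    note g = colinear_linear[OF \<gamma>[OF i]]
    show "\<gamma> i m \<in> carrier N" by (rule module_hom_closed[OF g m])
    show "coact P (u (\<gamma> i m)) = tensor_map K N A P A u id (coact N (\<gamma> i m))"
      using colinear_coact[OF u\<gamma>[OF i] m] colinear_coact[OF \<gamma>[OF i] m]
        tensor_map_comp_id[OF precomodule_module[OF F[OF i]] A_module NM PM g u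
          module_hom_closed[OF precomodule_coact[OF F[OF i]] m]] by simp
  qed
  ultimately have "carrier N \<subseteq> ?E" by (rule jointly_spanningD[OF span])
  then show ?thesis using u by (auto simp: colinear_def)
qed

lemma colinear_through_surjection:
  assumes M: "precomodule K A M" and N: "precomodule K A N" and P: "precomodule K A P"
    and u: "u \<in> module_hom K N P" and q: "colinear K A M N q" and surj: "q ` carrier M = carrier N"
    and uq: "colinear K A M P (\<lambda>m. u (q m))"
  shows "colinear K A N P u"
  by (rule colinear_through_generators[OF N P u, of "{()}" "\<lambda>_. M" "\<lambda>_. q"])
     (use M q uq surj in \<open>auto simp: jointly_spanning_def\<close>)

text \<open>The colinearity equation for \<open>u\<close> may be checked after applying the injective map \<open>f \<otimes> 1\<close>.\<close>

lemma colinear_through_injection: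
  assumes M: "precomodule K A M" and N: "precomodule K A N" and P: "precomodule K A P"
    and u: "u \<in> module_hom K P M" and f: "colinear K A M N f" and inj: "inj_on f (carrier M)"
    and fu: "colinear K A P N (\<lambda>m. f (u m))"
  shows "colinear K A P M u"
  unfolding colinear_def
proof (rule conjI[OF u], rule ballI)
  note MM = precomodule_module[OF M] and NM = precomodule_module[OF N] and PM = precomodule_module[OF P]
  fix m assume m: "m \<in> carrier P"
  note um = module_hom_closed[OF u m] and cm = module_hom_closed[OF precomodule_coact[OF P] m]
  show "coact M (u m) = tensor_map K P A M A u id (coact P m)"
  proof (rule tensor_map_injective[OF field_K MM NM A_module colinear_linear[OF f] inj])
    show "coact M (u m) \<in> carrier (tensor K M A)" by (rule module_hom_closed[OF precomodule_coact[OF M] um])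
    show "tensor_map K P A M A u id (coact P m) \<in> carrier (tensor K M A)"
      by (rule tensor_map_closed[OF PM A_module MM A_module u module_hom_id cm])
    show "tensor_map K M A N A f id (coact M (u m)) = tensor_map K M A N A f id (tensor_map K P A M A u id (coact P m))"
      using colinear_coact[OF fu m] colinear_coact[OF f um]
        tensor_map_comp_id[OF PM A_module MM NM u colinear_linear[OF f] cm] by simp
  qed
qed

subsection \<open>Transport of the comodule axioms along colinear maps\<close>

abbreviation coassoc_lhs :: "('k, 'a, 'm) comodule \<Rightarrow> 'm \<Rightarrow> ('m \<times> ('a \<times> 'a \<Rightarrow> 'k) set \<Rightarrow> 'k) set" where
  "coassoc_lhs M m \<equiv> tensor_assoc K M A A (tensor_map K M A (tensor K M A) A (coact M) id (coact M m))"

abbreviation coassoc_rhs :: "('k, 'a, 'm) comodule \<Rightarrow> 'm \<Rightarrow> ('m \<times> ('a \<times> 'a \<Rightarrow> 'k) set \<Rightarrow> 'k) set" where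
  "coassoc_rhs M m \<equiv> tensor_map K M A M (tensor K A A) id (comult A) (coact M m)"

abbreviation counit_action :: "('k, 'a, 'm) comodule \<Rightarrow> 'm \<Rightarrow> 'm" where
  "counit_action M m \<equiv> tensor_lift K M A M (\<lambda>n a. counit A a \<odot>\<^bsub>M\<^esub> n) (coact M m)"

lemma counit_bilinear:
  assumes M: "module K M"
  shows "bilinear_map K M A M (\<lambda>n a. counit A a \<odot>\<^bsub>M\<^esub> n)"
proof -
  interpret M: module K M by fact
  have c: "counit A a \<in> carrier K" "counit A (a \<oplus>\<^bsub>A\<^esub> b) = counit A a \<oplus>\<^bsub>K\<^esub> counit A b"
    if "a \<in> carrier A" "b \<in> carrier A" for a b
    using counit_ring_hom that by (auto simp: ring_hom_def)
  show ?thesis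
    unfolding bilinear_map_def
  proof (intro conjI ballI)
    fix a assume "a \<in> carrier A"
    then have "counit A a \<in> carrier K" using c by blast
    then show "(\<lambda>n. counit A a \<odot>\<^bsub>M\<^esub> n) \<in> module_hom K M M"
      using module_hom_smult_const[OF M M module_hom_id] by simp
  next
    fix n assume "n \<in> carrier M"
    then show "(\<lambda>a. counit A a \<odot>\<^bsub>M\<^esub> n) \<in> module_hom K A M"
      by (intro module_homI) (simp_all add: c counit_linear M.smult_l_distr M.smult_assoc1)
  qed
qed

lemma
  assumes M: "precomodule K A M"
  shows coassoc_lhs_linear: "coassoc_lhs M \<in> module_hom K M (tensor K M (tensor K A A))"
    and coassoc_rhs_linear: "coassoc_rhs M \<in> module_hom K M (tensor K M (tensor K A A))"
    and counit_action_linear: "counit_action M \<in> module_hom K M M"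
proof -
  note MM = precomodule_module[OF M] and d = precomodule_coact[OF M]
  note AA = tensor_module[OF A_module A_module] and MA = tensor_module[OF MM A_module]
  show "coassoc_lhs M \<in> module_hom K M (tensor K M (tensor K A A))"
    by (rule module_hom_comp[OF d module_hom_comp[OF tensor_map_linear[OF MM A_module MA A_module d module_hom_id]
          tensor_assoc_linear[OF MM A_module A_module]]])
  show "coassoc_rhs M \<in> module_hom K M (tensor K M (tensor K A A))"
    by (rule module_hom_comp[OF d tensor_map_linear[OF MM A_module MM AA module_hom_id comult_linear]])
  show "counit_action M \<in> module_hom K M M"
    by (rule module_hom_comp[OF d tensor_lift_linear[OF MM A_module MM counit_bilinear[OF MM]]])
qed

text \<open>A colinear map carries both sides of the coassociativity law and of the counit law at \<open>m\<close> to the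
corresponding sides at \<open>f m\<close>.  The laws can therefore be transported forwards along spanning families and
backwards along injections.\<close>

lemma
  assumes M: "precomodule K A M" and N: "precomodule K A N" and f: "colinear K A M N f" and m: "m \<in> carrier M"
  shows colinear_coassoc_lhs:
      "coassoc_lhs N (f m) = tensor_map K M (tensor K A A) N (tensor K A A) f id (coassoc_lhs M m)"
    and colinear_coassoc_rhs:
      "coassoc_rhs N (f m) = tensor_map K M (tensor K A A) N (tensor K A A) f id (coassoc_rhs M m)"
    and colinear_counit_action: "counit_action N (f m) = f (counit_action M m)"
proof -
  note MM = precomodule_module[OF M] and NM = precomodule_module[OF N]
  note d = precomodule_coact[OF M] and d' = precomodule_coact[OF N] and A = A_module
  note AA = tensor_module[OF A A] and MA = tensor_module[OF MM A] and NA = tensor_module[OF NM A]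
  note fl = colinear_linear[OF f] and cm = module_hom_closed[OF d m]
  note f1 = tensor_map_linear[OF MM A NM A fl module_hom_id]
  have "tensor_map K N A (tensor K N A) A (coact N) id (coact N (f m)) =
      tensor_map K M A (tensor K N A) A (\<lambda>m. coact N (f m)) id (coact M m)"
    by (simp add: colinear_coact[OF f m] tensor_map_comp_id[OF MM A NM NA fl d' cm])
  also have "\<dots> = tensor_map K M A (tensor K N A) A (\<lambda>m. tensor_map K M A N A f id (coact M m)) id (coact M m)"
    by (rule tensor_map_cong[OF MM A NA A module_hom_comp[OF fl d'] module_hom_id _ _ cm])
       (simp_all add: colinear_coact[OF f])
  also have "\<dots> = tensor_map K (tensor K M A) A (tensor K N A) A (tensor_map K M A N A f id) id
      (tensor_map K M A (tensor K M A) A (coact M) id (coact M m))"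
    by (rule tensor_map_comp_id[OF MM A MA NA d f1 cm, symmetric])
  finally show "coassoc_lhs N (f m) = tensor_map K M (tensor K A A) N (tensor K A A) f id (coassoc_lhs M m)"
    by (simp add: tensor_assoc_natural[OF MM NM A A fl tensor_map_closed[OF MM A MA A d module_hom_id cm]])
  have "tensor_map K N A N (tensor K A A) id (comult A) (tensor_map K M A N A f id (coact M m)) =
      tensor_map K M A N (tensor K A A) (\<lambda>m. id (f m)) (\<lambda>a. comult A (id a)) (coact M m)"
    by (rule tensor_map_comp[OF MM A NM A NM AA fl module_hom_id module_hom_id comult_linear cm])
  moreover have "tensor_map K M (tensor K A A) N (tensor K A A) f id (tensor_map K M A M (tensor K A A) id (comult A) (coact M m)) =
      tensor_map K M A N (tensor K A A) (\<lambda>m. f (id m)) (\<lambda>a. id (comult A a)) (coact M m)"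
    by (rule tensor_map_comp[OF MM A MM AA NM AA module_hom_id comult_linear fl module_hom_id cm])
  ultimately show "coassoc_rhs N (f m) = tensor_map K M (tensor K A A) N (tensor K A A) f id (coassoc_rhs M m)"
    by (simp add: colinear_coact[OF f m])
  note bM = counit_bilinear[OF MM] and bN = counit_bilinear[OF NM]
  note lM = tensor_lift_linear[OF MM A MM bM] and lN = tensor_lift_linear[OF NM A NM bN]
  have "tensor_lift K N A N (\<lambda>n a. counit A a \<odot>\<^bsub>N\<^esub> n) (tensor_map K M A N A f id (coact M m)) =
      f (counit_action M m)"
  proof (rule tensor_eqI[OF MM A NM module_hom_comp[OF f1 lN] module_hom_comp[OF lM fl] _ cm])
    fix x a assume x: "x \<in> carrier M" and a: "a \<in> carrier A"
    have "counit A a \<in> carrier K" using counit_ring_hom a by (auto simp: ring_hom_def)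
    then show "tensor_lift K N A N (\<lambda>n a. counit A a \<odot>\<^bsub>N\<^esub> n) (tensor_map K M A N A f id (pure_tensor K M A x a)) =
      f (tensor_lift K M A M (\<lambda>n a. counit A a \<odot>\<^bsub>M\<^esub> n) (pure_tensor K M A x a))"
      using x a by (simp add: tensor_map_pure[OF MM A NM A fl module_hom_id] tensor_lift_pure[OF NM A NM bN]
          tensor_lift_pure[OF MM A MM bM] module_hom_closed[OF fl] module_hom_smult[OF fl])
  qed
  then show "counit_action N (f m) = f (counit_action M m)" by (simp add: colinear_coact[OF f m])
qed

lemma is_comodule_iff:
  "is_comodule K A M \<longleftrightarrow> precomodule K A M \<and>
     (\<forall>m\<in>carrier M. coassoc_lhs M m = coassoc_rhs M m \<and> counit_action M m = m)"
  by (auto simp: is_comodule_def precomodule_def)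

lemma comodule_generated:
  assumes N: "precomodule K A N"
    and F: "\<And>i. i \<in> I \<Longrightarrow> is_comodule K A (F i)" and \<gamma>: "\<And>i. i \<in> I \<Longrightarrow> colinear K A (F i) N (\<gamma> i)"
    and span: "jointly_spanning K N I F \<gamma>"
  shows "is_comodule K A N"
proof -
  note NM = precomodule_module[OF N] and T = tensor_module[OF precomodule_module[OF N] tensor_module[OF A_module A_module]]
  have F': "precomodule K A (F i)" if "i \<in> I" for i using F[OF that] by (rule comodule_precomodule)
  have "submodule {n \<in> carrier N. coassoc_lhs N n = coassoc_rhs N n} K N"
    by (rule module_hom_equalizer[OF NM T coassoc_lhs_linear[OF N] coassoc_rhs_linear[OF N]])
  moreover have "\<gamma> i ` carrier (F i) \<subseteq> {n \<in> carrier N. coassoc_lhs N n = coassoc_rhs N n}" if i: "i \<in> I" for i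
    using F[OF i] module_hom_closed[OF colinear_linear[OF \<gamma>[OF i]]]
      colinear_coassoc_lhs[OF F'[OF i] N \<gamma>[OF i]] colinear_coassoc_rhs[OF F'[OF i] N \<gamma>[OF i]]
    by (auto simp: is_comodule_iff)
  ultimately have 1: "carrier N \<subseteq> {n \<in> carrier N. coassoc_lhs N n = coassoc_rhs N n}" by (rule jointly_spanningD[OF span])
  have "submodule {n \<in> carrier N. counit_action N n = id n} K N"
    by (rule module_hom_equalizer[OF NM NM counit_action_linear[OF N] module_hom_id])
  moreover have "\<gamma> i ` carrier (F i) \<subseteq> {n \<in> carrier N. counit_action N n = id n}" if i: "i \<in> I" for i
    using F[OF i] module_hom_closed[OF colinear_linear[OF \<gamma>[OF i]]] colinear_counit_action[OF F'[OF i] N \<gamma>[OF i]]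
    by (auto simp: is_comodule_iff)
  ultimately have 2: "carrier N \<subseteq> {n \<in> carrier N. counit_action N n = id n}" by (rule jointly_spanningD[OF span])
  show ?thesis using 1 2 N by (auto simp: is_comodule_iff)
qed

lemma comodule_embedded:
  assumes M: "precomodule K A M" and N: "is_comodule K A N" and f: "colinear K A M N f" and inj: "inj_on f (carrier M)"
  shows "is_comodule K A M"
  unfolding is_comodule_iff
proof (intro conjI ballI M)
  note N' = comodule_precomodule[OF N]
  note MM = precomodule_module[OF M] and NM = precomodule_module[OF N'] and AA = tensor_module[OF A_module A_module]
  fix m assume m: "m \<in> carrier M"
  note fm = module_hom_closed[OF colinear_linear[OF f] m]
  show "coassoc_lhs M m = coassoc_rhs M m"
  proof (rule tensor_map_injective[OF field_K MM NM AA colinear_linear[OF f] inj])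
    have "coassoc_lhs N (f m) = coassoc_rhs N (f m)" using N fm unfolding is_comodule_iff by blast
    then show "tensor_map K M (tensor K A A) N (tensor K A A) f id (coassoc_lhs M m) =
        tensor_map K M (tensor K A A) N (tensor K A A) f id (coassoc_rhs M m)"
      by (simp only: colinear_coassoc_lhs[OF M N' f m] colinear_coassoc_rhs[OF M N' f m])
  qed (rule module_hom_closed[OF coassoc_lhs_linear[OF M] m] module_hom_closed[OF coassoc_rhs_linear[OF M] m])+
  show "counit_action M m = m"
  proof (rule inj_onD[OF inj _ module_hom_closed[OF counit_action_linear[OF M] m] m])
    have "counit_action N (f m) = f m" using N fm unfolding is_comodule_iff by blast
    then show "f (counit_action M m) = f m" by (simp only: colinear_counit_action[OF M N' f m])
  qed
qed

end

section \<open>Subcomodules with coefficients in a subspace\<close>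

text \<open>The condition \<open>\<Delta> W \<subseteq> W \<otimes> X\<close>, with \<open>W \<otimes> X\<close> formed inside \<open>M \<otimes> A\<close>.  It avoids the coaction on the
restricted comodule, which is a unique preimage and awkward to compute with.\<close>

definition X_subcomodule ::
  "'k ring \<Rightarrow> ('k, 'a) hopf_algebra \<Rightarrow> 'a set \<Rightarrow> ('k, 'a, 'm) comodule \<Rightarrow> 'm set \<Rightarrow> bool" where
  "X_subcomodule K A X M W \<longleftrightarrow> submodule W K M \<and> coact M ` W \<subseteq> tensor_image K M A W X"

lemma restrict_comodule_simps [simp]:
  "carrier (restrict_comodule K A M W) = W"
  "add (restrict_comodule K A M W) = add M"
  "zero (restrict_comodule K A M W) = zero M"
  "smult (restrict_comodule K A M W) = smult M"
  by (simp_all add: restrict_comodule_def)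

lemma tensor_restrict_comodule:
  "tensor K (restrict_comodule K A M W) N = tensor K (M\<lparr>carrier := W\<rparr>) N"
  "pure_tensor K (restrict_comodule K A M W) N = pure_tensor K (M\<lparr>carrier := W\<rparr>) N"
  "tensor_map K (restrict_comodule K A M W) N M' N' = tensor_map K (M\<lparr>carrier := W\<rparr>) N M' N'"
  by (rule tensor_cong_left pure_tensor_cong_left tensor_map_cong_source; simp)+

context affine_group_scheme
begin

lemma A_subspace: "submodule (carrier A) K A"
  by (rule module.carrier_is_submodule[OF A_module])

lemma restrict_comodule_module:
  assumes M: "module K M" and W: "submodule W K M"
  shows "module K (restrict_comodule K A M W)"
  by (rule module_of_surjection[OF submodule_module[OF M W], of id]) simp_all

text \<open>The coaction of the restriction is well defined because \<open>W \<otimes> A \<rightarrow> M \<otimes> A\<close> is injective; by the same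
injectivity it inherits linearity from the coaction of \<open>M\<close>.\<close>

lemma
  assumes M: "precomodule K A M" and W: "submodule W K M" and co: "coact M ` W \<subseteq> tensor_image K M A W (carrier A)"
  shows restrict_comodule_precomodule: "precomodule K A (restrict_comodule K A M W)"
    and restrict_comodule_inclusion: "colinear K A (restrict_comodule K A M W) M id"
proof -
  note MM = precomodule_module[OF M]
  let ?N = "restrict_comodule K A M W"
  have N: "module K ?N" by (rule restrict_comodule_module[OF MM W])
  have Wc: "W \<subseteq> carrier M" using W by (simp add: submodule_iff[OF MM])
  have i: "id \<in> module_hom K ?N M" using Wc by (auto simp: module_hom_def)
  have inj: "inj_on id (carrier ?N)" by simp
  let ?j = "tensor_map K ?N A M A id id"
  note j = tensor_map_linear[OF N A_module MM A_module i module_hom_id] and T = tensor_module[OF N A_module]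
    and d = precomodule_coact[OF M]
  interpret T: module K "tensor K ?N A" by (rule T)
  have jinj: "s = t" if "s \<in> carrier (tensor K ?N A)" "t \<in> carrier (tensor K ?N A)" "?j s = ?j t" for s t
    by (rule tensor_map_injective[OF field_K N MM A_module i inj that])
  have *: "coact ?N w \<in> carrier (tensor K ?N A) \<and> ?j (coact ?N w) = coact M w" if w: "w \<in> W" for w
  proof -
    have "coact M w \<in> tensor_image K M A W (carrier A)" using co w by blast
    then obtain t where t: "t \<in> carrier (tensor K ?N A)" "?j t = coact M w"
      by (auto simp: tensor_image_def tensor_restrict_comodule)
    have "coact ?N w = (THE t. t \<in> carrier (tensor K ?N A) \<and> ?j t = coact M w)"
      by (simp add: tensor_restrict_comodule) (simp add: restrict_comodule_def)
    also have "\<dots> = t" using t jinj by (intro the_equality) auto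
    finally show ?thesis using t by simp
  qed
  have "coact ?N \<in> module_hom K ?N (tensor K ?N A)"
  proof (rule module_homI)
    fix w assume "w \<in> carrier ?N"
    then show "coact ?N w \<in> carrier (tensor K ?N A)" using * by simp
  next
    fix v w assume "v \<in> carrier ?N" "w \<in> carrier ?N"
    then have vw: "v \<in> W" "w \<in> W" "v \<oplus>\<^bsub>M\<^esub> w \<in> W" using W by (auto simp: submodule_iff[OF MM])
    have "coact ?N (v \<oplus>\<^bsub>M\<^esub> w) = coact ?N v \<oplus>\<^bsub>tensor K ?N A\<^esub> coact ?N w"
      using vw Wc *[OF vw(1)] *[OF vw(2)] *[OF vw(3)]
      by - (rule jinj, simp_all add: module_hom_add[OF j] module_hom_add[OF d] subsetD[OF Wc])
    then show "coact ?N (v \<oplus>\<^bsub>?N\<^esub> w) = coact ?N v \<oplus>\<^bsub>tensor K ?N A\<^esub> coact ?N w" by simp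
  next
    fix r w assume r: "r \<in> carrier K" and "w \<in> carrier ?N"
    then have w: "w \<in> W" "r \<odot>\<^bsub>M\<^esub> w \<in> W" using W by (auto simp: submodule_iff[OF MM])
    have "coact ?N (r \<odot>\<^bsub>M\<^esub> w) = r \<odot>\<^bsub>tensor K ?N A\<^esub> coact ?N w"
      using r w Wc *[OF w(1)] *[OF w(2)]
      by - (rule jinj, simp_all add: module_hom_smult[OF j] module_hom_smult[OF d] subsetD[OF Wc])
    then show "coact ?N (r \<odot>\<^bsub>?N\<^esub> w) = r \<odot>\<^bsub>tensor K ?N A\<^esub> coact ?N w" by simp
  qed
  then show "precomodule K A ?N" using N by (simp add: precomodule_def)
  show "colinear K A ?N M id" unfolding colinear_def using i * by simp
qed

lemma colinear_into_restriction:
  assumes M: "precomodule K A M" and W: "submodule W K M" and co: "coact M ` W \<subseteq> tensor_image K M A W (carrier A)"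
    and P: "precomodule K A P" and f: "colinear K A P M f" and fW: "f ` carrier P \<subseteq> W"
  shows "colinear K A P (restrict_comodule K A M W) f"
proof (rule colinear_through_injection[OF restrict_comodule_precomodule[OF M W co] M P, of _ id])
  show "f \<in> module_hom K P (restrict_comodule K A M W)"
    using colinear_linear[OF f] fW by (auto simp: module_hom_def)
  show "colinear K A (restrict_comodule K A M W) M id" by (rule restrict_comodule_inclusion[OF M W co])
  show "colinear K A P M (\<lambda>m. id (f m))" using f by simp
  show "inj_on id (carrier (restrict_comodule K A M W))" by (rule inj_on_id)
qed

end

locale affine_group_scheme_subspace = affine_group_scheme K A for K :: "'k ring" and A :: "('k, 'a) hopf_algebra" +
  fixes X :: "'a set"
  assumes X_subspace: "submodule X K A"
begin

lemma X_subset: "X \<subseteq> carrier A"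
  using X_subspace by (simp add: submodule_iff[OF A_module])

lemma X_comodule_iff:
  "X_comodule K A X M \<longleftrightarrow> is_comodule K A M \<and> X_subcomodule K A X M (carrier M)"
  by (auto simp: X_comodule_def X_subcomodule_def is_comodule_def intro: module.carrier_is_submodule)

lemma X_comodule_precomodule: "X_comodule K A X M \<Longrightarrow> precomodule K A M"
  by (simp add: X_comodule_iff comodule_precomodule)

lemma X_subcomodule_coact:
  assumes M: "precomodule K A M" and W: "X_subcomodule K A X M W"
  shows "submodule W K M" "coact M ` W \<subseteq> tensor_image K M A W (carrier A)"
  using W tensor_image_mono[OF precomodule_module[OF M] A_module _ X_subspace _ A_subspace _ X_subset, of W W]
  by (auto simp: X_subcomodule_def)

text \<open>The coaction of the restriction takes values in \<open>W \<otimes> X \<subseteq> W \<otimes> A\<close>: an element of \<open>W \<otimes> X \<subseteq> M \<otimes> A\<close>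
has a preimage there, and preimages in \<open>W \<otimes> A\<close> are unique.\<close>

lemma X_comodule_restrict:
  assumes M: "is_comodule K A M" and W: "X_subcomodule K A X M W"
  shows "X_comodule K A X (restrict_comodule K A M W)"
proof -
  note M' = comodule_precomodule[OF M] and MM = precomodule_module[OF comodule_precomodule[OF M]]
  let ?N = "restrict_comodule K A M W"
  note co = X_subcomodule_coact[OF M' W]
  note N = restrict_comodule_precomodule[OF M' co] and i = restrict_comodule_inclusion[OF M' co]
  note NM = precomodule_module[OF N]
  have sN: "submodule W K ?N" using module.carrier_is_submodule[OF NM] by simp
  have iN: "is_comodule K A ?N" by (rule comodule_embedded[OF N M i]) simp
  note j = tensor_map_linear[OF NM A_module MM A_module colinear_linear[OF i] module_hom_id]
  have sub: "tensor_image K ?N A W X \<subseteq> carrier (tensor K ?N A)"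
    using tensor_image_submodule[OF NM A_module sN X_subspace] by (simp add: submodule_iff[OF tensor_module[OF NM A_module]])
  have Nadd: "s \<oplus>\<^bsub>tensor K ?N A\<^esub> t \<in> tensor_image K ?N A W X"
    if "s \<in> tensor_image K ?N A W X" "t \<in> tensor_image K ?N A W X" for s t
    using tensor_image_submodule[OF NM A_module sN X_subspace] that by (simp add: submodule_iff[OF tensor_module[OF NM A_module]])
  have lift: "t \<in> tensor_map K ?N A M A id id ` tensor_image K ?N A W X" if t: "t \<in> tensor_image K M A W X" for t
  proof (rule tensor_image_induct[OF MM A_module co(1) X_subspace t])
    fix w x assume w: "w \<in> W" and x: "x \<in> X"
    then have "pure_tensor K M A w x = tensor_map K ?N A M A id id (pure_tensor K ?N A w x)"
      using X_subset by (auto simp: tensor_map_pure[OF NM A_module MM A_module colinear_linear[OF i] module_hom_id])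
    then show "pure_tensor K M A w x \<in> tensor_map K ?N A M A id id ` tensor_image K ?N A W X"
      using tensor_image_pure[OF NM A_module sN X_subspace w x] by (rule image_eqI)
  next
    fix s t assume "s \<in> tensor_map K ?N A M A id id ` tensor_image K ?N A W X"
      "t \<in> tensor_map K ?N A M A id id ` tensor_image K ?N A W X"
    then obtain s' t' where st: "s' \<in> tensor_image K ?N A W X" "t' \<in> tensor_image K ?N A W X"
      "s = tensor_map K ?N A M A id id s'" "t = tensor_map K ?N A M A id id t'" by blast
    then have "s \<oplus>\<^bsub>tensor K M A\<^esub> t = tensor_map K ?N A M A id id (s' \<oplus>\<^bsub>tensor K ?N A\<^esub> t')"
      using module_hom_add[OF j, of s' t'] sub by auto
    then show "s \<oplus>\<^bsub>tensor K M A\<^esub> t \<in> tensor_map K ?N A M A id id ` tensor_image K ?N A W X"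
      using Nadd[OF st(1,2)] by (rule image_eqI)
  qed
  have "coact ?N w \<in> tensor_image K ?N A W X" if w: "w \<in> W" for w
  proof -
    have "coact M w \<in> tensor_image K M A W X" using W w by (auto simp: X_subcomodule_def)
    then obtain t where t: "t \<in> tensor_image K ?N A W X" "coact M w = tensor_map K ?N A M A id id t"
      using lift by blast
    have "coact ?N w = t"
      by (rule tensor_map_injective[OF field_K NM MM A_module colinear_linear[OF i]])
         (use w t sub colinear_coact[OF i, of w] module_hom_closed[OF precomodule_coact[OF N], of w] in auto)
    with t show ?thesis by simp
  qed
  then show ?thesis using iN sN by (auto simp: X_comodule_iff X_subcomodule_def)
qed

lemma X_subcomodule_iff:
  assumes M: "is_comodule K A M"
  shows "subcomodule K A M W \<and> X_comodule K A X (restrict_comodule K A M W) \<longleftrightarrow> X_subcomodule K A X M W"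
proof
  note M' = comodule_precomodule[OF M] and MM = precomodule_module[OF comodule_precomodule[OF M]]
  let ?N = "restrict_comodule K A M W"
  assume *: "subcomodule K A M W \<and> X_comodule K A X ?N"
  then have W: "submodule W K M" "coact M ` W \<subseteq> tensor_image K M A W (carrier A)" by (auto simp: subcomodule_def)
  note N = restrict_comodule_precomodule[OF M' W] and i = restrict_comodule_inclusion[OF M' W]
  have "coact M w \<in> tensor_image K M A W X" if w: "w \<in> W" for w
  proof -
    have "submodule W K ?N" "coact ?N w \<in> tensor_image K ?N A W X"
      using * w by (auto simp: X_comodule_iff X_subcomodule_def)
    then have "tensor_map K ?N A M A id id (coact ?N w) \<in> tensor_image K M A W X"
      by (intro tensor_map_tensor_image[OF precomodule_module[OF N] A_module _ X_subspace MM A_module W(1) X_subspace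
            colinear_linear[OF i] module_hom_id]) auto
    then show ?thesis using colinear_coact[OF i, of w] w by simp
  qed
  then show "X_subcomodule K A X M W" using W by (auto simp: X_subcomodule_def)
next
  assume W: "X_subcomodule K A X M W"
  then show "subcomodule K A M W \<and> X_comodule K A X (restrict_comodule K A M W)"
    using X_comodule_restrict[OF M W] X_subcomodule_coact[OF comodule_precomodule[OF M] W] by (simp add: subcomodule_def)
qed

lemma X_subcomodule_image:
  assumes M: "precomodule K A M" and N: "precomodule K A N" and f: "colinear K A M N f"
    and W: "X_subcomodule K A X M W"
  shows "X_subcomodule K A X N (f ` W)"
  unfolding X_subcomodule_def
proof (intro conjI image_subsetI)
  note MM = precomodule_module[OF M] and NM = precomodule_module[OF N]
  have WM: "submodule W K M" using W by (simp add: X_subcomodule_def)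
  show fW: "submodule (f ` W) K N" by (rule module_hom_image[OF MM NM colinear_linear[OF f] WM])
  fix n assume "n \<in> f ` W"
  then obtain w where w: "w \<in> W" "n = f w" by blast
  have "w \<in> carrier M" using w WM by (auto simp: submodule_iff[OF MM])
  moreover have "tensor_map K M A N A f id (coact M w) \<in> tensor_image K N A (f ` W) X"
    using W w by (intro tensor_map_tensor_image[OF MM A_module WM X_subspace NM A_module fW X_subspace
          colinear_linear[OF f] module_hom_id]) (auto simp: X_subcomodule_def)
  ultimately show "coact N n \<in> tensor_image K N A (f ` W) X" using colinear_coact[OF f] w by simp
qed

lemma X_comodule_surjective_image:
  assumes M: "X_comodule K A X M" and N: "is_comodule K A N" and f: "colinear K A M N f" and surj: "f ` carrier M = carrier N"
  shows "X_comodule K A X N"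
  using X_subcomodule_image[OF X_comodule_precomodule[OF M] comodule_precomodule[OF N] f, of "carrier M"] M N surj
  by (simp add: X_comodule_iff)

text \<open>Colinearity gives \<open>(f \<otimes> 1) (\<Delta> m) = \<Delta> (f m) = 0\<close> for \<open>m\<close> in the kernel, so \<open>\<Delta> m\<close> lies in
\<open>ker f \<otimes> X\<close> by the description of the kernel of \<open>f \<otimes> 1\<close>.\<close>

lemma X_subcomodule_kernel:
  assumes M: "X_comodule K A X M" and N: "precomodule K A N" and f: "colinear K A M N f"
  shows "X_subcomodule K A X M {m \<in> carrier M. f m = \<zero>\<^bsub>N\<^esub>}"
  unfolding X_subcomodule_def
proof (intro conjI image_subsetI)
  note M' = X_comodule_precomodule[OF M]
  note MM = precomodule_module[OF M'] and NM = precomodule_module[OF N]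
  show "submodule {m \<in> carrier M. f m = \<zero>\<^bsub>N\<^esub>} K M" by (rule module_hom_kernel[OF MM NM colinear_linear[OF f]])
  fix m assume m: "m \<in> {m \<in> carrier M. f m = \<zero>\<^bsub>N\<^esub>}"
  show "coact M m \<in> tensor_image K M A {m \<in> carrier M. f m = \<zero>\<^bsub>N\<^esub>} X"
  proof (rule tensor_map_kernel[OF field_K MM NM A_module X_subspace colinear_linear[OF f]])
    show "coact M m \<in> tensor_image K M A (carrier M) X" using M m by (auto simp: X_comodule_def)
    show "tensor_map K M A N A f id (coact M m) = \<zero>\<^bsub>tensor K N A\<^esub>"
      using m colinear_coact[OF f, of m] module_hom_zero[OF NM tensor_module[OF NM A_module] precomodule_coact[OF N]] by simp
  qed
qed

section \<open>The largest submodule that is an \<open>X\<close>-comodule\<close>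

lemma X_part_carrier_eq:
  "is_comodule K A M \<Longrightarrow> X_part_carrier K A X M = \<Union>{W. X_subcomodule K A X M W}"
  by (simp add: X_part_carrier_def X_subcomodule_iff)

lemma X_subcomodule_sum:
  assumes M: "precomodule K A M" and V: "X_subcomodule K A X M V" and W: "X_subcomodule K A X M W"
  shows "\<exists>U. X_subcomodule K A X M U \<and> V \<subseteq> U \<and> W \<subseteq> U"
proof -
  note MM = precomodule_module[OF M]
  define U where "U = {v \<oplus>\<^bsub>M\<^esub> w | v w. v \<in> V \<and> w \<in> W}"
  have sV: "submodule V K M" and sW: "submodule W K M" using V W by (auto simp: X_subcomodule_def)
  note sU = submodule_sum(1)[OF MM sV sW, folded U_def] and VU = submodule_sum(2)[OF MM sV sW, folded U_def]
    and WU = submodule_sum(3)[OF MM sV sW, folded U_def]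
  have "coact M x \<in> tensor_image K M A U X" if x: "x \<in> U" for x
  proof -
    obtain v w where *: "v \<in> V" "w \<in> W" "x = v \<oplus>\<^bsub>M\<^esub> w" using x by (auto simp: U_def)
    have "coact M v \<in> tensor_image K M A U X" "coact M w \<in> tensor_image K M A U X"
      using V W * tensor_image_mono[OF MM A_module sV X_subspace sU X_subspace VU subset_refl]
        tensor_image_mono[OF MM A_module sW X_subspace sU X_subspace WU subset_refl]
      by (auto simp: X_subcomodule_def)
    moreover have "v \<in> carrier M" "w \<in> carrier M" using * sV sW by (auto simp: submodule_iff[OF MM])
    ultimately show ?thesis
      using * tensor_image_submodule[OF MM A_module sU X_subspace]
      by (simp add: module_hom_add[OF precomodule_coact[OF M]] submodule_iff[OF tensor_module[OF MM A_module]])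
  qed
  then show ?thesis using sU VU WU by (auto simp: X_subcomodule_def)
qed

text \<open>The union of all \<open>X\<close>-subcomodules is directed because sums of two of them are again
\<open>X\<close>-subcomodules; hence it is a subspace and satisfies the same condition.\<close>

lemma X_subcomodule_X_part:
  assumes M: "is_comodule K A M"
  shows "X_subcomodule K A X M (X_part_carrier K A X M)"
proof -
  note M' = comodule_precomodule[OF M]
  note MM = precomodule_module[OF M']
  interpret M: module K M by (rule MM)
  let ?U = "X_part_carrier K A X M"
  note eq = X_part_carrier_eq[OF M]
  have sub: "submodule W K M" if "X_subcomodule K A X M W" for W using that by (simp add: X_subcomodule_def)
  have le: "W \<subseteq> ?U" if "X_subcomodule K A X M W" for W using that by (auto simp: eq)
  have "X_subcomodule K A X M {\<zero>\<^bsub>M\<^esub>}"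
  proof -
    have s0: "submodule {\<zero>\<^bsub>M\<^esub>} K M" by (auto simp: submodule_iff[OF MM])
    show ?thesis
      using s0 tensor_image_submodule[OF MM A_module s0 X_subspace]
        module_hom_zero[OF MM tensor_module[OF MM A_module] precomodule_coact[OF M']]
      by (auto simp: X_subcomodule_def submodule_iff[OF tensor_module[OF MM A_module]])
  qed
  then have zero: "\<zero>\<^bsub>M\<^esub> \<in> ?U" using le by blast
  have sU: "submodule ?U K M"
    unfolding submodule_iff[OF MM]
  proof (intro conjI ballI zero)
    show "?U \<subseteq> carrier M" using sub unfolding eq submodule_iff[OF MM] by blast
  next
    fix x y assume "x \<in> ?U" "y \<in> ?U"
    then obtain V W where VW: "X_subcomodule K A X M V" "X_subcomodule K A X M W" "x \<in> V" "y \<in> W"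
      by (auto simp: eq)
    then obtain U where U: "X_subcomodule K A X M U" "V \<subseteq> U" "W \<subseteq> U" using X_subcomodule_sum[OF M'] by blast
    then have "x \<in> U" "y \<in> U" using VW by blast+
    then have "x \<oplus>\<^bsub>M\<^esub> y \<in> U" using sub[OF U(1)] by (auto simp: submodule_iff[OF MM])
    then show "x \<oplus>\<^bsub>M\<^esub> y \<in> ?U" using le[OF U(1)] by blast
  next
    fix r x assume r: "r \<in> carrier K" and "x \<in> ?U"
    then obtain W where W: "X_subcomodule K A X M W" "x \<in> W" by (auto simp: eq)
    then have "r \<odot>\<^bsub>M\<^esub> x \<in> W" using r sub[OF W(1)] by (auto simp: submodule_iff[OF MM])
    then show "r \<odot>\<^bsub>M\<^esub> x \<in> ?U" using le[OF W(1)] by blast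
  qed
  have "coact M x \<in> tensor_image K M A ?U X" if x: "x \<in> ?U" for x
  proof -
    obtain W where W: "X_subcomodule K A X M W" "x \<in> W" using x by (auto simp: eq)
    then show ?thesis
      using tensor_image_mono[OF MM A_module sub[OF W(1)] X_subspace sU X_subspace le[OF W(1)] subset_refl]
      by (auto simp: X_subcomodule_def)
  qed
  then show ?thesis using sU by (auto simp: X_subcomodule_def)
qed

lemma X_subcomodule_le_X_part:
  "is_comodule K A M \<Longrightarrow> X_subcomodule K A X M W \<Longrightarrow> W \<subseteq> X_part_carrier K A X M"
  by (auto simp: X_part_carrier_eq)

lemma colinear_X_part:
  assumes M: "is_comodule K A M" and N: "is_comodule K A N" and f: "colinear K A M N f"
  shows "f ` X_part_carrier K A X M \<subseteq> X_part_carrier K A X N"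
  using X_subcomodule_le_X_part[OF N X_subcomodule_image[OF comodule_precomodule[OF M] comodule_precomodule[OF N] f
        X_subcomodule_X_part[OF M]]] .

end

section \<open>Colimits of diagrams of comodules\<close>

text \<open>A diagram of modules is given by an index set \<open>I\<close>, modules \<open>F i\<close> and a set \<open>E\<close> of arrows
\<open>(i, j, u)\<close> with \<open>u : F i \<rightarrow> F j\<close>.  Its colimit is generated by the pairs \<open>(i, m)\<close> with
\<open>m \<in> F i\<close>; the relations express linearity in \<open>m\<close> and the identification of \<open>(i, m)\<close> with
\<open>(j, u m)\<close>.\<close>

definition colim_gens :: "'i set \<Rightarrow> ('i \<Rightarrow> ('r, 'm, 'c) module_scheme) \<Rightarrow> ('i \<times> 'm) set" where
  "colim_gens I F = (SIGMA i:I. carrier (F i))"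

definition colim_relations ::
  "('r, 'q) ring_scheme \<Rightarrow> 'i set \<Rightarrow> ('i \<Rightarrow> ('r, 'm, 'c) module_scheme) \<Rightarrow> ('i \<times> 'i \<times> ('m \<Rightarrow> 'm)) set \<Rightarrow>
   ('i \<times> 'm \<Rightarrow> 'r) set" where
  "colim_relations R I F E =
     (let G = free_module R (colim_gens I F); \<delta> = (\<lambda>i m. free_gen R (i, m)) in
       {\<delta> i (m \<oplus>\<^bsub>F i\<^esub> m') \<ominus>\<^bsub>G\<^esub> (\<delta> i m \<oplus>\<^bsub>G\<^esub> \<delta> i m') | i m m'. i \<in> I \<and> m \<in> carrier (F i) \<and> m' \<in> carrier (F i)} \<union>
       {\<delta> i (r \<odot>\<^bsub>F i\<^esub> m) \<ominus>\<^bsub>G\<^esub> (r \<odot>\<^bsub>G\<^esub> \<delta> i m) | i r m. i \<in> I \<and> r \<in> carrier R \<and> m \<in> carrier (F i)} \<union>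
       {\<delta> j (u m) \<ominus>\<^bsub>G\<^esub> \<delta> i m | i j u m. (i, j, u) \<in> E \<and> m \<in> carrier (F i)})"

definition colim_module ::
  "('r, 'q) ring_scheme \<Rightarrow> 'i set \<Rightarrow> ('i \<Rightarrow> ('r, 'm, 'c) module_scheme) \<Rightarrow> ('i \<times> 'i \<times> ('m \<Rightarrow> 'm)) set \<Rightarrow>
   ('r, ('i \<times> 'm \<Rightarrow> 'r) set) module" where
  "colim_module R I F E = presented_module R (colim_gens I F) (colim_relations R I F E)"

definition colim_in ::
  "('r, 'q) ring_scheme \<Rightarrow> 'i set \<Rightarrow> ('i \<Rightarrow> ('r, 'm, 'c) module_scheme) \<Rightarrow> ('i \<times> 'i \<times> ('m \<Rightarrow> 'm)) set \<Rightarrow>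
   'i \<Rightarrow> 'm \<Rightarrow> ('i \<times> 'm \<Rightarrow> 'r) set" where
  "colim_in R I F E i m = presented_class R (colim_gens I F) (colim_relations R I F E) (free_gen R (i, m))"

definition linear_diagram ::
  "('r, 'q) ring_scheme \<Rightarrow> 'i set \<Rightarrow> ('i \<Rightarrow> ('r, 'm, 'c) module_scheme) \<Rightarrow> ('i \<times> 'i \<times> ('m \<Rightarrow> 'm)) set \<Rightarrow> bool" where
  "linear_diagram R I F E \<longleftrightarrow> cring R \<and> (\<forall>i\<in>I. module R (F i)) \<and>
     (\<forall>(i, j, u)\<in>E. i \<in> I \<and> j \<in> I \<and> u \<in> module_hom R (F i) (F j))"

lemma
  assumes D: "linear_diagram R I F E"
  shows colim_relations_closed: "colim_relations R I F E \<subseteq> carrier (free_module R (colim_gens I F))"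
    and colim_module_module: "module R (colim_module R I F E)"
    and colim_in_linear: "i \<in> I \<Longrightarrow> colim_in R I F E i \<in> module_hom R (F i) (colim_module R I F E)"
    and colim_in_arrow: "(i, j, u) \<in> E \<Longrightarrow> m \<in> carrier (F i) \<Longrightarrow> colim_in R I F E j (u m) = colim_in R I F E i m"
    and colim_span: "submodule W R (colim_module R I F E) \<Longrightarrow>
      (\<And>i. i \<in> I \<Longrightarrow> colim_in R I F E i ` carrier (F i) \<subseteq> W) \<Longrightarrow> carrier (colim_module R I F E) \<subseteq> W"
proof -
  let ?B = "colim_gens I F" and ?Z = "colim_relations R I F E"
  let ?G = "free_module R ?B" and ?V = "colim_module R I F E" and ?\<pi> = "presented_class R (colim_gens I F) (colim_relations R I F E)"
  have R: "cring R" and F: "\<And>i. i \<in> I \<Longrightarrow> module R (F i)"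
    and E: "\<And>i j u. (i, j, u) \<in> E \<Longrightarrow> i \<in> I \<and> j \<in> I \<and> u \<in> module_hom R (F i) (F j)"
    using D by (auto simp: linear_diagram_def)
  have Fc: "m \<oplus>\<^bsub>F i\<^esub> m' \<in> carrier (F i)" "r \<odot>\<^bsub>F i\<^esub> m \<in> carrier (F i)"
    if "i \<in> I" "m \<in> carrier (F i)" "m' \<in> carrier (F i)" "r \<in> carrier R" for i m m' r
  proof -
    interpret M: module R "F i" by (rule F[OF that(1)])
    show "m \<oplus>\<^bsub>F i\<^esub> m' \<in> carrier (F i)" "r \<odot>\<^bsub>F i\<^esub> m \<in> carrier (F i)" using that by simp_all
  qed
  have one: "\<one>\<^bsub>R\<^esub> \<in> carrier R" using R by (simp add: cring.axioms(1) ring.ring_simprules(6))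
  have G: "module R ?G" by (rule free_module_module[OF R])
  interpret G: module R ?G by (rule G)
  have gen: "free_gen R (i, m) \<in> carrier ?G" if "i \<in> I" "m \<in> carrier (F i)" for i m
    using that by (intro free_gen_closed[OF R]) (simp add: colim_gens_def)
  have umc: "u m \<in> carrier (F j)" if "(i, j, u) \<in> E" "m \<in> carrier (F i)" for i j u m
    using E[OF that(1)] that(2) module_hom_closed by metis
  show Z: "?Z \<subseteq> carrier ?G"
    using E umc Fc[OF _ _ _ one] Fc(2) by (auto simp: colim_relations_def Let_def gen)
  note Q = presented_module_properties[OF R Z, folded colim_module_def]
  show V: "module R ?V" by (rule Q)
  interpret V: module R ?V by (rule V)
  note \<pi> = Q(2)
  have rel: "?\<pi> f = ?\<pi> g" if "f \<ominus>\<^bsub>?G\<^esub> g \<in> ?Z" "f \<in> carrier ?G" "g \<in> carrier ?G" for f g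
    using Q(4)[OF that(1)] that(2,3) module_hom_closed[OF \<pi>]
    by (simp add: module_hom_minus[OF G V \<pi>] minus_eq_zero_iff[OF V])
  show "colim_in R I F E i \<in> module_hom R (F i) ?V" if i: "i \<in> I"
  proof (rule module_homI)
    fix m assume "m \<in> carrier (F i)"
    then show "colim_in R I F E i m \<in> carrier ?V"
      unfolding colim_in_def by (rule module_hom_closed[OF \<pi> gen[OF i]])
  next
    fix m m' assume m: "m \<in> carrier (F i)" "m' \<in> carrier (F i)"
    have "free_gen R (i, m \<oplus>\<^bsub>F i\<^esub> m') \<ominus>\<^bsub>?G\<^esub> (free_gen R (i, m) \<oplus>\<^bsub>?G\<^esub> free_gen R (i, m')) \<in> ?Z"
      using i m unfolding colim_relations_def Let_def by blast
    from rel[OF this] show "colim_in R I F E i (m \<oplus>\<^bsub>F i\<^esub> m') = colim_in R I F E i m \<oplus>\<^bsub>?V\<^esub> colim_in R I F E i m'"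
      using i m Fc(1)[OF i m one] by (simp add: colim_in_def module_hom_add[OF \<pi>] gen)
  next
    fix r m assume r: "r \<in> carrier R" and m: "m \<in> carrier (F i)"
    have "free_gen R (i, r \<odot>\<^bsub>F i\<^esub> m) \<ominus>\<^bsub>?G\<^esub> (r \<odot>\<^bsub>?G\<^esub> free_gen R (i, m)) \<in> ?Z"
      using i m r unfolding colim_relations_def Let_def by blast
    from rel[OF this] show "colim_in R I F E i (r \<odot>\<^bsub>F i\<^esub> m) = r \<odot>\<^bsub>?V\<^esub> colim_in R I F E i m"
      using i m r Fc(2)[OF i m m r] by (simp add: colim_in_def module_hom_smult[OF \<pi>] gen)
  qed
  show "colim_in R I F E j (u m) = colim_in R I F E i m" if u: "(i, j, u) \<in> E" and m: "m \<in> carrier (F i)"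
  proof -
    have "free_gen R (j, u m) \<ominus>\<^bsub>?G\<^esub> free_gen R (i, m) \<in> ?Z"
      using u m unfolding colim_relations_def Let_def by blast
    from rel[OF this] show ?thesis using E[OF u] umc[OF u m] m by (simp add: colim_in_def gen)
  qed
  show "carrier ?V \<subseteq> W" if W: "submodule W R ?V" and sub: "\<And>i. i \<in> I \<Longrightarrow> colim_in R I F E i ` carrier (F i) \<subseteq> W"
    unfolding colim_module_def
  proof (rule presented_module_span[OF R Z W[unfolded colim_module_def]])
    fix b assume "b \<in> ?B"
    then obtain i m where "b = (i, m)" "i \<in> I" "m \<in> carrier (F i)" by (auto simp: colim_gens_def)
    then show "?\<pi> (free_gen R b) \<in> W" using sub[of i] by (auto simp: colim_in_def)
  qed
qed

lemma colim_lift: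
  assumes D: "linear_diagram R I F E" and P: "module R P"
    and \<delta>: "\<And>i. i \<in> I \<Longrightarrow> \<delta> i \<in> module_hom R (F i) P"
    and arr: "\<And>i j u m. (i, j, u) \<in> E \<Longrightarrow> m \<in> carrier (F i) \<Longrightarrow> \<delta> j (u m) = \<delta> i m"
  obtains h where "h \<in> module_hom R (colim_module R I F E) P"
    "\<And>i m. i \<in> I \<Longrightarrow> m \<in> carrier (F i) \<Longrightarrow> h (colim_in R I F E i m) = \<delta> i m"
proof -
  let ?B = "colim_gens I F" and ?Z = "colim_relations R I F E"
  let ?G = "free_module R ?B"
  have R: "cring R" and F: "\<And>i. i \<in> I \<Longrightarrow> module R (F i)"
    and E: "\<And>i j u. (i, j, u) \<in> E \<Longrightarrow> i \<in> I \<and> j \<in> I \<and> u \<in> module_hom R (F i) (F j)"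
    using D by (auto simp: linear_diagram_def)
  have G: "module R ?G" by (rule free_module_module[OF R])
  interpret G: module R ?G by (rule G)
  interpret P: module R P by (rule P)
  have gen: "free_gen R (i, m) \<in> carrier ?G" if "i \<in> I" "m \<in> carrier (F i)" for i m
    using that by (intro free_gen_closed[OF R]) (simp add: colim_gens_def)
  have rel: "h z = \<zero>\<^bsub>P\<^esub>" if h: "h \<in> module_hom R ?G P"
    and hb: "\<And>x. x \<in> ?B \<Longrightarrow> h (free_gen R x) = (\<lambda>(i, m). \<delta> i m) x" and z: "z \<in> ?Z" for h z
  proof -
    have hb': "h (free_gen R (i, m)) = \<delta> i m" if "i \<in> I" "m \<in> carrier (F i)" for i m
      using hb[of "(i, m)"] that by (simp add: colim_gens_def)
    consider (add) i m m' where "i \<in> I" "m \<in> carrier (F i)" "m' \<in> carrier (F i)"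
        "z = free_gen R (i, m \<oplus>\<^bsub>F i\<^esub> m') \<ominus>\<^bsub>?G\<^esub> (free_gen R (i, m) \<oplus>\<^bsub>?G\<^esub> free_gen R (i, m'))"
      | (smult) i r m where "i \<in> I" "r \<in> carrier R" "m \<in> carrier (F i)"
        "z = free_gen R (i, r \<odot>\<^bsub>F i\<^esub> m) \<ominus>\<^bsub>?G\<^esub> (r \<odot>\<^bsub>?G\<^esub> free_gen R (i, m))"
      | (arrow) i j u m where "(i, j, u) \<in> E" "m \<in> carrier (F i)"
        "z = free_gen R (j, u m) \<ominus>\<^bsub>?G\<^esub> free_gen R (i, m)"
      using z unfolding colim_relations_def Let_def by blast
    then show ?thesis
    proof cases
      case add
      interpret M: module R "F i" by (rule F[OF add(1)])
      show ?thesis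
        using add module_hom_closed[OF \<delta>[OF add(1)]]
        by (simp add: module_hom_minus[OF G P h] module_hom_add[OF h] gen hb' minus_eq_zero_iff[OF P]
            module_hom_add[OF \<delta>])
    next
      case smult
      interpret M: module R "F i" by (rule F[OF smult(1)])
      show ?thesis
        using smult module_hom_closed[OF \<delta>[OF smult(1)]]
        by (simp add: module_hom_minus[OF G P h] module_hom_smult[OF h] gen hb' minus_eq_zero_iff[OF P]
            module_hom_smult[OF \<delta>])
    next
      case arrow
      then have ij: "i \<in> I" "j \<in> I" "u m \<in> carrier (F j)" using E[OF arrow(1)] module_hom_closed[of u R "F i" "F j" m] by auto
      then show ?thesis
        using arrow module_hom_closed[OF \<delta>[OF ij(1)]]
        by (simp add: module_hom_minus[OF G P h] gen hb' minus_eq_zero_iff[OF P] arr)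
    qed
  qed
  obtain h where h: "h \<in> module_hom R (colim_module R I F E) P"
    "\<And>x. x \<in> ?B \<Longrightarrow> h (presented_class R ?B ?Z (free_gen R x)) = (\<lambda>(i, m). \<delta> i m) x"
    unfolding colim_module_def
    by (rule presented_module_lift[OF R colim_relations_closed[OF D] P, of "\<lambda>(i, m). \<delta> i m"])
       (use rel module_hom_closed[OF \<delta>] in \<open>auto simp: colim_gens_def\<close>)
  show thesis
  proof (rule that[OF h(1)])
    fix i m assume "i \<in> I" "m \<in> carrier (F i)"
    then show "h (colim_in R I F E i m) = \<delta> i m"
      using h(2)[of "(i, m)"] by (simp add: colim_gens_def colim_in_def)
  qed
qed

text \<open>The colimit is built from functions on \<open>'i \<times> 'm\<close>, whereas the objects of the comodule category have to
live on \<open>'m\<close>.  If an injection into \<open>'m\<close> exists, the structure is moved there.\<close>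

definition transport_comodule ::
  "('v \<Rightarrow> 'm) \<Rightarrow> ('k, 'v, 'c) module_scheme \<Rightarrow> ('m \<Rightarrow> ('m \<times> 'a \<Rightarrow> 'k) set) \<Rightarrow> ('k, 'a, 'm) comodule" where
  "transport_comodule h V c =
     (let g = inv_into (carrier V) h in
       \<lparr>carrier = h ` carrier V, mult = undefined, one = undefined, zero = h \<zero>\<^bsub>V\<^esub>,
        add = \<lambda>x y. h (g x \<oplus>\<^bsub>V\<^esub> g y), smult = \<lambda>r x. h (r \<odot>\<^bsub>V\<^esub> g x), coact = c\<rparr>)"

lemma tensor_transport_comodule:
  "tensor K (transport_comodule h V c) N = tensor K (transport_comodule h V c') N"
  "tensor_map K M N (transport_comodule h V c) N' = tensor_map K M N (transport_comodule h V c') N'"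
  by (rule tensor_cong_left tensor_map_cong_target; simp add: transport_comodule_def Let_def)+

lemma
  assumes V: "module K V" and h: "inj_on h (carrier V)"
  shows transport_comodule_module: "module K (transport_comodule h V c)"
    and transport_linear: "h \<in> module_hom K V (transport_comodule h V c)"
    and transport_inverse_linear: "inv_into (carrier V) h \<in> module_hom K (transport_comodule h V c) V"
proof -
  interpret V: module K V by (rule V)
  show "module K (transport_comodule h V c)" "h \<in> module_hom K V (transport_comodule h V c)"
    by (rule module_of_surjection[OF V, of h]; simp add: transport_comodule_def Let_def h inv_into_f_f)+
  show "inv_into (carrier V) h \<in> module_hom K (transport_comodule h V c) V"
    by (rule module_homI) (auto simp: transport_comodule_def Let_def h inv_into_f_f)
qed

text \<open>The universal property is stated for linear maps into vector spaces.  It implies the one for colinear maps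
and is also used with linear maps that are not colinear, to compute the kernel of a cokernel.\<close>

definition colimit_comodule ::
  "'k ring \<Rightarrow> ('k, 'a) hopf_algebra \<Rightarrow> 'i set \<Rightarrow> ('i \<Rightarrow> ('k, 'a, 'm) comodule) \<Rightarrow> ('i \<times> 'i \<times> ('m \<Rightarrow> 'm)) set \<Rightarrow>
   ('k, 'a, 'm) comodule \<Rightarrow> ('i \<Rightarrow> 'm \<Rightarrow> 'm) \<Rightarrow> bool" where
  "colimit_comodule K A I F E L \<gamma> \<longleftrightarrow>
     (\<forall>i\<in>I. colinear K A (F i) L (\<gamma> i)) \<and>
     (\<forall>i j u m. (i, j, u) \<in> E \<longrightarrow> m \<in> carrier (F i) \<longrightarrow> \<gamma> j (u m) = \<gamma> i m) \<and>
     jointly_spanning K L I F \<gamma> \<and>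
     (\<forall>(P :: ('k, 'a, 'm) comodule) \<delta>. module K P \<longrightarrow> (\<forall>i\<in>I. \<delta> i \<in> module_hom K (F i) P) \<longrightarrow>
        (\<forall>i j u m. (i, j, u) \<in> E \<longrightarrow> m \<in> carrier (F i) \<longrightarrow> \<delta> j (u m) = \<delta> i m) \<longrightarrow>
        (\<exists>h\<in>module_hom K L P. \<forall>i\<in>I. \<forall>m\<in>carrier (F i). h (\<gamma> i m) = \<delta> i m))"

lemma
  assumes "colimit_comodule K A I F E L \<gamma>"
  shows colimit_comodule_colinear: "i \<in> I \<Longrightarrow> colinear K A (F i) L (\<gamma> i)"
    and colimit_comodule_arrow: "(i, j, u) \<in> E \<Longrightarrow> m \<in> carrier (F i) \<Longrightarrow> \<gamma> j (u m) = \<gamma> i m"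
    and colimit_comodule_span: "jointly_spanning K L I F \<gamma>"
  using assms by (simp_all add: colimit_comodule_def)

lemma colimit_comodule_lift:
  fixes P :: "('k, 'a, 'm) comodule" and F :: "'i \<Rightarrow> ('k, 'a, 'm) comodule"
  assumes "colimit_comodule K A I F E L \<gamma>" and "module K P"
    and "\<And>i. i \<in> I \<Longrightarrow> \<delta> i \<in> module_hom K (F i) P"
    and "\<And>i j u m. (i, j, u) \<in> E \<Longrightarrow> m \<in> carrier (F i) \<Longrightarrow> \<delta> j (u m) = \<delta> i m"
  shows "\<exists>h\<in>module_hom K L P. \<forall>i\<in>I. \<forall>m\<in>carrier (F i). h (\<gamma> i m) = \<delta> i m"
  using assms by (simp add: colimit_comodule_def)

text \<open>Let \<open>L\<close> be the colimit of vector spaces.  The maps \<open>(\<gamma> i \<otimes> 1) \<circ> \<Delta> : F i \<rightarrow> L \<otimes> A\<close> are compatible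
with the arrows, because these are colinear, and so induce a coaction on \<open>L\<close>; the comodule laws hold
because the \<open>F i\<close> span \<open>L\<close>.  For the same reason \<open>L\<close> is an \<open>X\<close>-comodule if all \<open>F i\<close> are: its
\<open>X\<close>-part is a subspace containing the image of every \<open>F i\<close>.\<close>

lemma (in affine_group_scheme_subspace) small_colimit:
  fixes F :: "'i \<Rightarrow> ('k, 'a, 'm) comodule"
  assumes F: "\<And>i. i \<in> I \<Longrightarrow> X_comodule K A X (F i)"
    and E: "\<And>i j u. (i, j, u) \<in> E \<Longrightarrow> i \<in> I \<and> j \<in> I \<and> colinear K A (F i) (F j) u"
    and small: "inj_on (s :: _ \<Rightarrow> 'm) (carrier (colim_module K I F E))"
  obtains L :: "('k, 'a, 'm) comodule" and \<gamma> where "X_comodule K A X L" "colimit_comodule K A I F E L \<gamma>"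
proof -
  have F': "precomodule K A (F i)" and FM: "module K (F i)" if "i \<in> I" for i
    using X_comodule_precomodule[OF F[OF that]] precomodule_module by blast+
  have "cring K" ..
  then have D: "linear_diagram K I F E"
    using FM E colinear_linear unfolding linear_diagram_def by fastforce
  define V where "V = colim_module K I F E"
  \<comment> \<open>The tensor product \<open>L \<otimes> A\<close> has to be available before the coaction of \<open>L\<close> is known, so the
    coaction is a parameter \<open>c\<close> of the transported module, and \<open>L0\<close> has an arbitrary one.\<close>
  define L1 where "L1 c = transport_comodule s V c" for c :: "'m \<Rightarrow> ('m \<times> 'a \<Rightarrow> 'k) set"
  define \<gamma> where "\<gamma> i m = s (colim_in K I F E i m)" for i m
  define g where "g = inv_into (carrier V) s"
  note V = colim_module_module[OF D, folded V_def] and s = small[folded V_def]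
  have L1: "module K (L1 c)" and hs: "s \<in> module_hom K V (L1 c)" and gl: "g \<in> module_hom K (L1 c) V" for c
    unfolding L1_def g_def using transport_comodule_module[OF V s] transport_linear[OF V s]
      transport_inverse_linear[OF V s] by blast+
  have gs: "g (s v) = v" if "v \<in> carrier V" for v using s that by (simp add: g_def inv_into_f_f)
  have L1c: "carrier (L1 c) = s ` carrier V" for c by (simp add: L1_def transport_comodule_def Let_def)
  have cin: "colim_in K I F E i \<in> module_hom K (F i) V" if "i \<in> I" for i
    unfolding V_def by (rule colim_in_linear[OF D that])
  have \<gamma>l: "\<gamma> i \<in> module_hom K (F i) (L1 c)" if "i \<in> I" for i c
    unfolding \<gamma>_def[abs_def] by (rule module_hom_comp[OF cin[OF that] hs])
  have \<gamma>u: "\<gamma> j (u m) = \<gamma> i m" if "(i, j, u) \<in> E" "m \<in> carrier (F i)" for i j u m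
    by (simp add: \<gamma>_def colim_in_arrow[OF D that])
  have span: "carrier (L1 c) \<subseteq> W" if W: "submodule W K (L1 c)" and sub: "\<And>i. i \<in> I \<Longrightarrow> \<gamma> i ` carrier (F i) \<subseteq> W" for W c
  proof -
    have "submodule (g ` W) K V" by (rule module_hom_image[OF L1 V gl W])
    moreover have "colim_in K I F E i ` carrier (F i) \<subseteq> g ` W" if i: "i \<in> I" for i
    proof (rule image_subsetI)
      fix m assume m: "m \<in> carrier (F i)"
      then have "colim_in K I F E i m = g (\<gamma> i m)" using gs module_hom_closed[OF cin[OF i]] by (simp add: \<gamma>_def)
      then show "colim_in K I F E i m \<in> g ` W" using sub[OF i] m by blast
    qed
    ultimately have "carrier V \<subseteq> g ` W" unfolding V_def by (rule colim_span[OF D])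
    moreover have "s (g w) = w" if "w \<in> W" for w
      using that W gs by (auto simp: submodule_iff[OF L1] L1c)
    ultimately show ?thesis unfolding L1c by force
  qed
  have lift: "\<exists>h\<in>module_hom K (L1 c) P. \<forall>i\<in>I. \<forall>m\<in>carrier (F i). h (\<gamma> i m) = \<delta> i m"
    if P: "module K P" and \<delta>: "\<And>i. i \<in> I \<Longrightarrow> \<delta> i \<in> module_hom K (F i) P"
      and arr: "\<And>i j u m. (i, j, u) \<in> E \<Longrightarrow> m \<in> carrier (F i) \<Longrightarrow> \<delta> j (u m) = \<delta> i m"
    for P :: "('k, 'a, 'm) comodule" and \<delta> c
  proof -
    obtain h where h: "h \<in> module_hom K V P" "\<And>i m. i \<in> I \<Longrightarrow> m \<in> carrier (F i) \<Longrightarrow> h (colim_in K I F E i m) = \<delta> i m"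
      by (rule colim_lift[OF D P, of \<delta>, folded V_def]) (erule \<delta> | erule (1) arr | blast)+
    show ?thesis
      by (rule bexI[OF _ module_hom_comp[OF gl h(1)]])
         (use h(2) gs module_hom_closed[OF cin] in \<open>simp add: \<gamma>_def\<close>)
  qed
  define L0 where "L0 = L1 undefined"
  let ?T = "tensor K L0 A"
  have LT: "tensor K (L1 c) A = ?T" "tensor_map K M A (L1 c) A = tensor_map K M A L0 A"
    for c and M :: "('k, 'a, 'm) comodule"
    unfolding L0_def L1_def by (rule tensor_transport_comodule)+
  have L0: "module K L0" and \<gamma>l0: "\<And>i. i \<in> I \<Longrightarrow> \<gamma> i \<in> module_hom K (F i) L0"
    unfolding L0_def using L1 \<gamma>l by blast+
  have T: "module K ?T" by (rule tensor_module[OF L0 A_module])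
  define \<delta> where "\<delta> i m = tensor_map K (F i) A L0 A (\<gamma> i) id (coact (F i) m)" for i m
  have \<delta>l: "\<delta> i \<in> module_hom K (F i) ?T" if "i \<in> I" for i
    unfolding \<delta>_def[abs_def]
    by (rule module_hom_comp[OF precomodule_coact[OF F'[OF that]]
          tensor_map_linear[OF FM[OF that] A_module L0 A_module \<gamma>l0[OF that] module_hom_id]])
  have \<delta>u: "\<delta> j (u m) = \<delta> i m" if u: "(i, j, u) \<in> E" and m: "m \<in> carrier (F i)" for i j u m
  proof -
    have ij: "i \<in> I" "j \<in> I" "colinear K A (F i) (F j) u" using E[OF u] by auto
    note cm = module_hom_closed[OF precomodule_coact[OF F'[OF ij(1)]] m]
    have "\<delta> j (u m) = tensor_map K (F i) A L0 A (\<lambda>x. \<gamma> j (u x)) id (coact (F i) m)"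
      using tensor_map_comp_id[OF FM[OF ij(1)] A_module FM[OF ij(2)] L0 colinear_linear[OF ij(3)] \<gamma>l0[OF ij(2)] cm]
      by (simp add: \<delta>_def colinear_coact[OF ij(3) m])
    also have "\<dots> = \<delta> i m"
      unfolding \<delta>_def
      by (rule tensor_map_cong[OF FM[OF ij(1)] A_module L0 A_module
            module_hom_comp[OF colinear_linear[OF ij(3)] \<gamma>l0[OF ij(2)]] module_hom_id _ _ cm])
         (simp_all add: \<gamma>u[OF u])
    finally show ?thesis .
  qed
  obtain d where d: "d \<in> module_hom K V ?T"
    "\<And>i m. i \<in> I \<Longrightarrow> m \<in> carrier (F i) \<Longrightarrow> d (colim_in K I F E i m) = \<delta> i m"
    by (rule colim_lift[OF D T, of \<delta>, folded V_def]) (erule \<delta>l | erule (1) \<delta>u | blast)+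
  define c where "c x = d (g x)" for x
  define L where "L = L1 c"
  have coactL: "coact L = c" by (simp add: L_def L1_def transport_comodule_def Let_def)
  have "c \<in> module_hom K L ?T" unfolding c_def[abs_def] L_def by (rule module_hom_comp[OF gl d(1)])
  then have L': "precomodule K A L" using L1 unfolding precomodule_def coactL by (simp add: L_def LT)
  have \<gamma>c: "colinear K A (F i) L (\<gamma> i)" if i: "i \<in> I" for i
    unfolding colinear_def
  proof (intro conjI ballI)
    show "\<gamma> i \<in> module_hom K (F i) L" unfolding L_def by (rule \<gamma>l[OF i])
    fix m assume m: "m \<in> carrier (F i)"
    have "c (\<gamma> i m) = \<delta> i m"
      using d(2)[OF i m] gs module_hom_closed[OF cin[OF i] m] by (simp add: c_def \<gamma>_def)
    then show "coact L (\<gamma> i m) = tensor_map K (F i) A L A (\<gamma> i) id (coact (F i) m)"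
      unfolding coactL by (simp add: \<delta>_def L_def LT)
  qed
  have FC: "is_comodule K A (F i)" if "i \<in> I" for i using F[OF that] by (simp add: X_comodule_iff)
  have spanL: "carrier L \<subseteq> W" if "submodule W K L" "\<And>i. i \<in> I \<Longrightarrow> \<gamma> i ` carrier (F i) \<subseteq> W" for W
    using that unfolding L_def by (rule span)
  have LC: "is_comodule K A L"
  proof (rule comodule_generated[OF L'])
    show "is_comodule K A (F i)" if "i \<in> I" for i by (rule FC[OF that])
    show "colinear K A (F i) L (\<gamma> i)" if "i \<in> I" for i by (rule \<gamma>c[OF that])
    show "jointly_spanning K L I F \<gamma>" using spanL by (simp add: jointly_spanning_def)
  qed
  note LM = precomodule_module[OF L']
  have XU: "X_subcomodule K A X L (X_part_carrier K A X L)" by (rule X_subcomodule_X_part[OF LC])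
  have "carrier L \<subseteq> X_part_carrier K A X L"
  proof (rule spanL)
    show "submodule (X_part_carrier K A X L) K L" using XU by (simp add: X_subcomodule_def)
    fix i assume i: "i \<in> I"
    have "X_subcomodule K A X (F i) (carrier (F i))" using F[OF i] by (simp add: X_comodule_iff)
    then show "\<gamma> i ` carrier (F i) \<subseteq> X_part_carrier K A X L"
      by (intro X_subcomodule_le_X_part[OF LC] X_subcomodule_image[OF F'[OF i] L' \<gamma>c[OF i]])
  qed
  moreover have "X_part_carrier K A X L \<subseteq> carrier L" using XU by (auto simp: X_subcomodule_def submodule_iff[OF LM])
  ultimately have "X_comodule K A X L" using XU LC by (simp add: X_comodule_iff)
  moreover have "colimit_comodule K A I F E L \<gamma>"
    unfolding colimit_comodule_def jointly_spanning_def
    using \<gamma>c \<gamma>u spanL lift[of _ _ c, folded L_def] by (intro conjI allI impI ballI) simp_all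
  ultimately show thesis by (rule that)
qed

text \<open>As \<open>'m\<close> is infinite, \<open>'m \<times> 'm\<close> has the same cardinality.  A colimit whose elements can be
parametrised by pairs from \<open>'m\<close> therefore fits into \<open>'m\<close>.\<close>

lemma injection_into_infinite_type:
  fixes g :: "'m::infinite \<times> 'm \<Rightarrow> 'v"
  assumes "S \<subseteq> range g"
  obtains h :: "'v \<Rightarrow> 'm" where "inj_on h S"
proof -
  have "(card_of (UNIV \<times> UNIV :: ('m \<times> 'm) set), card_of (UNIV :: 'm set)) \<in> ordIso"
    using infinite_UNIV by (rule card_of_Times_same_infinite)
  then obtain b :: "'m \<times> 'm \<Rightarrow> 'm" where "bij_betw b (UNIV \<times> UNIV) UNIV"
    unfolding card_of_ordIso[symmetric] by blast
  then have b: "inj b" by (simp add: bij_betw_def)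
  have "inj_on (\<lambda>v. b (inv_into UNIV g v)) S"
  proof (rule inj_onI)
    fix v w assume "v \<in> S" "w \<in> S" "b (inv_into UNIV g v) = b (inv_into UNIV g w)"
    then show "v = w" using injD[OF b] assms by (metis f_inv_into_f subsetD)
  qed
  then show thesis by (rule that)
qed

section \<open>The category of \<open>X\<close>-comodules\<close>

type_synonym ('k, 'a, 'm) comodule_category = "(('k, 'a, 'm) comodule, 'm \<Rightarrow> 'm) preadditive"

lemma ModGX_simps [simp]:
  "Obj (ModGX K A X) = {M. X_comodule K A X M}"
  "Hom (ModGX K A X) = comodule_hom K A"
  "Idn (ModGX K A X) M = restrict id (carrier M)"
  "Cmp (ModGX K A X) M N P g f = compose (carrier M) g f"
  "hom_add (ModGX K A X) M N f g = (\<lambda>m\<in>carrier M. f m \<oplus>\<^bsub>N\<^esub> g m)"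
  "hom_zero (ModGX K A X) M N = (\<lambda>m\<in>carrier M. \<zero>\<^bsub>N\<^esub>)"
  by (simp_all add: ModGX_def ModG_def)

lemma ex1_unique: "\<exists>!x. P x \<Longrightarrow> P a \<Longrightarrow> P b \<Longrightarrow> a = b"
  by blast

lemma comodule_hom_eqI:
  assumes "f \<in> comodule_hom K A M N" "g \<in> comodule_hom K A M N'" "\<And>m. m \<in> carrier M \<Longrightarrow> f m = g m"
  shows "f = g"
  using assms by (intro extensionalityI[of _ "carrier M"]) (auto simp: comodule_hom_iff)

lemma comodule_hom_colinear: "f \<in> comodule_hom K A M N \<Longrightarrow> colinear K A M N f"
  by (simp add: comodule_hom_iff)

lemma comodule_hom_linear: "f \<in> comodule_hom K A M N \<Longrightarrow> f \<in> module_hom K M N"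
  by (auto simp: comodule_hom_iff intro: colinear_linear)

lemma comodule_hom_closed: "f \<in> comodule_hom K A M N \<Longrightarrow> m \<in> carrier M \<Longrightarrow> f m \<in> carrier N"
  using module_hom_closed[OF comodule_hom_linear] .

lemma (in affine_group_scheme) comodule_hom_restrict:
  assumes "precomodule K A M" "precomodule K A N" "colinear K A M N f"
  shows "restrict f (carrier M) \<in> comodule_hom K A M N"
  using colinear_cong[OF assms(1) precomodule_module[OF assms(2)] assms(3), of "restrict f (carrier M)"]
  by (simp add: comodule_hom_iff)

lemma (in affine_group_scheme) comodule_hom_compose:
  assumes "precomodule K A M" "precomodule K A N" "precomodule K A P"
    and "f \<in> comodule_hom K A M N" "g \<in> comodule_hom K A N P"
  shows "compose (carrier M) g f \<in> comodule_hom K A M P"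
  unfolding compose_def
  using colinear_comp[OF assms(1) precomodule_module[OF assms(2)] precomodule_module[OF assms(3)]]
    comodule_hom_colinear[OF assms(4)] comodule_hom_colinear[OF assms(5)]
  by (intro comodule_hom_restrict assms)

context affine_group_scheme_subspace
begin

lemma ModGX_category: "is_category (ModGX K A X)"
  unfolding is_category_def ModGX_simps
proof (intro conjI ballI; (unfold mem_Collect_eq)?)
  fix M assume "X_comodule K A X M"
  then show "restrict id (carrier M) \<in> comodule_hom K A M M"
    by (intro comodule_hom_restrict colinear_id X_comodule_precomodule)
next
  fix M N P f g assume "X_comodule K A X M" "X_comodule K A X N" "X_comodule K A X P"
    "f \<in> comodule_hom K A M N" "g \<in> comodule_hom K A N P"
  then show "compose (carrier M) g f \<in> comodule_hom K A M P"
    using comodule_hom_compose X_comodule_precomodule by blast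
next
  fix M N f assume "f \<in> comodule_hom K A M N"
  then show "compose (carrier M) f (restrict id (carrier M)) = f" "compose (carrier M) (restrict id (carrier N)) f = f"
    using comodule_hom_closed[of f K A M N] by (auto simp: comodule_hom_iff compose_def extensional_def fun_eq_iff)
next
  fix M N P Q f g h assume "f \<in> comodule_hom K A M N" "g \<in> comodule_hom K A N P"
  then show "compose (carrier M) h (compose (carrier M) g f) = compose (carrier M) (compose (carrier N) h g) f"
    using comodule_hom_closed[of f K A M N] by (auto simp: compose_def fun_eq_iff)
qed

lemma comodule_hom_comm_group:
  assumes M: "precomodule K A M" and N: "precomodule K A N"
  shows "comm_group \<lparr>carrier = comodule_hom K A M N, mult = \<lambda>f g. \<lambda>m\<in>carrier M. f m \<oplus>\<^bsub>N\<^esub> g m,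
    one = \<lambda>m\<in>carrier M. \<zero>\<^bsub>N\<^esub>\<rparr>"
proof -
  interpret M: module K M by (rule precomodule_module[OF M])
  interpret N: module K N by (rule precomodule_module[OF N])
  note cl = comodule_hom_closed[of _ K A M N]
  note ext = comodule_hom_eqI[of _ K A M N _ N]
  have sum: "(\<lambda>m\<in>carrier M. f m \<oplus>\<^bsub>N\<^esub> g m) \<in> comodule_hom K A M N"
    if "f \<in> comodule_hom K A M N" "g \<in> comodule_hom K A M N" for f g
    using that by (intro comodule_hom_restrict colinear_sum M N comodule_hom_colinear)
  have zero: "(\<lambda>m\<in>carrier M. \<zero>\<^bsub>N\<^esub>) \<in> comodule_hom K A M N"
    by (intro comodule_hom_restrict colinear_zero M N)
  show ?thesis
  proof (rule comm_groupI; simp only: partial_object.simps monoid.simps)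
    fix f assume f: "f \<in> comodule_hom K A M N"
    let ?g = "\<lambda>m\<in>carrier M. f ((\<ominus>\<^bsub>K\<^esub> \<one>\<^bsub>K\<^esub>) \<odot>\<^bsub>M\<^esub> m)"
    have g: "?g \<in> comodule_hom K A M N"
      using f by (intro comodule_hom_restrict colinear_smult M N comodule_hom_colinear) simp_all
    have "(\<lambda>m\<in>carrier M. ?g m \<oplus>\<^bsub>N\<^esub> f m) = (\<lambda>m\<in>carrier M. \<zero>\<^bsub>N\<^esub>)"
    proof (rule ext[OF sum[OF g f] zero])
      fix m assume m: "m \<in> carrier M"
      have "f ((\<ominus>\<^bsub>K\<^esub> \<one>\<^bsub>K\<^esub>) \<odot>\<^bsub>M\<^esub> m) \<oplus>\<^bsub>N\<^esub> f m = f (\<ominus>\<^bsub>M\<^esub> m \<oplus>\<^bsub>M\<^esub> m)"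
        using m module_hom_add[OF comodule_hom_linear[OF f], of "\<ominus>\<^bsub>M\<^esub> m" m] by (simp add: M.smult_l_minus)
      then show "(\<lambda>m\<in>carrier M. ?g m \<oplus>\<^bsub>N\<^esub> f m) m = (\<lambda>m\<in>carrier M. \<zero>\<^bsub>N\<^esub>) m"
        using m module_hom_zero[OF M.module_axioms N.module_axioms comodule_hom_linear[OF f]] by (simp add: M.l_neg)
    qed
    then show "\<exists>g\<in>comodule_hom K A M N. (\<lambda>m\<in>carrier M. g m \<oplus>\<^bsub>N\<^esub> f m) = (\<lambda>m\<in>carrier M. \<zero>\<^bsub>N\<^esub>)"
      using g by blast
  next
    fix f assume f: "f \<in> comodule_hom K A M N"
    show "(\<lambda>m\<in>carrier M. (\<lambda>m\<in>carrier M. \<zero>\<^bsub>N\<^esub>) m \<oplus>\<^bsub>N\<^esub> f m) = f"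
      using cl[OF f] by (intro ext[OF sum[OF zero f] f]) simp
  qed (auto simp: sum zero cl N.a_ac intro!: restrict_ext)
qed

lemma ModGX_preadditive: "preadditive_category (ModGX K A X)"
  unfolding preadditive_category_def
proof (intro conjI ballI ModGX_category)
  fix M N :: "('k, 'a, 'm::infinite) comodule" assume "M \<in> Obj (ModGX K A X)" "N \<in> Obj (ModGX K A X)"
  then have "precomodule K A M" "precomodule K A N" by (simp_all add: X_comodule_precomodule)
  then show "comm_group \<lparr>carrier = Hom (ModGX K A X) M N, mult = hom_add (ModGX K A X) M N, one = hom_zero (ModGX K A X) M N\<rparr>"
    unfolding ModGX_simps(2) ModGX_simps(5,6)[abs_def] by (rule comodule_hom_comm_group)
next
  fix M N P :: "('k, 'a, 'm::infinite) comodule" and f f' g g'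
  assume obj: "M \<in> Obj (ModGX K A X)" "N \<in> Obj (ModGX K A X)" "P \<in> Obj (ModGX K A X)"
    and hom: "f \<in> Hom (ModGX K A X) M N" "f' \<in> Hom (ModGX K A X) M N" "g \<in> Hom (ModGX K A X) N P" "g' \<in> Hom (ModGX K A X) N P"
  have "f \<in> comodule_hom K A M N" "f' \<in> comodule_hom K A M N" "g \<in> comodule_hom K A N P"
    using hom by simp_all
  then show "Cmp (ModGX K A X) M N P g (hom_add (ModGX K A X) M N f f') =
      hom_add (ModGX K A X) M P (Cmp (ModGX K A X) M N P g f) (Cmp (ModGX K A X) M N P g f')"
    "Cmp (ModGX K A X) M N P (hom_add (ModGX K A X) N P g g') f =
      hom_add (ModGX K A X) M P (Cmp (ModGX K A X) M N P g f) (Cmp (ModGX K A X) M N P g' f)"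
    using comodule_hom_closed[of f K A M N] comodule_hom_closed[of f' K A M N]
      module_hom_add[OF comodule_hom_linear[of g K A N P]]
    by (auto simp: compose_def fun_eq_iff)
qed

section \<open>Kernels and cokernels\<close>

text \<open>If \<open>f g = 0\<close>, then \<open>g\<close> maps into the image of the injection \<open>i\<close>.  For a generalized inverse
\<open>s\<close> of \<open>i\<close> the map \<open>s g\<close> is the factorisation; it is colinear because \<open>i s g = g\<close> is.\<close>

lemma kernelI:
  fixes k :: "('k, 'a, 'm::infinite) comodule"
  assumes M: "X_comodule K A X M" and N: "X_comodule K A X N" and f: "f \<in> comodule_hom K A M N"
    and k: "X_comodule K A X k" and i: "i \<in> comodule_hom K A k M" and inj: "inj_on i (carrier k)"
    and image: "i ` carrier k = {m \<in> carrier M. f m = \<zero>\<^bsub>N\<^esub>}"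
  shows "is_kernel (ModGX K A X) M N f k i"
  unfolding is_kernel_def ModGX_simps
proof (intro conjI ballI impI; (unfold mem_Collect_eq)?)
  note M' = X_comodule_precomodule[OF M] and k' = X_comodule_precomodule[OF k]
  note MM = precomodule_module[OF M'] and kM = precomodule_module[OF k']
  show "X_comodule K A X k" "i \<in> comodule_hom K A k M" by fact+
  have "f (i x) = \<zero>\<^bsub>N\<^esub>" if "x \<in> carrier k" for x using image that by blast
  then show "compose (carrier k) f i = (\<lambda>m\<in>carrier k. \<zero>\<^bsub>N\<^esub>)" by (auto simp: compose_def)
  fix w g assume w: "X_comodule K A X w" and g: "g \<in> comodule_hom K A w M"
    and fg: "compose (carrier w) f g = (\<lambda>m\<in>carrier w. \<zero>\<^bsub>N\<^esub>)"
  note w' = X_comodule_precomodule[OF w] and il = comodule_hom_linear[OF i]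
  have "f (g x) = \<zero>\<^bsub>N\<^esub>" if "x \<in> carrier w" for x using fun_cong[OF fg, of x] that by (simp add: compose_def)
  then have gi: "g x \<in> i ` carrier k" if "x \<in> carrier w" for x
    using that comodule_hom_closed[OF g] by (simp add: image)
  obtain s where s: "s \<in> module_hom K M k" "\<And>x. x \<in> carrier k \<Longrightarrow> i (s (i x)) = i x"
    using linear_generalized_inverse[OF field_K kM MM il] by blast
  have isg: "i (s (g x)) = g x" if "x \<in> carrier w" for x using gi[OF that] s(2) by auto
  have sg: "(\<lambda>x. s (g x)) \<in> module_hom K w k" by (rule module_hom_comp[OF comodule_hom_linear[OF g] s(1)])
  have "colinear K A w k (\<lambda>x. s (g x))"
    by (rule colinear_through_injection[OF k' M' w' sg comodule_hom_colinear[OF i] inj])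
       (rule colinear_cong[OF w' MM comodule_hom_colinear[OF g]], simp add: isg)
  then have u: "(\<lambda>x\<in>carrier w. s (g x)) \<in> comodule_hom K A w k" by (rule comodule_hom_restrict[OF w' k'])
  show "\<exists>!u. u \<in> comodule_hom K A w k \<and> compose (carrier w) i u = g"
  proof (rule ex1I)
    show "(\<lambda>x\<in>carrier w. s (g x)) \<in> comodule_hom K A w k \<and> compose (carrier w) i (\<lambda>x\<in>carrier w. s (g x)) = g"
      using u g isg by (auto simp: compose_def comodule_hom_iff extensional_def fun_eq_iff)
    fix v assume v: "v \<in> comodule_hom K A w k \<and> compose (carrier w) i v = g"
    show "v = (\<lambda>x\<in>carrier w. s (g x))"
    proof (rule comodule_hom_eqI[OF conjunct1[OF v] u])
      fix x assume x: "x \<in> carrier w"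
      have "i (v x) = i (s (g x))" using fun_cong[OF conjunct2[OF v], of x] x isg[OF x] by (simp add: compose_def)
      then have "v x = s (g x)"
        using inj_onD[OF inj] comodule_hom_closed[OF conjunct1[OF v] x] module_hom_closed[OF sg x] by blast
      then show "v x = (\<lambda>x\<in>carrier w. s (g x)) x" using x by simp
    qed
  qed
qed

lemma kernel_exists:
  fixes M :: "('k, 'a, 'm::infinite) comodule"
  assumes M: "X_comodule K A X M" and N: "X_comodule K A X N" and f: "f \<in> comodule_hom K A M N"
  obtains k and i :: "'m \<Rightarrow> 'm" where "X_comodule K A X k" "i \<in> comodule_hom K A k M" "inj_on i (carrier k)"
    "i ` carrier k = {m \<in> carrier M. f m = \<zero>\<^bsub>N\<^esub>}"
proof -
  let ?W = "{m \<in> carrier M. f m = \<zero>\<^bsub>N\<^esub>}" and ?k = "restrict_comodule K A M {m \<in> carrier M. f m = \<zero>\<^bsub>N\<^esub>}"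
  note M' = X_comodule_precomodule[OF M] and N' = X_comodule_precomodule[OF N]
  have MC: "is_comodule K A M" using M by (simp add: X_comodule_iff)
  have W: "X_subcomodule K A X M ?W" by (rule X_subcomodule_kernel[OF M N' comodule_hom_colinear[OF f]])
  note k = X_comodule_restrict[OF MC W]
  have "restrict id (carrier ?k) \<in> comodule_hom K A ?k M"
    by (rule comodule_hom_restrict[OF X_comodule_precomodule[OF k] M' restrict_comodule_inclusion[OF M' X_subcomodule_coact[OF M' W]]])
  then show thesis by (rule that[OF k]) (auto simp: inj_on_def)
qed

text \<open>An abstract kernel is isomorphic to the restriction to the set-theoretic kernel, which gives the non-trivial
direction.\<close>

lemma kernel_iff:
  fixes k :: "('k, 'a, 'm::infinite) comodule"
  assumes M: "X_comodule K A X M" and N: "X_comodule K A X N" and f: "f \<in> comodule_hom K A M N"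
  shows "is_kernel (ModGX K A X) M N f k i \<longleftrightarrow> X_comodule K A X k \<and> i \<in> comodule_hom K A k M \<and>
    inj_on i (carrier k) \<and> i ` carrier k = {m \<in> carrier M. f m = \<zero>\<^bsub>N\<^esub>}"
proof
  assume ker: "is_kernel (ModGX K A X) M N f k i"
  then have k: "X_comodule K A X k" and i: "i \<in> comodule_hom K A k M"
    and fi: "compose (carrier k) f i = (\<lambda>m\<in>carrier k. \<zero>\<^bsub>N\<^esub>)"
    and univ: "\<And>w g. X_comodule K A X w \<Longrightarrow> g \<in> comodule_hom K A w M \<Longrightarrow>
      compose (carrier w) f g = (\<lambda>m\<in>carrier w. \<zero>\<^bsub>N\<^esub>) \<Longrightarrow> \<exists>!u. u \<in> comodule_hom K A w k \<and> compose (carrier w) i u = g"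
    by (simp_all add: is_kernel_def)
  note k' = X_comodule_precomodule[OF k]
  have fi0: "f (i x) = \<zero>\<^bsub>N\<^esub>" if "x \<in> carrier k" for x using fun_cong[OF fi, of x] that by (simp add: compose_def)
  obtain l and j :: "'m \<Rightarrow> 'm" where l: "X_comodule K A X l" "j \<in> comodule_hom K A l M" "inj_on j (carrier l)"
    "j ` carrier l = {m \<in> carrier M. f m = \<zero>\<^bsub>N\<^esub>}"
    using kernel_exists[OF M N f] by blast
  note l' = X_comodule_precomodule[OF l(1)]
  have fj0: "f (j x) = \<zero>\<^bsub>N\<^esub>" if "x \<in> carrier l" for x using l(4) that by blast
  then have fj: "compose (carrier l) f j = (\<lambda>m\<in>carrier l. \<zero>\<^bsub>N\<^esub>)" by (auto simp: compose_def)
  have "\<exists>u. u \<in> comodule_hom K A k l \<and> compose (carrier k) j u = i"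
    using kernelI[OF M N f l] k i fi unfolding is_kernel_def ModGX_simps by blast
  then obtain u where u: "u \<in> comodule_hom K A k l" "compose (carrier k) j u = i" by blast
  obtain v where v: "v \<in> comodule_hom K A l k" "compose (carrier l) i v = j" using univ[OF l(1,2) fj] by blast
  have ju: "j (u x) = i x" if "x \<in> carrier k" for x using fun_cong[OF u(2), of x] that by (simp add: compose_def)
  have iv: "i (v x) = j x" if "x \<in> carrier l" for x using fun_cong[OF v(2), of x] that by (simp add: compose_def)
  have id: "restrict id (carrier k) \<in> comodule_hom K A k k" by (rule comodule_hom_restrict[OF k' k' colinear_id[OF k']])
  have "compose (carrier k) v u = restrict id (carrier k)"
  proof (rule ex1_unique)
    show "\<exists>!u. u \<in> comodule_hom K A k k \<and> compose (carrier k) i u = i" by (rule univ[OF k i fi])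
    show "compose (carrier k) v u \<in> comodule_hom K A k k \<and> compose (carrier k) i (compose (carrier k) v u) = i"
      using comodule_hom_compose[OF k' l' k' u(1) v(1)] i comodule_hom_closed[OF u(1)] iv ju
      by (auto simp: compose_def comodule_hom_iff extensional_def fun_eq_iff)
    show "restrict id (carrier k) \<in> comodule_hom K A k k \<and> compose (carrier k) i (restrict id (carrier k)) = i"
      using id i by (auto simp: compose_def comodule_hom_iff extensional_def fun_eq_iff)
  qed
  then have vu: "v (u x) = x" if "x \<in> carrier k" for x using that by (auto simp: compose_def dest: fun_cong[of _ _ x])
  have inj: "inj_on i (carrier k)"
  proof (rule inj_onI)
    fix x y assume x: "x \<in> carrier k" and y: "y \<in> carrier k" and "i x = i y"
    then have "u x = u y" using ju inj_onD[OF l(3)] comodule_hom_closed[OF u(1)] by metis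
    then show "x = y" using vu x y by metis
  qed
  have "i ` carrier k = {m \<in> carrier M. f m = \<zero>\<^bsub>N\<^esub>}"
  proof
    show "i ` carrier k \<subseteq> {m \<in> carrier M. f m = \<zero>\<^bsub>N\<^esub>}" using fi0 comodule_hom_closed[OF i] by blast
    show "{m \<in> carrier M. f m = \<zero>\<^bsub>N\<^esub>} \<subseteq> i ` carrier k"
      unfolding l(4)[symmetric] using iv comodule_hom_closed[OF v(1)] by (metis image_eqI image_subsetI)
  qed
  then show "X_comodule K A X k \<and> i \<in> comodule_hom K A k M \<and>
    inj_on i (carrier k) \<and> i ` carrier k = {m \<in> carrier M. f m = \<zero>\<^bsub>N\<^esub>}" using k i inj by blast
next
  assume "X_comodule K A X k \<and> i \<in> comodule_hom K A k M \<and>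
    inj_on i (carrier k) \<and> i ` carrier k = {m \<in> carrier M. f m = \<zero>\<^bsub>N\<^esub>}"
  then show "is_kernel (ModGX K A X) M N f k i" using kernelI[OF M N f] by blast
qed

lemma cokernelI:
  fixes c :: "('k, 'a, 'm::infinite) comodule"
  assumes M: "X_comodule K A X M" and N: "X_comodule K A X N" and f: "f \<in> comodule_hom K A M N"
    and c: "X_comodule K A X c" and q: "q \<in> comodule_hom K A N c" and surj: "q ` carrier N = carrier c"
    and ker: "{n \<in> carrier N. q n = \<zero>\<^bsub>c\<^esub>} = f ` carrier M"
  shows "is_cokernel (ModGX K A X) M N f c q"
  unfolding is_cokernel_def ModGX_simps
proof (intro conjI ballI impI; (unfold mem_Collect_eq)?)
  note N' = X_comodule_precomodule[OF N] and c' = X_comodule_precomodule[OF c]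
  note NM = precomodule_module[OF N'] and cM = precomodule_module[OF c']
  show "X_comodule K A X c" "q \<in> comodule_hom K A N c" by fact+
  have "q (f x) = \<zero>\<^bsub>c\<^esub>" if "x \<in> carrier M" for x using ker that by blast
  then show "compose (carrier M) q f = (\<lambda>m\<in>carrier M. \<zero>\<^bsub>c\<^esub>)" by (auto simp: compose_def)
  fix w g assume w: "X_comodule K A X w" and g: "g \<in> comodule_hom K A N w"
    and gf: "compose (carrier M) g f = (\<lambda>m\<in>carrier M. \<zero>\<^bsub>w\<^esub>)"
  note w' = X_comodule_precomodule[OF w] and ql = comodule_hom_linear[OF q] and gl = comodule_hom_linear[OF g]
  note wM = precomodule_module[OF w']
  have gf0: "g (f x) = \<zero>\<^bsub>w\<^esub>" if "x \<in> carrier M" for x using fun_cong[OF gf, of x] that by (simp add: compose_def)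
  have kk: "g n = \<zero>\<^bsub>w\<^esub>" if "n \<in> carrier N" "q n = \<zero>\<^bsub>c\<^esub>" for n
  proof -
    have "n \<in> f ` carrier M" using that by (simp add: ker[symmetric])
    then show ?thesis using gf0 by blast
  qed
  obtain u where u: "u \<in> module_hom K c w" "\<And>n. n \<in> carrier N \<Longrightarrow> u (q n) = g n"
    using factor_through_surjection[OF NM cM wM ql surj gl kk] by blast
  have "colinear K A c w u"
    by (rule colinear_through_surjection[OF N' c' w' u(1) comodule_hom_colinear[OF q] surj])
       (rule colinear_cong[OF N' wM comodule_hom_colinear[OF g]], simp add: u(2))
  then have ru: "restrict u (carrier c) \<in> comodule_hom K A c w" by (rule comodule_hom_restrict[OF c' w'])
  show "\<exists>!u. u \<in> comodule_hom K A c w \<and> compose (carrier N) u q = g"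
  proof (rule ex1I)
    show "restrict u (carrier c) \<in> comodule_hom K A c w \<and> compose (carrier N) (restrict u (carrier c)) q = g"
      using ru g u(2) comodule_hom_closed[OF q] by (auto simp: compose_def comodule_hom_iff extensional_def fun_eq_iff)
    fix v assume v: "v \<in> comodule_hom K A c w \<and> compose (carrier N) v q = g"
    show "v = restrict u (carrier c)"
    proof (rule comodule_hom_eqI[OF conjunct1[OF v] ru])
      fix x assume x: "x \<in> carrier c"
      then obtain n where n: "n \<in> carrier N" "x = q n" using surj by blast
      then have "v x = g n" using fun_cong[OF conjunct2[OF v], of n] by (simp add: compose_def)
      then show "v x = restrict u (carrier c) x" using x n u(2) by simp
    qed
  qed
qed

text \<open>The cokernel of \<open>f\<close> is the colimit of the two arrows \<open>f, 0 : M \<rightarrow> N\<close>.  To see that its kernel is no larger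
than the image of \<open>f\<close>, take \<open>s\<close> with \<open>f s f = f\<close>: the linear map \<open>e = 1 - f s\<close> kills the image and so
factors through the cokernel, while \<open>e n = 0\<close> means \<open>n = f (s n)\<close>.\<close>

lemma cokernel_exists:
  fixes N :: "('k, 'a, 'm::infinite) comodule"
  assumes M: "X_comodule K A X M" and N: "X_comodule K A X N" and f: "f \<in> comodule_hom K A M N"
  obtains c and q :: "'m \<Rightarrow> 'm" where "X_comodule K A X c" "q \<in> comodule_hom K A N c" "q ` carrier N = carrier c"
    "{n \<in> carrier N. q n = \<zero>\<^bsub>c\<^esub>} = f ` carrier M"
proof -
  note M' = X_comodule_precomodule[OF M] and N' = X_comodule_precomodule[OF N]
  note MM = precomodule_module[OF M'] and NM = precomodule_module[OF N'] and fl = comodule_hom_linear[OF f]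
  interpret N: module K N by (rule NM)
  interpret M: module K M by (rule MM)
  \<comment> \<open>The index \<open>True\<close> stands for the target and \<open>False\<close> for the source.\<close>
  define F where "F b = (if b then N else M)" for b :: bool
  have F: "F True = N" "F False = M" by (simp_all add: F_def)
  define E where "E = {(False, True, f), (False, True, \<lambda>_. \<zero>\<^bsub>N\<^esub>)}"
  have FX: "X_comodule K A X (F b)" for b using M N by (simp add: F_def)
  have EX: "colinear K A (F i) (F j) u" if "(i, j, u) \<in> E" for i j u
    using that comodule_hom_colinear[OF f] colinear_zero[OF M' N'] by (auto simp: E_def F)
  have "cring K" ..
  then have D: "linear_diagram K UNIV F E"
    using precomodule_module[OF X_comodule_precomodule[OF FX]] EX colinear_linear unfolding linear_diagram_def by fastforce
  let ?V = "colim_module K UNIV F E" and ?c = "colim_in K UNIV F E"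
  note Vm = colim_module_module[OF D]
  have "carrier ?V \<subseteq> ?c True ` carrier N"
  proof (rule colim_span[OF D])
    show "submodule (?c True ` carrier N) K ?V"
      using module_hom_image[OF NM Vm colim_in_linear[OF D, of True, unfolded F] N.carrier_is_submodule] by simp
    fix b :: bool
    have "?c False m \<in> ?c True ` carrier N" if "m \<in> carrier M" for m
      using colim_in_arrow[OF D, of False True f m] that comodule_hom_closed[OF f, of m] by (force simp: E_def F)
    then show "?c b ` carrier (F b) \<subseteq> ?c True ` carrier N" by (cases b) (auto simp: F)
  qed
  then have "carrier ?V \<subseteq> range (\<lambda>(x :: 'm, y :: 'm). ?c True x)" by force
  then obtain s :: "_ \<Rightarrow> 'm" where s: "inj_on s (carrier ?V)" by (rule injection_into_infinite_type)
  obtain L :: "('k, 'a, 'm) comodule" and \<gamma> where L: "X_comodule K A X L"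
    and colim: "colimit_comodule K A UNIV F E L \<gamma>"
    by (rule small_colimit[OF FX _ s]) (use EX in blast)+
  note \<gamma> = colimit_comodule_colinear[OF colim] and \<gamma>u = colimit_comodule_arrow[OF colim]
  note L' = X_comodule_precomodule[OF L]
  note LM = precomodule_module[OF L']
  define q where "q = restrict (\<gamma> True) (carrier N)"
  have \<gamma>N: "colinear K A N L (\<gamma> True)" using \<gamma>[of True] by (simp add: F)
  have q: "q \<in> comodule_hom K A N L" unfolding q_def by (rule comodule_hom_restrict[OF N' L' \<gamma>N])
  have \<gamma>f: "\<gamma> False m = \<gamma> True (f m)" if "m \<in> carrier M" for m using \<gamma>u[of False True f m] that by (simp add: E_def F)
  have \<gamma>0: "\<gamma> False m = \<zero>\<^bsub>L\<^esub>" if "m \<in> carrier M" for m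
    using \<gamma>u[of False True "\<lambda>_. \<zero>\<^bsub>N\<^esub>" m] that module_hom_zero[OF NM LM colinear_linear[OF \<gamma>N]] by (simp add: E_def F)
  have "carrier L \<subseteq> \<gamma> True ` carrier N"
  proof (rule jointly_spanningD[OF colimit_comodule_span[OF colim]])
    show "submodule (\<gamma> True ` carrier N) K L"
      by (rule module_hom_image[OF NM LM colinear_linear[OF \<gamma>N] N.carrier_is_submodule])
    fix b :: bool
    show "\<gamma> b ` carrier (F b) \<subseteq> \<gamma> True ` carrier N"
      by (cases b) (auto simp: F \<gamma>f comodule_hom_closed[OF f])
  qed
  then have surj: "q ` carrier N = carrier L" using comodule_hom_closed[OF q] by (auto simp: q_def)
  obtain s where s: "s \<in> module_hom K N M" "\<And>m. m \<in> carrier M \<Longrightarrow> f (s (f m)) = f m"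
    using linear_generalized_inverse[OF field_K MM NM fl] by blast
  define e where "e n = n \<ominus>\<^bsub>N\<^esub> f (s n)" for n
  have e: "e \<in> module_hom K N N"
    using module_hom_diff[OF NM NM module_hom_id module_hom_comp[OF s(1) fl]] by (simp add: e_def[abs_def])
  have ef: "e (f m) = \<zero>\<^bsub>N\<^esub>" if "m \<in> carrier M" for m
    using that s(2) comodule_hom_closed[OF f that] by (simp add: e_def minus_eq_zero_iff[OF NM])
  have e0: "e \<zero>\<^bsub>N\<^esub> = \<zero>\<^bsub>N\<^esub>" by (rule module_hom_zero[OF NM NM e])
  have "\<exists>h\<in>module_hom K L N. \<forall>i\<in>UNIV. \<forall>m\<in>carrier (F i). h (\<gamma> i m) = (if i then e else (\<lambda>_. \<zero>\<^bsub>N\<^esub>)) m"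
    by (rule colimit_comodule_lift[OF colim NM]) (use e ef e0 in \<open>auto simp: F_def E_def module_hom_const_zero[OF NM]\<close>)
  then obtain h where h: "h \<in> module_hom K L N" "\<And>n. n \<in> carrier N \<Longrightarrow> h (\<gamma> True n) = e n"
    by (auto simp: F)
  have "{n \<in> carrier N. q n = \<zero>\<^bsub>L\<^esub>} = f ` carrier M"
  proof (intro equalityI subsetI)
    fix n assume "n \<in> {n \<in> carrier N. q n = \<zero>\<^bsub>L\<^esub>}"
    then have n: "n \<in> carrier N" "\<gamma> True n = \<zero>\<^bsub>L\<^esub>" by (auto simp: q_def)
    then have "e n = \<zero>\<^bsub>N\<^esub>" using h(2)[OF n(1)] module_hom_zero[OF LM NM h(1)] by simp
    then have "n = f (s n)"
      using n module_hom_closed[OF s(1)] comodule_hom_closed[OF f] by (simp add: e_def minus_eq_zero_iff[OF NM])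
    then show "n \<in> f ` carrier M" using module_hom_closed[OF s(1) n(1)] by (rule image_eqI)
  next
    fix n assume "n \<in> f ` carrier M"
    then show "n \<in> {n \<in> carrier N. q n = \<zero>\<^bsub>L\<^esub>}"
      using comodule_hom_closed[OF f] \<gamma>f \<gamma>0 by (auto simp: q_def)
  qed
  with L q surj show thesis by (rule that)
qed

lemma cokernel_iff:
  fixes c :: "('k, 'a, 'm::infinite) comodule"
  assumes M: "X_comodule K A X M" and N: "X_comodule K A X N" and f: "f \<in> comodule_hom K A M N"
  shows "is_cokernel (ModGX K A X) M N f c q \<longleftrightarrow> X_comodule K A X c \<and> q \<in> comodule_hom K A N c \<and>
    q ` carrier N = carrier c \<and> {n \<in> carrier N. q n = \<zero>\<^bsub>c\<^esub>} = f ` carrier M"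
proof
  assume cok: "is_cokernel (ModGX K A X) M N f c q"
  then have c: "X_comodule K A X c" and q: "q \<in> comodule_hom K A N c"
    and qf: "compose (carrier M) q f = (\<lambda>m\<in>carrier M. \<zero>\<^bsub>c\<^esub>)"
    and univ: "\<And>w g. X_comodule K A X w \<Longrightarrow> g \<in> comodule_hom K A N w \<Longrightarrow>
      compose (carrier M) g f = (\<lambda>m\<in>carrier M. \<zero>\<^bsub>w\<^esub>) \<Longrightarrow> \<exists>!u. u \<in> comodule_hom K A c w \<and> compose (carrier N) u q = g"
    by (simp_all add: is_cokernel_def)
  note c' = X_comodule_precomodule[OF c]
  obtain l and r :: "'m \<Rightarrow> 'm" where l: "X_comodule K A X l" "r \<in> comodule_hom K A N l" "r ` carrier N = carrier l"
    "{n \<in> carrier N. r n = \<zero>\<^bsub>l\<^esub>} = f ` carrier M"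
    using cokernel_exists[OF M N f] by blast
  note l' = X_comodule_precomodule[OF l(1)]
  have "r (f x) = \<zero>\<^bsub>l\<^esub>" if "x \<in> carrier M" for x using l(4) that by blast
  then have rf: "compose (carrier M) r f = (\<lambda>m\<in>carrier M. \<zero>\<^bsub>l\<^esub>)" by (auto simp: compose_def)
  have "\<exists>u. u \<in> comodule_hom K A l c \<and> compose (carrier N) u r = q"
    using cokernelI[OF M N f l] c q qf unfolding is_cokernel_def ModGX_simps by blast
  then obtain v where v: "v \<in> comodule_hom K A l c" "compose (carrier N) v r = q" by blast
  obtain u where u: "u \<in> comodule_hom K A c l" "compose (carrier N) u q = r" using univ[OF l(1,2) rf] by blast
  have vr: "v (r x) = q x" if "x \<in> carrier N" for x using fun_cong[OF v(2), of x] that by (simp add: compose_def)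
  have uq: "u (q x) = r x" if "x \<in> carrier N" for x using fun_cong[OF u(2), of x] that by (simp add: compose_def)
  have id: "restrict id (carrier c) \<in> comodule_hom K A c c" by (rule comodule_hom_restrict[OF c' c' colinear_id[OF c']])
  have "compose (carrier c) v u = restrict id (carrier c)"
  proof (rule ex1_unique)
    show "\<exists>!u. u \<in> comodule_hom K A c c \<and> compose (carrier N) u q = q" by (rule univ[OF c q qf])
    show "compose (carrier c) v u \<in> comodule_hom K A c c \<and> compose (carrier N) (compose (carrier c) v u) q = q"
      using comodule_hom_compose[OF c' l' c' u(1) v(1)] q comodule_hom_closed[OF q] vr uq
      by (auto simp: compose_def comodule_hom_iff extensional_def fun_eq_iff)
    show "restrict id (carrier c) \<in> comodule_hom K A c c \<and> compose (carrier N) (restrict id (carrier c)) q = q"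
      using id q comodule_hom_closed[OF q] by (auto simp: compose_def comodule_hom_iff extensional_def fun_eq_iff)
  qed
  then have vu: "v (u x) = x" if "x \<in> carrier c" for x using that by (auto simp: compose_def dest: fun_cong[of _ _ x])
  have surj: "q ` carrier N = carrier c"
  proof
    show "q ` carrier N \<subseteq> carrier c" using comodule_hom_closed[OF q] by blast
    show "carrier c \<subseteq> q ` carrier N"
    proof
      fix x assume x: "x \<in> carrier c"
      then obtain n where n: "n \<in> carrier N" "u x = r n" using l(3) comodule_hom_closed[OF u(1) x] by blast
      then have "x = q n" using vu[OF x] vr by simp
      then show "x \<in> q ` carrier N" using n by blast
    qed
  qed
  have "v \<zero>\<^bsub>l\<^esub> = \<zero>\<^bsub>c\<^esub>" "u \<zero>\<^bsub>c\<^esub> = \<zero>\<^bsub>l\<^esub>"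
    using module_hom_zero precomodule_module[OF l'] precomodule_module[OF c'] comodule_hom_linear[OF v(1)] comodule_hom_linear[OF u(1)] by blast+
  then have "q n = \<zero>\<^bsub>c\<^esub> \<longleftrightarrow> r n = \<zero>\<^bsub>l\<^esub>" if "n \<in> carrier N" for n using vr uq that by metis
  then have "{n \<in> carrier N. q n = \<zero>\<^bsub>c\<^esub>} = f ` carrier M" using l(4) by blast
  then show "X_comodule K A X c \<and> q \<in> comodule_hom K A N c \<and>
    q ` carrier N = carrier c \<and> {n \<in> carrier N. q n = \<zero>\<^bsub>c\<^esub>} = f ` carrier M" using c q surj by blast
next
  assume "X_comodule K A X c \<and> q \<in> comodule_hom K A N c \<and>
    q ` carrier N = carrier c \<and> {n \<in> carrier N. q n = \<zero>\<^bsub>c\<^esub>} = f ` carrier M"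
  then show "is_cokernel (ModGX K A X) M N f c q" using cokernelI[OF M N f] by blast
qed

end

section \<open>The category of \<open>X\<close>-comodules is abelian\<close>

context affine_group_scheme_subspace
begin

lemma
  fixes L P :: "('k, 'a, 'm) comodule"
  assumes L: "X_comodule K A X L" and P: "precomodule K A P" and F: "\<And>i. i \<in> I \<Longrightarrow> X_comodule K A X (F i)"
    and colim: "colimit_comodule K A I F E L \<gamma>"
  shows colimit_comodule_hom_exists: "(\<And>i. i \<in> I \<Longrightarrow> colinear K A (F i) P (\<delta> i)) \<Longrightarrow>
      (\<And>i j u m. (i, j, u) \<in> E \<Longrightarrow> m \<in> carrier (F i) \<Longrightarrow> \<delta> j (u m) = \<delta> i m) \<Longrightarrow>
      \<exists>h\<in>comodule_hom K A L P. \<forall>i\<in>I. \<forall>m\<in>carrier (F i). h (\<gamma> i m) = \<delta> i m"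
    and colimit_comodule_hom_unique: "g \<in> comodule_hom K A L P \<Longrightarrow> h \<in> comodule_hom K A L P \<Longrightarrow>
      (\<And>i m. i \<in> I \<Longrightarrow> m \<in> carrier (F i) \<Longrightarrow> g (\<gamma> i m) = h (\<gamma> i m)) \<Longrightarrow> g = h"
proof -
  note L' = X_comodule_precomodule[OF L]
  note LM = precomodule_module[OF L'] and PM = precomodule_module[OF P]
  note \<gamma> = colimit_comodule_colinear[OF colim] and span = colimit_comodule_span[OF colim]
  have F': "precomodule K A (F i)" if "i \<in> I" for i by (rule X_comodule_precomodule[OF F[OF that]])
  have \<gamma>c: "\<gamma> i m \<in> carrier L" if "i \<in> I" "m \<in> carrier (F i)" for i m
    by (rule module_hom_closed[OF colinear_linear[OF \<gamma>[OF that(1)]] that(2)])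
  show "\<exists>h\<in>comodule_hom K A L P. \<forall>i\<in>I. \<forall>m\<in>carrier (F i). h (\<gamma> i m) = \<delta> i m"
    if \<delta>: "\<And>i. i \<in> I \<Longrightarrow> colinear K A (F i) P (\<delta> i)"
      and arr: "\<And>i j u m. (i, j, u) \<in> E \<Longrightarrow> m \<in> carrier (F i) \<Longrightarrow> \<delta> j (u m) = \<delta> i m"
  proof -
    have "\<exists>h\<in>module_hom K L P. \<forall>i\<in>I. \<forall>m\<in>carrier (F i). h (\<gamma> i m) = \<delta> i m"
      using colinear_linear[OF \<delta>] arr by (rule colimit_comodule_lift[OF colim PM])
    then obtain h where h: "h \<in> module_hom K L P" "\<And>i m. i \<in> I \<Longrightarrow> m \<in> carrier (F i) \<Longrightarrow> h (\<gamma> i m) = \<delta> i m"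
      by blast
    have h\<gamma>: "colinear K A (F i) P (\<lambda>m. h (\<gamma> i m))" if "i \<in> I" for i
      by (rule colinear_cong[OF F'[OF that] PM \<delta>[OF that]]) (simp add: h(2)[OF that])
    have "colinear K A L P h"
      by (rule colinear_through_generators[OF L' P h(1) F' \<gamma> span h\<gamma>])
    then have "restrict h (carrier L) \<in> comodule_hom K A L P" by (rule comodule_hom_restrict[OF L' P])
    then show ?thesis by (rule rev_bexI) (simp add: \<gamma>c h(2))
  qed
  show "g = h" if g: "g \<in> comodule_hom K A L P" and h: "h \<in> comodule_hom K A L P"
    and eq: "\<And>i m. i \<in> I \<Longrightarrow> m \<in> carrier (F i) \<Longrightarrow> g (\<gamma> i m) = h (\<gamma> i m)"
  proof (rule comodule_hom_eqI[OF g h])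
    have "carrier L \<subseteq> {x \<in> carrier L. g x = h x}"
      by (rule jointly_spanningD[OF span module_hom_equalizer[OF LM PM comodule_hom_linear[OF g] comodule_hom_linear[OF h]]])
         (auto simp: eq \<gamma>c)
    then show "g m = h m" if "m \<in> carrier L" for m using that by blast
  qed
qed

text \<open>The zero object is the colimit of the empty diagram.\<close>

lemma ModGX_zero_object: "\<exists>z. is_zero_object (ModGX K A X :: ('k, 'a, 'm::infinite) comodule_category) z"
proof -
  have "cring K" ..
  define F :: "bool \<Rightarrow> ('k, 'a, 'm) comodule" where "F = undefined"
  have D: "linear_diagram K {} F {}" using \<open>cring K\<close> by (simp add: linear_diagram_def)
  let ?V = "colim_module K {} F {}"
  interpret V: module K ?V by (rule colim_module_module[OF D])
  have "carrier ?V \<subseteq> {\<zero>\<^bsub>?V\<^esub>}"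
    by (rule colim_span[OF D]) (auto simp: submodule_iff[OF V.module_axioms])
  then have "carrier ?V \<subseteq> range (\<lambda>(x :: 'm, y :: 'm). \<zero>\<^bsub>?V\<^esub>)" by force
  then obtain s :: "_ \<Rightarrow> 'm" where s: "inj_on s (carrier ?V)" by (rule injection_into_infinite_type)
  obtain L :: "('k, 'a, 'm) comodule" and \<gamma> where L: "X_comodule K A X L"
    and colim: "colimit_comodule K A {} F {} L \<gamma>"
    by (rule small_colimit[OF _ _ s]) blast+
  note L' = X_comodule_precomodule[OF L] and LM = precomodule_module[OF X_comodule_precomodule[OF L]]
  interpret L: module K L by (rule LM)
  have L0: "x = \<zero>\<^bsub>L\<^esub>" if "x \<in> carrier L" for x
    using jointly_spanningD[OF colimit_comodule_span[OF colim], of "{\<zero>\<^bsub>L\<^esub>}"] that by (auto simp: submodule_iff[OF LM])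
  have "is_zero_object (ModGX K A X) L"
    unfolding is_zero_object_def ModGX_simps
  proof (intro conjI ballI; (unfold mem_Collect_eq)?)
    show "X_comodule K A X L" by fact
    fix M :: "('k, 'a, 'm) comodule" assume "X_comodule K A X M"
    then have M': "precomodule K A M" by (rule X_comodule_precomodule)
    show "\<exists>!f. f \<in> comodule_hom K A M L"
    proof (rule ex1I)
      show z: "(\<lambda>m\<in>carrier M. \<zero>\<^bsub>L\<^esub>) \<in> comodule_hom K A M L"
        by (rule comodule_hom_restrict[OF M' L' colinear_zero[OF M' L']])
      fix f assume f: "f \<in> comodule_hom K A M L"
      show "f = (\<lambda>m\<in>carrier M. \<zero>\<^bsub>L\<^esub>)"
        by (rule comodule_hom_eqI[OF f z]) (simp add: L0 comodule_hom_closed[OF f])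
    qed
    show "\<exists>!f. f \<in> comodule_hom K A L M"
    proof (rule ex1I)
      show z: "(\<lambda>m\<in>carrier L. \<zero>\<^bsub>M\<^esub>) \<in> comodule_hom K A L M"
        by (rule comodule_hom_restrict[OF L' M' colinear_zero[OF L' M']])
      fix f assume f: "f \<in> comodule_hom K A L M"
      show "f = (\<lambda>m\<in>carrier L. \<zero>\<^bsub>M\<^esub>)"
      proof (rule comodule_hom_eqI[OF f z])
        fix m assume "m \<in> carrier L"
        then show "f m = (\<lambda>m\<in>carrier L. \<zero>\<^bsub>M\<^esub>) m"
          using module_hom_zero[OF LM precomodule_module[OF M'] comodule_hom_linear[OF f]] L0[of m] by simp
      qed
    qed
  qed
  then show ?thesis by blast
qed

text \<open>The biproduct is the colimit of the diagram without arrows on the two objects.  Its projections come from the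
universal property, and the identities between them and the injections are checked on the two summands.\<close>

lemma ModGX_biproduct:
  fixes M N :: "('k, 'a, 'm::infinite) comodule"
  assumes M: "X_comodule K A X M" and N: "X_comodule K A X N"
  shows "\<exists>s i\<^sub>1 i\<^sub>2 p\<^sub>1 p\<^sub>2. is_biproduct (ModGX K A X) M N s i\<^sub>1 i\<^sub>2 p\<^sub>1 p\<^sub>2"
proof -
  note M' = X_comodule_precomodule[OF M] and N' = X_comodule_precomodule[OF N]
  note MM = precomodule_module[OF M'] and NM = precomodule_module[OF N']
  interpret N: module K N by (rule NM)
  interpret M: module K M by (rule MM)
  define F where "F b = (if b then M else N)" for b :: bool
  have F: "F True = M" "F False = N" by (simp_all add: F_def)
  have FX: "X_comodule K A X (F b)" for b using M N by (simp add: F_def)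
  have "cring K" ..
  then have D: "linear_diagram K UNIV F {}"
    using precomodule_module[OF X_comodule_precomodule[OF FX]] unfolding linear_diagram_def by blast
  let ?V = "colim_module K UNIV F {}" and ?c = "colim_in K UNIV F {}"
  note Vm = colim_module_module[OF D]
  interpret V: module K ?V by (rule Vm)
  have cM: "?c True \<in> module_hom K M ?V" and cN: "?c False \<in> module_hom K N ?V"
    using colim_in_linear[OF D, of True] colim_in_linear[OF D, of False] by (simp_all add: F)
  let ?W = "{v \<oplus>\<^bsub>?V\<^esub> w | v w. v \<in> ?c True ` carrier M \<and> w \<in> ?c False ` carrier N}"
  have sub: "submodule (?c True ` carrier M) K ?V" "submodule (?c False ` carrier N) K ?V"
    using module_hom_image[OF MM Vm cM M.carrier_is_submodule] module_hom_image[OF NM Vm cN N.carrier_is_submodule] by auto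
  have "carrier ?V \<subseteq> ?W"
  proof (rule colim_span[OF D submodule_sum(1)[OF Vm sub]])
    show "?c b ` carrier (F b) \<subseteq> ?W" for b
      using submodule_sum(2,3)[OF Vm sub] by (cases b) (simp_all add: F)
  qed
  then have "carrier ?V \<subseteq> range (\<lambda>(x :: 'm, y :: 'm). ?c True x \<oplus>\<^bsub>?V\<^esub> ?c False y)" by force
  then obtain s :: "_ \<Rightarrow> 'm" where s: "inj_on s (carrier ?V)" by (rule injection_into_infinite_type)
  obtain L :: "('k, 'a, 'm) comodule" and \<gamma> where L: "X_comodule K A X L"
    and colim: "colimit_comodule K A UNIV F {} L \<gamma>"
    by (rule small_colimit[OF FX _ s]) blast+
  note \<gamma> = colimit_comodule_colinear[OF colim]
  note L' = X_comodule_precomodule[OF L]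
  note LM = precomodule_module[OF L']
  interpret L: module K L by (rule LM)
  have \<gamma>M: "colinear K A M L (\<gamma> True)" and \<gamma>N: "colinear K A N L (\<gamma> False)"
    using \<gamma>[of True] \<gamma>[of False] by (simp_all add: F)
  note \<gamma>Mc = module_hom_closed[OF colinear_linear[OF \<gamma>M]] and \<gamma>Nc = module_hom_closed[OF colinear_linear[OF \<gamma>N]]
  have proj: "\<exists>p\<in>comodule_hom K A L P. (\<forall>m\<in>carrier M. p (\<gamma> True m) = d m) \<and> (\<forall>n\<in>carrier N. p (\<gamma> False n) = e n)"
    if P: "precomodule K A P" and d: "colinear K A M P d" and e: "colinear K A N P e" for P :: "('k, 'a, 'm) comodule" and d e
  proof -
    let ?\<delta> = "\<lambda>b. if b then d else e"
    have de: "colinear K A (F b) P (?\<delta> b)" for b using d e by (simp add: F_def)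
    have "\<exists>p\<in>comodule_hom K A L P. \<forall>b\<in>UNIV. \<forall>m\<in>carrier (F b). p (\<gamma> b m) = ?\<delta> b m"
      by (rule colimit_comodule_hom_exists[OF L P FX colim]) (rule de, simp)
    then obtain p where p: "p \<in> comodule_hom K A L P" "\<And>b m. m \<in> carrier (F b) \<Longrightarrow> p (\<gamma> b m) = ?\<delta> b m"
      by blast
    show ?thesis by (rule bexI[OF _ p(1)]) (use p(2)[of _ True] p(2)[of _ False] in \<open>simp add: F\<close>)
  qed
  obtain p where p: "p \<in> comodule_hom K A L M" "\<And>m. m \<in> carrier M \<Longrightarrow> p (\<gamma> True m) = m"
    "\<And>n. n \<in> carrier N \<Longrightarrow> p (\<gamma> False n) = \<zero>\<^bsub>M\<^esub>"
    using proj[OF M' colinear_id[OF M'] colinear_zero[OF N' M']] by auto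
  obtain q where q: "q \<in> comodule_hom K A L N" "\<And>m. m \<in> carrier M \<Longrightarrow> q (\<gamma> True m) = \<zero>\<^bsub>N\<^esub>"
    "\<And>n. n \<in> carrier N \<Longrightarrow> q (\<gamma> False n) = n"
    using proj[OF N' colinear_zero[OF M' N'] colinear_id[OF N']] by auto
  define i where "i = restrict (\<gamma> True) (carrier M)"
  define j where "j = restrict (\<gamma> False) (carrier N)"
  have i: "i \<in> comodule_hom K A M L" unfolding i_def by (rule comodule_hom_restrict[OF M' L' \<gamma>M])
  have j: "j \<in> comodule_hom K A N L" unfolding j_def by (rule comodule_hom_restrict[OF N' L' \<gamma>N])
  let ?e = "\<lambda>x\<in>carrier L. compose (carrier L) i p x \<oplus>\<^bsub>L\<^esub> compose (carrier L) j q x"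
  have e: "?e \<in> comodule_hom K A L L"
    by (intro comodule_hom_restrict L' colinear_sum comodule_hom_colinear comodule_hom_compose[OF L' M' L' p(1) i]
        comodule_hom_compose[OF L' N' L' q(1) j])
  have id: "restrict id (carrier L) \<in> comodule_hom K A L L" by (rule comodule_hom_restrict[OF L' L' colinear_id[OF L']])
  have "?e = restrict id (carrier L)"
  proof (rule colimit_comodule_hom_unique[OF L L' FX colim e id])
    fix b m assume "b \<in> UNIV" "m \<in> carrier (F b)"
    then show "?e (\<gamma> b m) = restrict id (carrier L) (\<gamma> b m)"
      using module_hom_zero[OF MM LM colinear_linear[OF \<gamma>M]] module_hom_zero[OF NM LM colinear_linear[OF \<gamma>N]]
      by (cases b) (simp_all add: F compose_def i_def j_def p q \<gamma>Mc \<gamma>Nc)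
  qed
  then have "is_biproduct (ModGX K A X) M N L i j p q"
    unfolding is_biproduct_def ModGX_simps
    using L i j p q \<gamma>Mc \<gamma>Nc by (simp add: compose_def i_def j_def fun_eq_iff)
  then show ?thesis by blast
qed

lemma ModGX_abelian: "abelian_category (ModGX K A X :: ('k, 'a, 'm::infinite) comodule_category)"
proof -
  let ?C = "ModGX K A X :: ('k, 'a, 'm) comodule_category"
  have add: "additive_category ?C"
    unfolding additive_category_def
    by (intro conjI ballI ModGX_preadditive ModGX_zero_object ModGX_biproduct) simp_all
  have "(\<exists>k i. is_kernel ?C M N f k i) \<and> (\<exists>c q. is_cokernel ?C M N f c q) \<and>
      (is_monic ?C M N f \<longrightarrow> (\<exists>z\<in>Obj ?C. \<exists>g\<in>Hom ?C N z. is_kernel ?C N z g M f)) \<and>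
      (is_epic ?C M N f \<longrightarrow> (\<exists>w\<in>Obj ?C. \<exists>g\<in>Hom ?C w M. is_cokernel ?C w M g N f))"
    if "M \<in> Obj ?C" "N \<in> Obj ?C" "f \<in> Hom ?C M N" for M N f
  proof -
    have M: "X_comodule K A X M" and N: "X_comodule K A X N" and f: "f \<in> comodule_hom K A M N"
      using that by simp_all
    note M' = X_comodule_precomodule[OF M] and N' = X_comodule_precomodule[OF N] and fl = comodule_hom_linear[OF f]
    note MM = precomodule_module[OF M'] and NM = precomodule_module[OF N']
    interpret M: module K M by (rule MM)
    obtain k i where k: "X_comodule K A X k" "i \<in> comodule_hom K A k M" "inj_on i (carrier k)"
      "i ` carrier k = {m \<in> carrier M. f m = \<zero>\<^bsub>N\<^esub>}" by (rule kernel_exists[OF M N f])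
    obtain c q where c: "X_comodule K A X c" "q \<in> comodule_hom K A N c" "q ` carrier N = carrier c"
      "{n \<in> carrier N. q n = \<zero>\<^bsub>c\<^esub>} = f ` carrier M" by (rule cokernel_exists[OF M N f])
    note k' = X_comodule_precomodule[OF k(1)] and c' = X_comodule_precomodule[OF c(1)]
    \<comment> \<open>A monomorphism has zero kernel, hence is injective, hence is a kernel of its cokernel.\<close>
    have "is_kernel ?C N c q M f" if mono: "is_monic ?C M N f"
    proof -
      have z: "(\<lambda>x\<in>carrier k. \<zero>\<^bsub>M\<^esub>) \<in> comodule_hom K A k M"
        by (rule comodule_hom_restrict[OF k' M' colinear_zero[OF k' M']])
      have "f (i x) = \<zero>\<^bsub>N\<^esub>" if "x \<in> carrier k" for x using k(4) that by blast
      then have "compose (carrier k) f i = compose (carrier k) f (\<lambda>x\<in>carrier k. \<zero>\<^bsub>M\<^esub>)"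
        using module_hom_zero[OF MM NM fl] by (auto simp: compose_def)
      then have "i = (\<lambda>x\<in>carrier k. \<zero>\<^bsub>M\<^esub>)"
        using mono k(1,2) z by (simp add: is_monic_def)
      then have ker0: "i x = \<zero>\<^bsub>M\<^esub>" if "x \<in> carrier k" for x using that by simp
      have "inj_on f (carrier M)"
      proof (rule inj_onI)
        fix x y assume x: "x \<in> carrier M" "y \<in> carrier M" "f x = f y"
        then have "f (x \<ominus>\<^bsub>M\<^esub> y) = \<zero>\<^bsub>N\<^esub>"
          using comodule_hom_closed[OF f] by (simp add: module_hom_minus[OF MM NM fl] minus_eq_zero_iff[OF NM])
        then have "x \<ominus>\<^bsub>M\<^esub> y \<in> i ` carrier k" unfolding k(4) using x by simp
        then have "x \<ominus>\<^bsub>M\<^esub> y = \<zero>\<^bsub>M\<^esub>" using ker0 by auto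
        then show "x = y" using x by (simp add: minus_eq_zero_iff[OF MM])
      qed
      then show ?thesis using kernelI[OF N c(1,2) M f] c(4) by simp
    qed
    \<comment> \<open>Dually, an epimorphism has zero cokernel, hence is surjective, hence is a cokernel of its kernel.\<close>
    moreover have "is_cokernel ?C k M i N f" if epi: "is_epic ?C M N f"
    proof -
      have z: "(\<lambda>x\<in>carrier N. \<zero>\<^bsub>c\<^esub>) \<in> comodule_hom K A N c"
        by (rule comodule_hom_restrict[OF N' c' colinear_zero[OF N' c']])
      have "q (f x) = \<zero>\<^bsub>c\<^esub>" if "x \<in> carrier M" for x using c(4) that by blast
      then have "compose (carrier M) q f = compose (carrier M) (\<lambda>x\<in>carrier N. \<zero>\<^bsub>c\<^esub>) f"
        using comodule_hom_closed[OF f] by (auto simp: compose_def)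
      then have q0: "q = (\<lambda>x\<in>carrier N. \<zero>\<^bsub>c\<^esub>)"
        using epi c(1,2) z by (simp add: is_epic_def)
      have "f ` carrier M = carrier N" unfolding c(4)[symmetric] by (auto simp: q0)
      then show ?thesis using cokernelI[OF k(1) M k(2) N f] k(4) by simp
    qed
    ultimately show ?thesis
      using kernelI[OF M N f k] cokernelI[OF M N f c] k(1,2) c(1,2) by (simp (no_asm_simp)) blast
  qed
  then show ?thesis unfolding abelian_category_def using add by blast
qed

section \<open>Filtered colimits\<close>

text \<open>In a filtered colimit every element comes from a single \<open>D i\<close>: a sum of elements from \<open>D i\<close> and \<open>D j\<close>
is represented in any \<open>D k\<close> to which both map.  So pairs of an index and an element parametrise the colimit.\<close>

lemma filtered_colimit_small:
  fixes J :: "('m::infinite, 'm) category" and D :: "('m, 'm, ('k, 'a, 'm) comodule, 'm \<Rightarrow> 'm) cat_functor"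
  assumes J: "filtered_category J"
    and diag: "linear_diagram K (Obj J) (fobj D) E"
    and E: "E = {(i, j, fmap D i j u) | i j u. i \<in> Obj J \<and> j \<in> Obj J \<and> u \<in> Hom J i j}"
  obtains s :: "_ \<Rightarrow> 'm" where "inj_on s (carrier (colim_module K (Obj J) (fobj D) E))"
proof -
  let ?V = "colim_module K (Obj J) (fobj D) E" and ?c = "colim_in K (Obj J) (fobj D) E"
  note Vm = colim_module_module[OF diag]
  interpret V: module K ?V by (rule Vm)
  have Dm: "module K (fobj D i)" if "i \<in> Obj J" for i using diag that by (simp add: linear_diagram_def)
  have Dl: "fmap D i j u \<in> module_hom K (fobj D i) (fobj D j)" if "i \<in> Obj J" "j \<in> Obj J" "u \<in> Hom J i j" for i j u
    using diag that unfolding linear_diagram_def E by blast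
  have arr: "?c j (fmap D i j u m) = ?c i m" if "i \<in> Obj J" "j \<in> Obj J" "u \<in> Hom J i j" "m \<in> carrier (fobj D i)" for i j u m
    by (rule colim_in_arrow[OF diag _ that(4)]) (use that in \<open>auto simp: E\<close>)
  note cl = colim_in_linear[OF diag]
  let ?W = "{?c i m | i m. i \<in> Obj J \<and> m \<in> carrier (fobj D i)}"
  have "carrier ?V \<subseteq> ?W"
  proof (rule colim_span[OF diag])
    show "submodule ?W K ?V"
      unfolding submodule_iff[OF Vm]
    proof (intro conjI ballI)
      show "?W \<subseteq> carrier ?V" using module_hom_closed[OF cl] by auto
      obtain i where i: "i \<in> Obj J" using J by (auto simp: filtered_category_def)
      interpret Di: module K "fobj D i" by (rule Dm[OF i])
      show "\<zero>\<^bsub>?V\<^esub> \<in> ?W"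
        unfolding module_hom_zero[OF Dm[OF i] Vm cl[OF i], symmetric] using i Di.zero_closed by blast
    next
      fix x y assume "x \<in> ?W" "y \<in> ?W"
      then obtain i m j n where *: "i \<in> Obj J" "m \<in> carrier (fobj D i)" "j \<in> Obj J" "n \<in> carrier (fobj D j)"
        "x = ?c i m" "y = ?c j n" by blast
      have "\<exists>k\<in>Obj J. Hom J i k \<noteq> {} \<and> Hom J j k \<noteq> {}" using J *(1,3) by (simp add: filtered_category_def)
      then obtain k u v where k: "k \<in> Obj J" "u \<in> Hom J i k" "v \<in> Hom J j k" by blast
      interpret Dk: module K "fobj D k" by (rule Dm[OF k(1)])
      let ?m = "fmap D i k u m" and ?n = "fmap D j k v n"
      have mn: "?m \<in> carrier (fobj D k)" "?n \<in> carrier (fobj D k)"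
        using * k by (auto intro: module_hom_closed[OF Dl])
      have "x \<oplus>\<^bsub>?V\<^esub> y = ?c k (?m \<oplus>\<^bsub>fobj D k\<^esub> ?n)"
        using * k mn by (simp add: arr module_hom_add[OF cl])
      then show "x \<oplus>\<^bsub>?V\<^esub> y \<in> ?W" using k(1) mn Dk.a_closed by blast
    next
      fix r x assume r: "r \<in> carrier K" and "x \<in> ?W"
      then obtain i m where *: "i \<in> Obj J" "m \<in> carrier (fobj D i)" "x = ?c i m" by blast
      interpret Di: module K "fobj D i" by (rule Dm[OF *(1)])
      have "r \<odot>\<^bsub>?V\<^esub> x = ?c i (r \<odot>\<^bsub>fobj D i\<^esub> m)" using r * by (simp add: module_hom_smult[OF cl])
      then show "r \<odot>\<^bsub>?V\<^esub> x \<in> ?W" using * r Di.smult_closed by blast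
    qed
    show "?c i ` carrier (fobj D i) \<subseteq> ?W" if "i \<in> Obj J" for i using that by blast
  qed
  then have "carrier ?V \<subseteq> range (\<lambda>(i, m). ?c i m)" by force
  then show thesis by (rule injection_into_infinite_type) (rule that)
qed

text \<open>The diagram lies in the \<open>X\<close>-comodules, but the universal property is needed in the larger category of
\<open>X'\<close>-comodules, which will be that of all comodules.\<close>

lemma filtered_colimit:
  fixes J :: "('m::infinite, 'm) category" and D :: "('m, 'm, ('k, 'a, 'm) comodule, 'm \<Rightarrow> 'm) cat_functor"
  assumes J: "filtered_category J" and D: "is_functor J (ModGX K A X) D" and X': "submodule X' K A" and XX': "X \<subseteq> X'"
  shows "\<exists>L \<gamma>. X_comodule K A X L \<and> is_colimit J (ModGX K A X') D L \<gamma>"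
proof -
  interpret Y: affine_group_scheme_subspace K A X' by (intro affine_group_scheme_subspace.intro affine_group_scheme_subspace_axioms.intro affine_group_scheme_axioms X')
  define E where "E = {(i, j, fmap D i j u) | i j u. i \<in> Obj J \<and> j \<in> Obj J \<and> u \<in> Hom J i j}"
  have DX: "X_comodule K A X (fobj D i)" if "i \<in> Obj J" for i using D that by (simp add: is_functor_def)
  have Dh: "fmap D i j u \<in> comodule_hom K A (fobj D i) (fobj D j)" if "i \<in> Obj J" "j \<in> Obj J" "u \<in> Hom J i j" for i j u
    using D that by (simp add: is_functor_def)
  have EX: "i \<in> Obj J \<and> j \<in> Obj J \<and> colinear K A (fobj D i) (fobj D j) u" if "(i, j, u) \<in> E" for i j u
    using that comodule_hom_colinear[OF Dh] by (auto simp: E_def)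
  have D': "precomodule K A (fobj D i)" if "i \<in> Obj J" for i by (rule X_comodule_precomodule[OF DX[OF that]])
  have "cring K" ..
  then have diag: "linear_diagram K (Obj J) (fobj D) E"
    using precomodule_module[OF D'] EX colinear_linear unfolding linear_diagram_def by fastforce
  obtain s :: "_ \<Rightarrow> 'm" where s: "inj_on s (carrier (colim_module K (Obj J) (fobj D) E))"
    by (rule filtered_colimit_small[OF J diag E_def])
  obtain L :: "('k, 'a, 'm) comodule" and \<gamma> where L: "X_comodule K A X L"
    and colim: "colimit_comodule K A (Obj J) (fobj D) E L \<gamma>"
    by (rule small_colimit[OF DX EX s]) blast+
  note \<gamma> = colimit_comodule_colinear[OF colim] and \<gamma>u = colimit_comodule_arrow[OF colim]
  note L' = X_comodule_precomodule[OF L]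
  have XY: "X_comodule K A X' M" if "X_comodule K A X M" for M :: "('k, 'a, 'm) comodule"
    using that tensor_image_mono[OF precomodule_module[OF X_comodule_precomodule[OF that]] A_module _ X_subspace _ X' _ XX']
      module.carrier_is_submodule[OF precomodule_module[OF X_comodule_precomodule[OF that]]]
    unfolding X_comodule_def by blast
  define \<gamma>' where "\<gamma>' i = restrict (\<gamma> i) (carrier (fobj D i))" for i
  have \<gamma>': "\<gamma>' i \<in> comodule_hom K A (fobj D i) L" if "i \<in> Obj J" for i
    unfolding \<gamma>'_def by (rule comodule_hom_restrict[OF D'[OF that] L' \<gamma>[OF that]])
  have cocone: "is_cocone J (ModGX K A X') D L \<gamma>'"
    unfolding is_cocone_def ModGX_simps
  proof (intro conjI ballI; (unfold mem_Collect_eq)?)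
    show "X_comodule K A X' L" by (rule XY[OF L])
    show "\<gamma>' i \<in> comodule_hom K A (fobj D i) L" if "i \<in> Obj J" for i by (rule \<gamma>'[OF that])
    fix i j u assume ij: "i \<in> Obj J" "j \<in> Obj J" "u \<in> Hom J i j"
    then have "(i, j, fmap D i j u) \<in> E" by (auto simp: E_def)
    then show "compose (carrier (fobj D i)) (\<gamma>' j) (fmap D i j u) = \<gamma>' i"
      using comodule_hom_closed[OF Dh[OF ij]] \<gamma>u by (auto simp: compose_def \<gamma>'_def fun_eq_iff)
  qed
  moreover have "\<exists>!u. u \<in> comodule_hom K A L N \<and> (\<forall>i\<in>Obj J. compose (carrier (fobj D i)) u (\<gamma>' i) = \<delta> i)"
    if co: "is_cocone J (ModGX K A X') D N \<delta>" for N \<delta>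
  proof -
    have N: "X_comodule K A X' N" and \<delta>: "\<And>i. i \<in> Obj J \<Longrightarrow> \<delta> i \<in> comodule_hom K A (fobj D i) N"
      and \<delta>u: "\<And>i j u. i \<in> Obj J \<Longrightarrow> j \<in> Obj J \<Longrightarrow> u \<in> Hom J i j \<Longrightarrow> compose (carrier (fobj D i)) (\<delta> j) (fmap D i j u) = \<delta> i"
      using co by (auto simp: is_cocone_def)
    note N' = Y.X_comodule_precomodule[OF N]
    have \<delta>E: "\<delta> j (u m) = \<delta> i m" if u: "(i, j, u) \<in> E" and m: "m \<in> carrier (fobj D i)" for i j u m
    proof -
      obtain v where v: "i \<in> Obj J" "j \<in> Obj J" "v \<in> Hom J i j" "u = fmap D i j v" using u by (auto simp: E_def)
      show ?thesis using fun_cong[OF \<delta>u[OF v(1-3)], of m] m v(4) by (simp add: compose_def)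
    qed
    have "\<exists>h\<in>comodule_hom K A L N. \<forall>i\<in>Obj J. \<forall>m\<in>carrier (fobj D i). h (\<gamma> i m) = \<delta> i m"
      by (rule colimit_comodule_hom_exists[OF L N' DX colim])
         (assumption | erule (1) \<delta>E | rule comodule_hom_colinear, erule \<delta>)+
    then obtain h where h: "h \<in> comodule_hom K A L N" "\<And>i m. i \<in> Obj J \<Longrightarrow> m \<in> carrier (fobj D i) \<Longrightarrow> h (\<gamma> i m) = \<delta> i m"
      by blast
    show ?thesis
    proof (rule ex1I)
      show "h \<in> comodule_hom K A L N \<and> (\<forall>i\<in>Obj J. compose (carrier (fobj D i)) h (\<gamma>' i) = \<delta> i)"
        using h \<delta> by (auto simp: compose_def \<gamma>'_def comodule_hom_iff extensional_def fun_eq_iff)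
      fix g assume g: "g \<in> comodule_hom K A L N \<and> (\<forall>i\<in>Obj J. compose (carrier (fobj D i)) g (\<gamma>' i) = \<delta> i)"
      have g\<gamma>: "g (\<gamma> i m) = h (\<gamma> i m)" if im: "i \<in> Obj J" "m \<in> carrier (fobj D i)" for i m
      proof -
        have "compose (carrier (fobj D i)) g (\<gamma>' i) = \<delta> i" using g im by blast
        from fun_cong[OF this, of m] show ?thesis using im h(2)[OF im] by (simp add: compose_def \<gamma>'_def)
      qed
      show "g = h" by (rule colimit_comodule_hom_unique[OF L N' DX colim conjunct1[OF g] h(1) g\<gamma>])
    qed
  qed
  ultimately show ?thesis using L unfolding is_colimit_def ModGX_simps by blast
qed

text \<open>Any other colimit of the diagram is isomorphic to the one constructed above, and a surjective image of an
\<open>X\<close>-comodule is an \<open>X\<close>-comodule.\<close>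

lemma closed_under_filtered_colimits:
  fixes J :: "('m::infinite, 'm) category"
  assumes J: "filtered_category J" and X': "submodule X' K A" and XX': "X \<subseteq> X'"
  shows "closed_under_colimits_of J (ModGX K A X :: ('k, 'a, 'm) comodule_category) (ModGX K A X')"
  unfolding closed_under_colimits_of_def
proof (intro allI impI conjI)
  interpret Y: affine_group_scheme_subspace K A X' by (intro affine_group_scheme_subspace.intro affine_group_scheme_subspace_axioms.intro affine_group_scheme_axioms X')
  fix D :: "('m, 'm, ('k, 'a, 'm) comodule, 'm \<Rightarrow> 'm) cat_functor"
  assume D: "is_functor J (ModGX K A X) D"
  obtain L \<gamma> where L: "X_comodule K A X L" and colim: "is_colimit J (ModGX K A X') D L \<gamma>"
    using filtered_colimit[OF J D X' XX'] by blast
  then show "\<exists>L \<gamma>. is_colimit J (ModGX K A X') D L \<gamma>" by blast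
  fix M \<delta> assume M: "is_colimit J (ModGX K A X') D M \<delta>"
  have co: "is_cocone J (ModGX K A X') D L \<gamma>" "is_cocone J (ModGX K A X') D M \<delta>"
    and univ: "\<And>N \<epsilon>. is_cocone J (ModGX K A X') D N \<epsilon> \<Longrightarrow>
      \<exists>!u. u \<in> comodule_hom K A L N \<and> (\<forall>i\<in>Obj J. compose (carrier (fobj D i)) u (\<gamma> i) = \<epsilon> i)"
    and univ': "\<And>N \<epsilon>. is_cocone J (ModGX K A X') D N \<epsilon> \<Longrightarrow>
      \<exists>!u. u \<in> comodule_hom K A M N \<and> (\<forall>i\<in>Obj J. compose (carrier (fobj D i)) u (\<delta> i) = \<epsilon> i)"
    using colim M by (simp_all add: is_colimit_def)
  have MX: "X_comodule K A X' M" and \<delta>: "\<And>i. i \<in> Obj J \<Longrightarrow> \<delta> i \<in> comodule_hom K A (fobj D i) M"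
    using co(2) by (simp_all add: is_cocone_def)
  note L' = X_comodule_precomodule[OF L] and M' = Y.X_comodule_precomodule[OF MX]
  obtain u where u: "u \<in> comodule_hom K A L M" "\<And>i. i \<in> Obj J \<Longrightarrow> compose (carrier (fobj D i)) u (\<gamma> i) = \<delta> i"
    using univ[OF co(2)] by blast
  obtain v where v: "v \<in> comodule_hom K A M L" "\<And>i. i \<in> Obj J \<Longrightarrow> compose (carrier (fobj D i)) v (\<delta> i) = \<gamma> i"
    using univ'[OF co(1)] by blast
  have "compose (carrier M) u v = restrict id (carrier M)"
  proof (rule ex1_unique[OF univ'[OF co(2)]])
    have "u (v (\<delta> i x)) = \<delta> i x" if "i \<in> Obj J" "x \<in> carrier (fobj D i)" for i x
      using fun_cong[OF u(2)[OF that(1)], of x] fun_cong[OF v(2)[OF that(1)], of x] that(2) by (simp add: compose_def)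
    then have "compose (carrier (fobj D i)) (compose (carrier M) u v) (\<delta> i) = \<delta> i" if "i \<in> Obj J" for i
      using that comodule_hom_closed[OF \<delta>[OF that]] \<delta>[OF that]
      by (auto simp: compose_def comodule_hom_iff extensional_def fun_eq_iff)
    then show "compose (carrier M) u v \<in> comodule_hom K A M M \<and>
        (\<forall>i\<in>Obj J. compose (carrier (fobj D i)) (compose (carrier M) u v) (\<delta> i) = \<delta> i)"
      using comodule_hom_compose[OF M' L' M' v(1) u(1)] by blast
    have "compose (carrier (fobj D i)) (restrict id (carrier M)) (\<delta> i) = \<delta> i" if "i \<in> Obj J" for i
      using comodule_hom_closed[OF \<delta>[OF that]] \<delta>[OF that]
      by (auto simp: compose_def comodule_hom_iff extensional_def fun_eq_iff)
    then show "restrict id (carrier M) \<in> comodule_hom K A M M \<and>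
        (\<forall>i\<in>Obj J. compose (carrier (fobj D i)) (restrict id (carrier M)) (\<delta> i) = \<delta> i)"
      using comodule_hom_restrict[OF M' M' colinear_id[OF M']] by blast
  qed
  then have uv: "u (v x) = x" if "x \<in> carrier M" for x using that by (auto simp: compose_def dest: fun_cong[of _ _ x])
  have "u ` carrier L = carrier M"
  proof
    show "u ` carrier L \<subseteq> carrier M" using comodule_hom_closed[OF u(1)] by blast
    show "carrier M \<subseteq> u ` carrier L"
    proof
      fix x assume x: "x \<in> carrier M"
      show "x \<in> u ` carrier L" using imageI[OF comodule_hom_closed[OF v(1) x], of u] uv[OF x] by simp
    qed
  qed
  moreover have "is_comodule K A M" using MX by (simp add: X_comodule_def)
  ultimately show "M \<in> Obj (ModGX K A X)"
    using X_comodule_surjective_image[OF L _ comodule_hom_colinear[OF u(1)]] by simp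
qed

lemma X_comodule_is_comodule: "X_comodule K A X M \<Longrightarrow> is_comodule K A M"
  by (simp add: X_comodule_def)

section \<open>The functor \<open>M \<mapsto> M\<^sub>X\<close>\<close>

lemma X_part_X_comodule: "is_comodule K A M \<Longrightarrow> X_comodule K A X (X_part K A X M)"
  unfolding X_part_def by (intro X_comodule_restrict X_subcomodule_X_part)

lemma X_part_simps [simp]:
  "carrier (X_part K A X M) = X_part_carrier K A X M" "add (X_part K A X M) = add M" "zero (X_part K A X M) = zero M"
  by (simp_all add: X_part_def)

lemma X_part_inclusion: "is_comodule K A M \<Longrightarrow> colinear K A (X_part K A X M) M id"
  unfolding X_part_def
  by (intro restrict_comodule_inclusion X_subcomodule_coact comodule_precomodule X_subcomodule_X_part)

lemma X_part_subset: "is_comodule K A M \<Longrightarrow> X_part_carrier K A X M \<subseteq> carrier M"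
  using X_subcomodule_X_part[of M] precomodule_module[OF comodule_precomodule, of M]
  by (auto simp: X_subcomodule_def submodule_iff)

lemma colinear_into_X_part:
  assumes P: "precomodule K A P" and M: "is_comodule K A M" and f: "colinear K A P M f"
    and "f ` carrier P \<subseteq> X_part_carrier K A X M"
  shows "colinear K A P (X_part K A X M) f"
  unfolding X_part_def
  by (rule colinear_into_restriction[OF comodule_precomodule[OF M] X_subcomodule_coact[OF comodule_precomodule[OF M]
        X_subcomodule_X_part[OF M]] P f assms(4)])

lemma X_comodule_image_in_X_part:
  assumes M: "X_comodule K A X M" and N: "is_comodule K A N" and f: "colinear K A M N f"
  shows "f ` carrier M \<subseteq> X_part_carrier K A X N"
proof (rule X_subcomodule_le_X_part[OF N X_subcomodule_image[OF X_comodule_precomodule[OF M] comodule_precomodule[OF N] f]])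
  show "X_subcomodule K A X M (carrier M)" using M by (simp add: X_comodule_iff)
qed

text \<open>A colinear map from an \<open>X\<close>-comodule to \<open>N\<close> has image in \<open>N\<^sub>X\<close>.  So the two sets of arrows are equal as
sets of functions, and the bijection of the adjunction is the identity.\<close>

lemma comodule_hom_X_part_eq:
  assumes M: "X_comodule K A X M" and N: "is_comodule K A N"
  shows "comodule_hom K A M (X_part K A X N) = comodule_hom K A M N"
proof (intro equalityI subsetI)
  note M' = X_comodule_precomodule[OF M]
  fix f assume "f \<in> comodule_hom K A M N"
  then show "f \<in> comodule_hom K A M (X_part K A X N)"
    using colinear_into_X_part[OF M' N _ X_comodule_image_in_X_part[OF M N]] by (auto simp: comodule_hom_iff)
next
  note M' = X_comodule_precomodule[OF M]
  fix f assume "f \<in> comodule_hom K A M (X_part K A X N)"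
  then show "f \<in> comodule_hom K A M N"
    using colinear_comp[OF M' precomodule_module[OF X_comodule_precomodule[OF X_part_X_comodule[OF N]]]
        precomodule_module[OF comodule_precomodule[OF N]] _ X_part_inclusion[OF N], of f]
    by (simp add: comodule_hom_iff)
qed

lemma X_part_map:
  assumes M: "is_comodule K A M" and N: "is_comodule K A N" and f: "f \<in> comodule_hom K A M N"
  shows "restrict f (X_part_carrier K A X M) \<in> comodule_hom K A (X_part K A X M) (X_part K A X N)"
proof -
  note P = X_part_X_comodule[OF M]
  note P' = X_comodule_precomodule[OF P]
  have "colinear K A (X_part K A X M) N (\<lambda>m. f (id m))"
    by (rule colinear_comp[OF P' precomodule_module[OF comodule_precomodule[OF M]] precomodule_module[OF comodule_precomodule[OF N]]
          X_part_inclusion[OF M] comodule_hom_colinear[OF f]])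
  then have "restrict (\<lambda>m. f (id m)) (carrier (X_part K A X M)) \<in> comodule_hom K A (X_part K A X M) N"
    by (rule comodule_hom_restrict[OF P' comodule_precomodule[OF N]])
  then show ?thesis by (simp add: comodule_hom_X_part_eq[OF P N])
qed

end

text \<open>For \<open>X = A\<close> the results on \<open>X\<close>-comodules are results on all comodules.\<close>

lemma (in affine_group_scheme) all_coefficients:
  shows "affine_group_scheme_subspace K A (carrier A)" and "X_comodule K A (carrier A) M \<longleftrightarrow> is_comodule K A M"
    and "ModG K A = ModGX K A (carrier A)"
proof -
  show "affine_group_scheme_subspace K A (carrier A)"
    by (intro affine_group_scheme_subspace.intro affine_group_scheme_subspace_axioms.intro affine_group_scheme_axioms A_subspace)
  have iff: "X_comodule K A (carrier A) M \<longleftrightarrow> is_comodule K A M" for M :: "('k, 'a, 'n) comodule"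
    using tensor_image_carrier[OF _ A_module, of M] module_hom_closed[of "coact M" K M "tensor K M A"]
    by (auto simp: X_comodule_def is_comodule_def)
  show "X_comodule K A (carrier A) M \<longleftrightarrow> is_comodule K A M" by (rule iff)
  show "ModG K A = ModGX K A (carrier A)" by (simp add: ModGX_def iff) (simp add: ModG_def)
qed

context affine_group_scheme_subspace
begin

lemma X_part_is_functor:
  "is_functor (ModG K A :: ('k, 'a, 'm::infinite) comodule_category) (ModGX K A X) (X_part_functor K A X)"
proof -
  interpret Y: affine_group_scheme_subspace K A "carrier A" by (rule all_coefficients)
  show ?thesis
    unfolding is_functor_def all_coefficients(3) ModGX_simps X_part_functor_def cat_functor.simps
  proof (intro conjI ballI; (unfold mem_Collect_eq all_coefficients(2))?)
    show "is_category (ModGX K A (carrier A) :: ('k, 'a, 'm) comodule_category)"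
      "is_category (ModGX K A X :: ('k, 'a, 'm) comodule_category)"
      by (rule Y.ModGX_category ModGX_category)+
    fix M :: "('k, 'a, 'm) comodule" assume M: "is_comodule K A M"
    show "X_comodule K A X (X_part K A X M)" by (rule X_part_X_comodule[OF M])
    show "restrict (restrict id (carrier M)) (X_part_carrier K A X M) = restrict id (carrier (X_part K A X M))"
      using X_part_subset[OF M] by (auto simp: fun_eq_iff)
    fix N :: "('k, 'a, 'm) comodule" and f assume N: "is_comodule K A N" and f: "f \<in> comodule_hom K A M N"
    show "restrict f (X_part_carrier K A X M) \<in> comodule_hom K A (X_part K A X M) (X_part K A X N)"
      by (rule X_part_map[OF M N f])
    fix P :: "('k, 'a, 'm) comodule" and g assume "is_comodule K A P" "g \<in> comodule_hom K A N P"
    show "restrict (compose (carrier M) g f) (X_part_carrier K A X M) =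
        compose (carrier (X_part K A X M)) (restrict g (X_part_carrier K A X N)) (restrict f (X_part_carrier K A X M))"
      using X_part_subset[OF M] colinear_X_part[OF M N comodule_hom_colinear[OF f]]
      by (auto simp: compose_def fun_eq_iff)
  qed
qed

text \<open>By the description of kernels it has to be shown that every \<open>m \<in> M\<^sub>X\<close> with \<open>f m = 0\<close> comes from \<open>k\<^sub>X\<close>,
where \<open>i : k \<rightarrow> M\<close> is a kernel of \<open>f\<close>.  The kernel \<open>z\<close> of \<open>f\<close> on \<open>M\<^sub>X\<close> is an \<open>X\<close>-comodule, and
its map to \<open>M\<close> factors through \<open>k\<close>, hence through \<open>k\<^sub>X\<close>.\<close>

lemma X_part_left_exact:
  "left_exact (ModG K A :: ('k, 'a, 'm::infinite) comodule_category) (ModGX K A X) (X_part_functor K A X)"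
proof -
  interpret Y: affine_group_scheme_subspace K A "carrier A" by (rule all_coefficients)
  have "additive_functor (ModG K A :: ('k, 'a, 'm) comodule_category) (ModGX K A X) (X_part_functor K A X)"
    unfolding additive_functor_def
    using X_part_is_functor X_part_subset
    by (auto simp: all_coefficients(2,3) X_part_functor_def fun_eq_iff)
  moreover have "is_kernel (ModGX K A X) (X_part K A X M) (X_part K A X N) (restrict f (X_part_carrier K A X M))
      (X_part K A X k) (restrict i (X_part_carrier K A X k))"
    if MN: "is_comodule K A M" "is_comodule K A N" and f: "f \<in> comodule_hom K A M N"
      and ker: "is_kernel (ModGX K A (carrier A)) M N f k i" for M N k :: "('k, 'a, 'm) comodule" and f i
  proof -
    have kk: "is_comodule K A k" and i: "i \<in> comodule_hom K A k M" and inj: "inj_on i (carrier k)"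
      and image: "i ` carrier k = {m \<in> carrier M. f m = \<zero>\<^bsub>N\<^esub>}"
      using ker Y.kernel_iff[of M N f k i] MN f by (simp_all add: all_coefficients(2))
    note PM = X_part_X_comodule[OF MN(1)] and PN = X_part_X_comodule[OF MN(2)] and fX = X_part_map[OF MN f]
    show ?thesis
    proof (rule kernelI[OF PM PN fX X_part_X_comodule[OF kk] X_part_map[OF kk MN(1) i]])
      show "inj_on (restrict i (X_part_carrier K A X k)) (carrier (X_part K A X k))"
        using inj X_part_subset[OF kk] by (auto simp: inj_on_def)
      show "restrict i (X_part_carrier K A X k) ` carrier (X_part K A X k) =
        {m \<in> carrier (X_part K A X M). restrict f (X_part_carrier K A X M) m = \<zero>\<^bsub>X_part K A X N\<^esub>}"
      proof (intro equalityI subsetI)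
        fix m assume "m \<in> restrict i (X_part_carrier K A X k) ` carrier (X_part K A X k)"
        then obtain x where x: "x \<in> X_part_carrier K A X k" "m = i x" by auto
        then have "m \<in> X_part_carrier K A X M" using colinear_X_part[OF kk MN(1) comodule_hom_colinear[OF i]] by blast
        moreover have "m \<in> i ` carrier k" using x X_part_subset[OF kk] by blast
        then have "f m = \<zero>\<^bsub>N\<^esub>" by (simp add: image)
        ultimately show "m \<in> {m \<in> carrier (X_part K A X M). restrict f (X_part_carrier K A X M) m = \<zero>\<^bsub>X_part K A X N\<^esub>}"
          by simp
      next
        fix m assume m: "m \<in> {m \<in> carrier (X_part K A X M). restrict f (X_part_carrier K A X M) m = \<zero>\<^bsub>X_part K A X N\<^esub>}"
        obtain z j where z: "X_comodule K A X z" "j \<in> comodule_hom K A z (X_part K A X M)" "inj_on j (carrier z)"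
          "j ` carrier z = {m \<in> carrier (X_part K A X M). restrict f (X_part_carrier K A X M) m = \<zero>\<^bsub>X_part K A X N\<^esub>}"
          by (rule kernel_exists[OF PM PN fX])
        have zc: "is_comodule K A z" using z(1) by (simp add: X_comodule_def)
        have jM: "j \<in> comodule_hom K A z M" using z(2) by (simp add: comodule_hom_X_part_eq[OF z(1) MN(1)])
        have "f (j x) = \<zero>\<^bsub>N\<^esub>" if "x \<in> carrier z" for x
        proof -
          have "j x \<in> j ` carrier z" using that by blast
          then show ?thesis unfolding z(4) by (simp split: if_splits)
        qed
        then have "compose (carrier z) f j = (\<lambda>x\<in>carrier z. \<zero>\<^bsub>N\<^esub>)" by (auto simp: compose_def)
        then have "\<exists>u. u \<in> comodule_hom K A z k \<and> compose (carrier z) i u = j"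
          using ker zc jM unfolding is_kernel_def ModGX_simps mem_Collect_eq all_coefficients(2) by blast
        then obtain u where u: "u \<in> comodule_hom K A z k" "compose (carrier z) i u = j" by blast
        obtain x where x: "x \<in> carrier z" "m = j x" using m unfolding z(4)[symmetric] by blast
        have "u x \<in> X_part_carrier K A X k"
          using X_comodule_image_in_X_part[OF z(1) kk comodule_hom_colinear[OF u(1)]] x by blast
        moreover have "m = i (u x)" using fun_cong[OF u(2), of x] x by (simp add: compose_def)
        ultimately show "m \<in> restrict i (X_part_carrier K A X k) ` carrier (X_part K A X k)" by auto
      qed
    qed
  qed
  ultimately show ?thesis
    unfolding left_exact_def by (simp add: all_coefficients(2,3) X_part_functor_def)
qed

lemma inclusion_additive:
  "additive_functor (ModGX K A X :: ('k, 'a, 'm::infinite) comodule_category) (ModG K A) inclusion_functor"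
proof -
  interpret Y: affine_group_scheme_subspace K A "carrier A" by (rule all_coefficients)
  show ?thesis
    unfolding additive_functor_def is_functor_def inclusion_functor_def
    by (auto simp: ModGX_category Y.ModGX_category all_coefficients(2,3) intro: X_comodule_is_comodule)
qed

lemma X_part_right_adjoint:
  "right_adjoint (ModGX K A X :: ('k, 'a, 'm::infinite) comodule_category) (ModG K A)
     inclusion_functor (X_part_functor K A X)"
  unfolding right_adjoint_def
proof (intro conjI exI[where x = "\<lambda>x y h. h"] ballI)
  show "is_functor (ModGX K A X :: ('k, 'a, 'm) comodule_category) (ModG K A) inclusion_functor"
    using inclusion_additive unfolding additive_functor_def by blast
  show "is_functor (ModG K A :: ('k, 'a, 'm) comodule_category) (ModGX K A X) (X_part_functor K A X)"
    by (rule X_part_is_functor)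
next
  fix x y :: "('k, 'a, 'm) comodule" assume "x \<in> Obj (ModGX K A X)" "y \<in> Obj (ModG K A)"
  then show "bij_betw (\<lambda>h. h) (Hom (ModG K A) (fobj inclusion_functor x) y) (Hom (ModGX K A X) x (fobj (X_part_functor K A X) y))"
    by (simp add: inclusion_functor_def X_part_functor_def all_coefficients(2,3) comodule_hom_X_part_eq bij_betw_def)
next
  fix x x' y y' :: "('k, 'a, 'm) comodule" and u v h
  assume *: "x \<in> Obj (ModGX K A X)" "x' \<in> Obj (ModGX K A X)" "y \<in> Obj (ModG K A)" "y' \<in> Obj (ModG K A)"
    "u \<in> Hom (ModGX K A X) x' x" "v \<in> Hom (ModG K A) y y'" "h \<in> Hom (ModG K A) (fobj inclusion_functor x) y"
  then have "X_comodule K A X x" "is_comodule K A y" "u \<in> comodule_hom K A x' x" "h \<in> comodule_hom K A x y"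
    by (simp_all add: inclusion_functor_def all_coefficients(2,3))
  then have "h (u m) \<in> X_part_carrier K A X y" if "m \<in> carrier x'" for m
    using X_comodule_image_in_X_part[of x y h] comodule_hom_colinear[of h K A x y] comodule_hom_closed[of u K A x' x m] that by blast
  then show "Cmp (ModG K A) (fobj inclusion_functor x') y y' v
      (Cmp (ModG K A) (fobj inclusion_functor x') (fobj inclusion_functor x) y h (fmap inclusion_functor x' x u)) =
    Cmp (ModGX K A X) x' (fobj (X_part_functor K A X) y) (fobj (X_part_functor K A X) y') (fmap (X_part_functor K A X) y y' v)
      (Cmp (ModGX K A X) x' x (fobj (X_part_functor K A X) y) h u)"
    by (auto simp: inclusion_functor_def X_part_functor_def all_coefficients(3) compose_def fun_eq_iff)
qed

text \<open>Kernels and cokernels have the same elementwise description in both categories, so the inclusion preserves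
them.\<close>

lemma ModGX_abelian_subcategory:
  "abelian_subcategory (ModGX K A X :: ('k, 'a, 'm::infinite) comodule_category) (ModG K A)"
proof -
  interpret Y: affine_group_scheme_subspace K A "carrier A" by (rule all_coefficients)
  let ?S = "ModGX K A X :: ('k, 'a, 'm) comodule_category"
  note X = X_comodule_is_comodule
  have "full_subcategory ?S (ModG K A)"
    using X by (auto simp: full_subcategory_def all_coefficients(2,3)) (simp add: ModGX_def)
  moreover have "abelian_category (ModG K A :: ('k, 'a, 'm) comodule_category)"
    unfolding all_coefficients(3) by (rule Y.ModGX_abelian)
  moreover have "is_kernel (ModG K A) M N f k i"
    if "X_comodule K A X M" "X_comodule K A X N" "f \<in> comodule_hom K A M N" "is_kernel (ModGX K A X) M N f k i"
    for M N k :: "('k, 'a, 'm) comodule" and f i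
    using that(4) X[of k]
    unfolding kernel_iff[OF that(1-3)] all_coefficients(3)
      Y.kernel_iff[unfolded all_coefficients(2), OF X[OF that(1)] X[OF that(2)] that(3)] by blast
  then have "left_exact ?S (ModG K A) inclusion_functor"
    unfolding left_exact_def using inclusion_additive
    by (simp add: inclusion_functor_def all_coefficients(2,3))
  moreover have "is_cokernel (ModG K A) M N f c q"
    if "X_comodule K A X M" "X_comodule K A X N" "f \<in> comodule_hom K A M N" "is_cokernel (ModGX K A X) M N f c q"
    for M N c :: "('k, 'a, 'm) comodule" and f q
    using that(4) X[of c]
    unfolding cokernel_iff[OF that(1-3)] all_coefficients(3)
      Y.cokernel_iff[unfolded all_coefficients(2), OF X[OF that(1)] X[OF that(2)] that(3)] by blast
  then have "right_exact ?S (ModG K A) inclusion_functor"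
    unfolding right_exact_def using inclusion_additive
    by (simp add: inclusion_functor_def all_coefficients(2,3))
  ultimately show ?thesis
    using ModGX_abelian by (simp add: abelian_subcategory_def)
qed

end

theorem theorem2p4:
  fixes K :: "'k ring" and A :: "('k, 'a) hopf_algebra" and X :: "'a set" and p :: nat
    and \<C> \<C>\<^sub>X :: "(('k, 'a, 'm::infinite) comodule, 'm \<Rightarrow> 'm) preadditive"
  defines "\<C> \<equiv> ModG K A" and "\<C>\<^sub>X \<equiv> ModGX K A X"
  assumes "field K" and "p > 0" and "has_characteristic K p"
    and "affine_group_scheme K A" and "finite_type K A"
    and "submodule X K A"
  shows "(abelian_subcategory \<C>\<^sub>X \<C> \<and>
          (\<forall>J :: ('m, 'm) category. filtered_category J \<longrightarrow> closed_under_colimits_of J \<C>\<^sub>X \<C>)) \<and>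
         ((\<forall>M\<in>Obj \<C>. subcomodule K A M (X_part_carrier K A X M)) \<and>
          is_functor \<C> \<C>\<^sub>X (X_part_functor K A X)) \<and>
         (left_exact \<C> \<C>\<^sub>X (X_part_functor K A X) \<and>
          right_adjoint \<C>\<^sub>X \<C> inclusion_functor (X_part_functor K A X))"
proof -
  interpret affine_group_scheme_subspace K A X
    using assms by (simp add: affine_group_scheme_subspace_def affine_group_scheme_subspace_axioms_def)
  have "subcomodule K A M (X_part_carrier K A X M)" if "M \<in> Obj \<C>" for M
    using that X_subcomodule_iff[of M "X_part_carrier K A X M"] X_subcomodule_X_part[of M]
    by (simp add: \<C>_def all_coefficients(2,3))
  moreover have "closed_under_colimits_of J \<C>\<^sub>X \<C>" if "filtered_category J" for J :: "('m, 'm) category"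
    unfolding \<C>_def \<C>\<^sub>X_def all_coefficients(3) by (rule closed_under_filtered_colimits[OF that A_subspace X_subset])
  ultimately show ?thesis
    unfolding \<C>_def \<C>\<^sub>X_def
    using ModGX_abelian_subcategory X_part_is_functor X_part_left_exact X_part_right_adjoint by blast
qed

end
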